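(* Let $K$ be a field of characteristic zero, $A$ a commutative associative unital $K$-algebra and $(G,\rho)$ a Lie--Rinehart algebra over $A$. Then the triple \[ \left(\bigwedge_A G,\wedge,[\cdot,\cdot]_{SN}\right), \] where $[\cdot,\cdot]_{SN}$ is the Schouten--Nijenhuis bracket, is a Gerstenhaber algebra.
   Context: A Lie--Rinehart algebra over $A$ is an $A$-module $G$ endowed with a $K$-Lie bracket $[\cdot,\cdot]$ and an $A$-linear map $\rho:G\to\operatorname{Der}_K(A)$ (the anchor) that is a morphism of $K$-Lie algebras, such that $[x,ay]=a[x,y]+\rho(x)(a)y$ for all $a\in A$, $x,y\in G$. $\bigwedge_AG=\bigoplus_{p\ge0}\bigwedge_A^pG$ is the exterior algebra over $A$, with $\bigwedge_A^0G=A$, $\bigwedge_A^1G=G$ and zero in negative degrees. A Gerstenhaber algebra is a graded commutative associative algebra $(\mathcal G,\wedge)$ (here over $K$) endowed with a $K$-bilinear bracket of degree $-1$, i.e. $[\mathcal G^p,\mathcal G^q]\subseteq\mathcal G^{p+q-1}$, such that for homogeneous $P\in\mathcal G^p$, $Q\in\mathcal G^q$, $R\in\mathcal G^r$, \[ [P,Q]=-(-1)^{(p-1)(q-1)}[Q,P], \] \[ (-1)^{(p-1)(r-1)}[P,[Q,R]]+(-1)^{(q-1)(p-1)}[Q,[R,P]]+(-1)^{(r-1)(q-1)}[R,[P,Q]]=0, \] \[ [P,Q\wedge R]=[P,Q]\wedge R+(-1)^{(p-1)q}Q\wedge[P,R]. \] The Schouten--Nijenhuis bracket $[\cdot,\cdot]_{SN}$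 is the (well-defined) $K$-bilinear map on $\bigwedge_AG$ given on decomposable elements as follows. For $X=x_1\wedge\cdots\wedge x_p$ and $Y=y_1\wedge\cdots\wedge y_q$ with $x_i,y_j\in G$, let $\widehat X_i$ be $X$ with the factor $x_i$ omitted ($\widehat X_1=1$ if $p=1$), and similarly $\widehat Y_j$. For $p,q\ge1$, \[ [X,Y]_{SN}=\sum_{i=1}^p\sum_{j=1}^q(-1)^{i+j}[x_i,y_j]\wedge\widehat X_i\wedge\widehat Y_j . \] For $a\in A$ and $p\ge1$, \[ [X,a]_{SN}=\sum_{i=1}^p(-1)^{p-i}\rho(x_i)(a)\,\widehat X_i,\qquad [a,X]_{SN}=\sum_{i=1}^p(-1)^{i}\rho(x_i)(a)\,\widehat X_i . \] For $a,b\in A$, $[a,b]_{SN}=0$. *)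

theory Defs
  imports "HOL-Algebra.Module" "HOL-Algebra.QuotRing"
begin

section \<open>Lie--Rinehart algebras\<close>

text \<open>If \<open>A\<close> is a \<open>K\<close>-algebra, an \<open>A\<close>-module \<open>M\<close> is a \<open>K\<close>-module through \<open>k \<mapsto> k 1\<^sub>A\<close>.\<close>

definition restrict_scalars ::
    "('k, 'a, 'm) module_scheme \<Rightarrow> ('a, 'b, 'n) module_scheme \<Rightarrow> ('k, 'b) module" where
  "restrict_scalars A M =
     \<lparr>carrier = carrier M, mult = mult M, one = one M, zero = zero M, add = add M,
      smult = (\<lambda>k x. (k \<odot>\<^bsub>A\<^esub> \<one>\<^bsub>A\<^esub>) \<odot>\<^bsub>M\<^esub> x)\<rparr>"

definition bilinear_op ::
    "('k, 'm) ring_scheme \<Rightarrow> ('k, 'b, 'n) module_scheme \<Rightarrow> ('b \<Rightarrow> 'b \<Rightarrow> 'b) \<Rightarrow> bool" where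
  "bilinear_op K M f \<longleftrightarrow>
     f \<in> carrier M \<rightarrow> carrier M \<rightarrow> carrier M \<and>
     (\<forall>x\<in>carrier M. \<forall>y\<in>carrier M. \<forall>z\<in>carrier M.
        f (x \<oplus>\<^bsub>M\<^esub> y) z = f x z \<oplus>\<^bsub>M\<^esub> f y z \<and>
        f x (y \<oplus>\<^bsub>M\<^esub> z) = f x y \<oplus>\<^bsub>M\<^esub> f x z) \<and>
     (\<forall>k\<in>carrier K. \<forall>x\<in>carrier M. \<forall>y\<in>carrier M.
        f (k \<odot>\<^bsub>M\<^esub> x) y = k \<odot>\<^bsub>M\<^esub> f x y \<and>
        f x (k \<odot>\<^bsub>M\<^esub> y) = k \<odot>\<^bsub>M\<^esub> f x y)"

locale lie_algebra =
  fixes K :: "('k, 'm) ring_scheme"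
    and L :: "('k, 'b, 'n) module_scheme"
    and br :: "'b \<Rightarrow> 'b \<Rightarrow> 'b"
  assumes module: "module K L"
    and bilinear: "bilinear_op K L br"
    and alternating: "x \<in> carrier L \<Longrightarrow> br x x = \<zero>\<^bsub>L\<^esub>"
    and jacobi: "\<lbrakk>x \<in> carrier L; y \<in> carrier L; z \<in> carrier L\<rbrakk> \<Longrightarrow>
      br x (br y z) \<oplus>\<^bsub>L\<^esub> br y (br z x) \<oplus>\<^bsub>L\<^esub> br z (br x y) = \<zero>\<^bsub>L\<^esub>"

definition derivations ::
    "('k, 'm) ring_scheme \<Rightarrow> ('k, 'a, 'n) module_scheme \<Rightarrow> ('a \<Rightarrow> 'a) set" where
  "derivations K A =
     {D \<in> carrier A \<rightarrow> carrier A.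
        (\<forall>a\<in>carrier A. \<forall>b\<in>carrier A. D (a \<oplus>\<^bsub>A\<^esub> b) = D a \<oplus>\<^bsub>A\<^esub> D b) \<and>
        (\<forall>k\<in>carrier K. \<forall>a\<in>carrier A. D (k \<odot>\<^bsub>A\<^esub> a) = k \<odot>\<^bsub>A\<^esub> D a) \<and>
        (\<forall>a\<in>carrier A. \<forall>b\<in>carrier A.
           D (a \<otimes>\<^bsub>A\<^esub> b) = a \<otimes>\<^bsub>A\<^esub> D b \<oplus>\<^bsub>A\<^esub> D a \<otimes>\<^bsub>A\<^esub> b)}"

text \<open>Derivations are compared pointwise on the carrier of \<open>A\<close>; the Lie bracket on derivations
  is the commutator.\<close>

locale lie_rinehart =
  fixes K :: "('k, 'm) ring_scheme"
    and A :: "('k, 'a, 'n) module_scheme"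
    and G :: "('a, 'g, 'l) module_scheme"
    and br :: "'g \<Rightarrow> 'g \<Rightarrow> 'g"
    and \<rho> :: "'g \<Rightarrow> 'a \<Rightarrow> 'a"
  assumes algebra: "algebra K A"
    and module: "module A G"
    and lie_algebra: "lie_algebra K (restrict_scalars A G) br"
    and anchor_closed: "\<rho> \<in> carrier G \<rightarrow> derivations K A"
    and anchor_add: "\<lbrakk>x \<in> carrier G; y \<in> carrier G; a \<in> carrier A\<rbrakk> \<Longrightarrow>
      \<rho> (x \<oplus>\<^bsub>G\<^esub> y) a = \<rho> x a \<oplus>\<^bsub>A\<^esub> \<rho> y a"
    and anchor_smult: "\<lbrakk>b \<in> carrier A; x \<in> carrier G; a \<in> carrier A\<rbrakk> \<Longrightarrow>
      \<rho> (b \<odot>\<^bsub>G\<^esub> x) a = b \<otimes>\<^bsub>A\<^esub> \<rho> x a"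
    and anchor_bracket: "\<lbrakk>x \<in> carrier G; y \<in> carrier G; a \<in> carrier A\<rbrakk> \<Longrightarrow>
      \<rho> (br x y) a = \<rho> x (\<rho> y a) \<ominus>\<^bsub>A\<^esub> \<rho> y (\<rho> x a)"
    and leibniz: "\<lbrakk>x \<in> carrier G; y \<in> carrier G; a \<in> carrier A\<rbrakk> \<Longrightarrow>
      br x (a \<odot>\<^bsub>G\<^esub> y) = a \<odot>\<^bsub>G\<^esub> br x y \<oplus>\<^bsub>G\<^esub> \<rho> x a \<odot>\<^bsub>G\<^esub> y"

section \<open>The exterior algebra of a module\<close>

text \<open>The free associative unital \<open>A\<close>-algebra on a set \<open>S\<close>: finitely supported functions from
  words over \<open>S\<close> to \<open>A\<close>, with the convolution product over all splittings of a word.\<close>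

definition free_algebra ::
    "('a, 'm) ring_scheme \<Rightarrow> 'g set \<Rightarrow> ('a, 'g list \<Rightarrow> 'a) module" where
  "free_algebra A S =
     \<lparr>carrier = {f. (\<forall>w\<in>lists S. f w \<in> carrier A) \<and> (\<forall>w. w \<notin> lists S \<longrightarrow> f w = \<zero>\<^bsub>A\<^esub>) \<and>
                    finite {w. f w \<noteq> \<zero>\<^bsub>A\<^esub>}},
      mult = (\<lambda>f g w. \<Oplus>\<^bsub>A\<^esub>k\<in>{..length w}. f (take k w) \<otimes>\<^bsub>A\<^esub> g (drop k w)),
      one = (\<lambda>w. if w = [] then \<one>\<^bsub>A\<^esub> else \<zero>\<^bsub>A\<^esub>),
      zero = (\<lambda>w. \<zero>\<^bsub>A\<^esub>),
      add = (\<lambda>f g w. f w \<oplus>\<^bsub>A\<^esub> g w),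
      smult = (\<lambda>a f w. a \<otimes>\<^bsub>A\<^esub> f w)\<rparr>"

definition word :: "('a, 'm) ring_scheme \<Rightarrow> 'g list \<Rightarrow> 'g list \<Rightarrow> 'a" where
  "word A u = (\<lambda>w. if w = u then \<one>\<^bsub>A\<^esub> else \<zero>\<^bsub>A\<^esub>)"

text \<open>Dividing the free \<open>A\<close>-algebra on the underlying set of \<open>G\<close> by the first two families of
  relations gives the tensor algebra of the \<open>A\<close>-module \<open>G\<close>; the third family is
  \<open>x \<otimes> x = 0\<close>.\<close>

definition ext_ideal ::
    "('a, 'm) ring_scheme \<Rightarrow> ('a, 'g, 'n) module_scheme \<Rightarrow> ('g list \<Rightarrow> 'a) set" where
  "ext_ideal A G = (let F = free_algebra A (carrier G) in
     Idl\<^bsub>F\<^esub>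
       ({word A [x \<oplus>\<^bsub>G\<^esub> y] \<ominus>\<^bsub>F\<^esub> (word A [x] \<oplus>\<^bsub>F\<^esub> word A [y]) | x y.
           x \<in> carrier G \<and> y \<in> carrier G} \<union>
        {word A [a \<odot>\<^bsub>G\<^esub> x] \<ominus>\<^bsub>F\<^esub> a \<odot>\<^bsub>F\<^esub> word A [x] | a x.
           a \<in> carrier A \<and> x \<in> carrier G} \<union>
        {word A [x, x] | x. x \<in> carrier G}))"

definition ext_class ::
    "('a, 'm) ring_scheme \<Rightarrow> ('a, 'g, 'n) module_scheme \<Rightarrow> ('g list \<Rightarrow> 'a)
      \<Rightarrow> ('g list \<Rightarrow> 'a) set" where
  "ext_class A G f = ext_ideal A G +>\<^bsub>free_algebra A (carrier G)\<^esub> f"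

definition ext_const ::
    "('a, 'm) ring_scheme \<Rightarrow> ('a, 'g, 'n) module_scheme \<Rightarrow> 'a \<Rightarrow> ('g list \<Rightarrow> 'a) set" where
  "ext_const A G a = ext_class A G (a \<odot>\<^bsub>free_algebra A (carrier G)\<^esub> word A [])"

definition ext_algebra ::
    "('a, 'm) ring_scheme \<Rightarrow> ('a, 'g, 'n) module_scheme
      \<Rightarrow> ('a, ('g list \<Rightarrow> 'a) set) module" where
  "ext_algebra A G = (let E = free_algebra A (carrier G) Quot ext_ideal A G in
     \<lparr>carrier = carrier E, mult = mult E, one = one E, zero = zero E, add = add E,
      smult = (\<lambda>a P. ext_const A G a \<otimes>\<^bsub>E\<^esub> P)\<rparr>)"

text \<open>Exterior powers, indexed by the integers: \<open>ext_power A G p\<close> is the image of the linear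
  combinations of words of length \<open>p\<close>, hence zero for negative \<open>p\<close>.\<close>

definition ext_power ::
    "('a, 'm) ring_scheme \<Rightarrow> ('a, 'g, 'n) module_scheme \<Rightarrow> int
      \<Rightarrow> ('g list \<Rightarrow> 'a) set set" where
  "ext_power A G p = ext_class A G `
     {f \<in> carrier (free_algebra A (carrier G)). \<forall>w. int (length w) \<noteq> p \<longrightarrow> f w = \<zero>\<^bsub>A\<^esub>}"

text \<open>\<open>wedge A G [x\<^sub>1, \<dots>, x\<^sub>p]\<close> is \<open>x\<^sub>1 \<and> \<dots> \<and> x\<^sub>p\<close>, and \<open>1\<close> for the empty list.\<close>

definition wedge ::
    "('a, 'm) ring_scheme \<Rightarrow> ('a, 'g, 'n) module_scheme \<Rightarrow> 'g list
      \<Rightarrow> ('g list \<Rightarrow> 'a) set" where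
  "wedge A G xs =
     foldr (\<lambda>x P. ext_class A G (word A [x]) \<otimes>\<^bsub>ext_algebra A G\<^esub> P) xs \<one>\<^bsub>ext_algebra A G\<^esub>"

section \<open>Gerstenhaber algebras\<close>

text \<open>\<open>sign_pow E n x\<close> is \<open>(-1)\<^sup>n x\<close>.\<close>

definition sign_pow :: "('e, 'm) ring_scheme \<Rightarrow> int \<Rightarrow> 'e \<Rightarrow> 'e" where
  "sign_pow E n x = (if even n then x else \<ominus>\<^bsub>E\<^esub> x)"

locale graded_commutative_algebra =
  fixes K :: "('k, 'm) ring_scheme"
    and E :: "('k, 'e, 'n) module_scheme"
    and gr :: "int \<Rightarrow> 'e set"
  assumes module: "module K E"
    and ring: "ring E"
    and mult_bilinear: "bilinear_op K E (mult E)"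
    and submodule: "submodule (gr p) K E"
    and direct_sum: "x \<in> carrier E \<Longrightarrow>
      \<exists>!c. (\<forall>p. c p \<in> gr p) \<and> finite {p. c p \<noteq> \<zero>\<^bsub>E\<^esub>} \<and>
           x = (\<Oplus>\<^bsub>E\<^esub>p\<in>{p. c p \<noteq> \<zero>\<^bsub>E\<^esub>}. c p)"
    and mult_degree: "\<lbrakk>P \<in> gr p; Q \<in> gr q\<rbrakk> \<Longrightarrow> P \<otimes>\<^bsub>E\<^esub> Q \<in> gr (p + q)"
    and graded_commute: "\<lbrakk>P \<in> gr p; Q \<in> gr q\<rbrakk> \<Longrightarrow>
      P \<otimes>\<^bsub>E\<^esub> Q = sign_pow E (p * q) (Q \<otimes>\<^bsub>E\<^esub> P)"

locale gerstenhaber_algebra = graded_commutative_algebra K E gr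
  for K :: "('k, 'm) ring_scheme"
    and E :: "('k, 'e, 'n) module_scheme"
    and gr :: "int \<Rightarrow> 'e set" +
  fixes br :: "'e \<Rightarrow> 'e \<Rightarrow> 'e"
  assumes bracket_bilinear: "bilinear_op K E br"
    and bracket_degree: "\<lbrakk>P \<in> gr p; Q \<in> gr q\<rbrakk> \<Longrightarrow> br P Q \<in> gr (p + q - 1)"
    and graded_antisym: "\<lbrakk>P \<in> gr p; Q \<in> gr q\<rbrakk> \<Longrightarrow>
      br P Q = \<ominus>\<^bsub>E\<^esub> sign_pow E ((p - 1) * (q - 1)) (br Q P)"
    and graded_jacobi: "\<lbrakk>P \<in> gr p; Q \<in> gr q; R \<in> gr r\<rbrakk> \<Longrightarrow>
      sign_pow E ((p - 1) * (r - 1)) (br P (br Q R)) \<oplus>\<^bsub>E\<^esub>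
      sign_pow E ((q - 1) * (p - 1)) (br Q (br R P)) \<oplus>\<^bsub>E\<^esub>
      sign_pow E ((r - 1) * (q - 1)) (br R (br P Q)) = \<zero>\<^bsub>E\<^esub>"
    and graded_leibniz: "\<lbrakk>P \<in> gr p; Q \<in> gr q; R \<in> gr r\<rbrakk> \<Longrightarrow>
      br P (Q \<otimes>\<^bsub>E\<^esub> R) =
        br P Q \<otimes>\<^bsub>E\<^esub> R \<oplus>\<^bsub>E\<^esub> sign_pow E ((p - 1) * q) (Q \<otimes>\<^bsub>E\<^esub> br P R)"

section \<open>The Schouten--Nijenhuis bracket\<close>

text \<open>Indices start at 1, so the \<open>i\<close>-th entry of \<open>xs\<close> is \<open>xs ! (i - 1)\<close>.\<close>

definition omit :: "nat \<Rightarrow> 'b list \<Rightarrow> 'b list" where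
  "omit i xs = take (i - 1) xs @ drop i xs"

definition is_schouten_bracket ::
    "('k, 'm) ring_scheme \<Rightarrow> ('k, 'a, 'n) module_scheme \<Rightarrow> ('a, 'g, 'l) module_scheme \<Rightarrow>
     ('g \<Rightarrow> 'g \<Rightarrow> 'g) \<Rightarrow> ('g \<Rightarrow> 'a \<Rightarrow> 'a) \<Rightarrow>
     (('g list \<Rightarrow> 'a) set \<Rightarrow> ('g list \<Rightarrow> 'a) set \<Rightarrow> ('g list \<Rightarrow> 'a) set) \<Rightarrow> bool" where
  "is_schouten_bracket K A G br \<rho> B \<longleftrightarrow> (let E = ext_algebra A G in
     bilinear_op K (restrict_scalars A E) B \<and>
     (\<forall>xs\<in>lists (carrier G). \<forall>ys\<in>lists (carrier G). xs \<noteq> [] \<longrightarrow> ys \<noteq> [] \<longrightarrow>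
        B (wedge A G xs) (wedge A G ys) =
          (\<Oplus>\<^bsub>E\<^esub>i\<in>{1..length xs}. \<Oplus>\<^bsub>E\<^esub>j\<in>{1..length ys}.
             sign_pow E (int i + int j)
               (wedge A G [br (xs ! (i - 1)) (ys ! (j - 1))] \<otimes>\<^bsub>E\<^esub>
                wedge A G (omit i xs) \<otimes>\<^bsub>E\<^esub> wedge A G (omit j ys)))) \<and>
     (\<forall>xs\<in>lists (carrier G). \<forall>a\<in>carrier A. xs \<noteq> [] \<longrightarrow>
        B (wedge A G xs) (ext_const A G a) =
          (\<Oplus>\<^bsub>E\<^esub>i\<in>{1..length xs}.
             sign_pow E (int (length xs) - int i)
               (\<rho> (xs ! (i - 1)) a \<odot>\<^bsub>E\<^esub> wedge A G (omit i xs))) \<and>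
        B (ext_const A G a) (wedge A G xs) =
          (\<Oplus>\<^bsub>E\<^esub>i\<in>{1..length xs}.
             sign_pow E (int i)
               (\<rho> (xs ! (i - 1)) a \<odot>\<^bsub>E\<^esub> wedge A G (omit i xs)))) \<and>
     (\<forall>a\<in>carrier A. \<forall>b\<in>carrier A. B (ext_const A G a) (ext_const A G b) = \<zero>\<^bsub>E\<^esub>))"

text \<open>The conditions determine the bracket on the exterior algebra only; the extensionality
  clauses fix the junk values outside the carrier, without which the description could not be
  unique.\<close>

definition schouten_bracket ::
    "('k, 'm) ring_scheme \<Rightarrow> ('k, 'a, 'n) module_scheme \<Rightarrow> ('a, 'g, 'l) module_scheme \<Rightarrow>
     ('g \<Rightarrow> 'g \<Rightarrow> 'g) \<Rightarrow> ('g \<Rightarrow> 'a \<Rightarrow> 'a) \<Rightarrow>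
     ('g list \<Rightarrow> 'a) set \<Rightarrow> ('g list \<Rightarrow> 'a) set \<Rightarrow> ('g list \<Rightarrow> 'a) set" where
  "schouten_bracket K A G br \<rho> =
     (THE B. is_schouten_bracket K A G br \<rho> B \<and>
        B \<in> extensional (carrier (ext_algebra A G)) \<and>
        (\<forall>P\<in>carrier (ext_algebra A G). B P \<in> extensional (carrier (ext_algebra A G))))"

end

theory Submission
  imports Defs
begin

text \<open>A graded derivation of \<open>\<And>\<^sub>A G\<close> is determined by its values on \<open>A\<close> and \<open>G\<close>, and it can be
  prescribed there by any pair of additive maps that is compatible with the products \<open>a b\<close>
  and \<open>a x\<close>; the relation \<open>x \<and> x = 0\<close> takes care of itself by graded commutativity.
  This yields in turn the derivations \<open>[a, \<cdot>]\<close> and \<open>[x, \<cdot>]\<close> for \<open>a \<in> A\<close> and \<open>x \<in> G\<close>, and then, for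
  homogeneous \<open>P\<close> of degree \<open>p\<close>, the derivation \<open>[P, \<cdot>]\<close> of degree \<open>p - 1\<close> with
  \<open>[P, a] = (-1)\<^sup>p [a, P]\<close> and \<open>[P, x] = - [x, P]\<close>. The Leibniz rule in the second argument thus holds
  by construction. All other identities compare graded derivations, so it suffices to check them
  on generators: first the Leibniz rule in the first argument, then antisymmetry, and finally the
  Jacobi identity, whose cyclic form allows one argument after another to be replaced by a
  generator, until only the axioms of a Lie--Rinehart algebra remain. Since a derivation of
  \<open>y\<^sub>1 \<and> \<dots> \<and> y\<^sub>q\<close> expands into a sum over the factors, the bracket is given on decomposable elements
  by the defining formulas, which characterise it because such elements span.\<close>

section \<open>The free algebra\<close>

text \<open>The bracket is not bilinear over A, since \<open>[x, a y]\<close> contains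
  \<open>\<rho> x a\<close> times y, so the usual extension of A-linear maps to the exterior algebra
  does not produce it. Derivations are therefore built on the free algebra over the underlying set
  of G, where words with coefficients can be given values freely, as maps into the exterior algebra;
  the work lies in showing that they kill the ideal. Elements of A count as generators of degree 0
  with values of their own. To prescribe \<open>[P, \<cdot>]\<close> on \<open>a b\<close> and on
  \<open>a x\<close>, the product rules of \<open>[a b, P]\<close> and \<open>[a x, P]\<close> must
  be known already. This is why the brackets with a and with x on the left are constructed
  separately, as full derivations, before a general P is treated. The signs \<open>(-1)^p\<close>
  and -1 are graded antisymmetry for the degrees (p, 0) and (p, 1). The first depends on p, which an
  element does not determine because zero has every degree. Degrees are therefore carried as
  explicit arguments, and an arbitrary P is split into its components.\<close>

locale exterior_algebra = A: cring A + G: module A G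
  for A :: "('a, 'm) ring_scheme" and G :: "('a, 'g, 'n) module_scheme"
begin

abbreviation "F \<equiv> free_algebra A (carrier G)"
abbreviation "I \<equiv> ext_ideal A G"
abbreviation "E \<equiv> ext_algebra A G"

lemma F_carrier: "f \<in> carrier F \<longleftrightarrow>
    range f \<subseteq> carrier A \<and> (\<forall>w. w \<notin> lists (carrier G) \<longrightarrow> f w = \<zero>\<^bsub>A\<^esub>) \<and> finite {w. f w \<noteq> \<zero>\<^bsub>A\<^esub>}"
  by (auto simp: free_algebra_def image_subset_iff) (metis A.zero_closed)

lemma F_val [simp, intro]: "f \<in> carrier F \<Longrightarrow> f w \<in> carrier A"
  by (auto simp: F_carrier)

lemma F_ops: "mult F f g w = (\<Oplus>\<^bsub>A\<^esub> k\<in>{..length w}. f (take k w) \<otimes>\<^bsub>A\<^esub> g (drop k w))"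
    "(f \<oplus>\<^bsub>F\<^esub> g) w = f w \<oplus>\<^bsub>A\<^esub> g w" "(a \<odot>\<^bsub>F\<^esub> f) w = a \<otimes>\<^bsub>A\<^esub> f w" "\<zero>\<^bsub>F\<^esub> w = \<zero>\<^bsub>A\<^esub>"
    "\<one>\<^bsub>F\<^esub> w = (if w = [] then \<one>\<^bsub>A\<^esub> else \<zero>\<^bsub>A\<^esub>)"
  unfolding free_algebra_def by (simp_all only: ring_record_simps module.simps)

text \<open>The identities of convolution are proved for all functions with values in A. Recursion
  on words passes to the shifts \<open>\<lambda>u. f (x # u)\<close>, and with this weak condition
  no support has to be inspected along the way.\<close>

abbreviation total :: "('g list \<Rightarrow> 'a) \<Rightarrow> bool" where
  "total f \<equiv> \<forall>w. f w \<in> carrier A"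

lemma conv_closed: "total f \<Longrightarrow> total g \<Longrightarrow> total (f \<otimes>\<^bsub>F\<^esub> g)"
  by (auto simp: F_ops intro!: A.finsum_closed)

lemma conv_Nil: "total f \<Longrightarrow> total g \<Longrightarrow> (f \<otimes>\<^bsub>F\<^esub> g) [] = f [] \<otimes>\<^bsub>A\<^esub> g []"
  by (simp add: F_ops)

text \<open>A splitting of \<open>x # w\<close> either has an empty left part or is a splitting of w
  with x pushed onto the left part. Convolution thus becomes recursive in the word.\<close>

lemma conv_Cons:
  assumes "total f" "total g"
  shows "(f \<otimes>\<^bsub>F\<^esub> g) (x # w) = f [] \<otimes>\<^bsub>A\<^esub> g (x # w) \<oplus>\<^bsub>A\<^esub> ((\<lambda>u. f (x # u)) \<otimes>\<^bsub>F\<^esub> g) w"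
proof -
  have "(f \<otimes>\<^bsub>F\<^esub> g) (x # w) = (\<Oplus>\<^bsub>A\<^esub> k\<in>{..Suc (length w)}. f (take k (x # w)) \<otimes>\<^bsub>A\<^esub> g (drop k (x # w)))"
    by (simp only: F_ops list.size) simp
  also have "\<dots> = (\<Oplus>\<^bsub>A\<^esub> k\<in>{..length w}. f (x # take k w) \<otimes>\<^bsub>A\<^esub> g (drop k w)) \<oplus>\<^bsub>A\<^esub> f [] \<otimes>\<^bsub>A\<^esub> g (x # w)"
    using assms by (subst A.finsum_Suc2) auto
  finally show ?thesis
    using assms by (simp add: F_ops(1) A.a_comm)
qed

lemma conv_add_left:
  assumes "total f" "total f'" "total g"
  shows "((f \<oplus>\<^bsub>F\<^esub> f') \<otimes>\<^bsub>F\<^esub> g) w = (f \<otimes>\<^bsub>F\<^esub> g) w \<oplus>\<^bsub>A\<^esub> (f' \<otimes>\<^bsub>F\<^esub> g) w"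
proof -
  have "((f \<oplus>\<^bsub>F\<^esub> f') \<otimes>\<^bsub>F\<^esub> g) w
      = (\<Oplus>\<^bsub>A\<^esub> k\<in>{..length w}. f (take k w) \<otimes>\<^bsub>A\<^esub> g (drop k w) \<oplus>\<^bsub>A\<^esub> f' (take k w) \<otimes>\<^bsub>A\<^esub> g (drop k w))"
    using assms by (simp add: F_ops A.l_distr)
  also have "\<dots> = (f \<otimes>\<^bsub>F\<^esub> g) w \<oplus>\<^bsub>A\<^esub> (f' \<otimes>\<^bsub>F\<^esub> g) w"
    unfolding F_ops(1) using assms by (intro A.finsum_addf) auto
  finally show ?thesis .
qed

lemma conv_add_right:
  assumes "total f" "total g'" "total g"
  shows "(f \<otimes>\<^bsub>F\<^esub> (g \<oplus>\<^bsub>F\<^esub> g')) w = (f \<otimes>\<^bsub>F\<^esub> g) w \<oplus>\<^bsub>A\<^esub> (f \<otimes>\<^bsub>F\<^esub> g') w"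
proof -
  have "(f \<otimes>\<^bsub>F\<^esub> (g \<oplus>\<^bsub>F\<^esub> g')) w
      = (\<Oplus>\<^bsub>A\<^esub> k\<in>{..length w}. f (take k w) \<otimes>\<^bsub>A\<^esub> g (drop k w) \<oplus>\<^bsub>A\<^esub> f (take k w) \<otimes>\<^bsub>A\<^esub> g' (drop k w))"
    using assms by (simp add: F_ops A.r_distr)
  also have "\<dots> = (f \<otimes>\<^bsub>F\<^esub> g) w \<oplus>\<^bsub>A\<^esub> (f \<otimes>\<^bsub>F\<^esub> g') w"
    unfolding F_ops(1) using assms by (intro A.finsum_addf) auto
  finally show ?thesis .
qed

lemma conv_smult_left:
  assumes "total f" "total g" "a \<in> carrier A"
  shows "((a \<odot>\<^bsub>F\<^esub> f) \<otimes>\<^bsub>F\<^esub> g) w = a \<otimes>\<^bsub>A\<^esub> (f \<otimes>\<^bsub>F\<^esub> g) w"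
proof -
  have "((a \<odot>\<^bsub>F\<^esub> f) \<otimes>\<^bsub>F\<^esub> g) w = (\<Oplus>\<^bsub>A\<^esub> k\<in>{..length w}. a \<otimes>\<^bsub>A\<^esub> (f (take k w) \<otimes>\<^bsub>A\<^esub> g (drop k w)))"
    using assms by (simp add: F_ops A.m_assoc)
  also have "\<dots> = a \<otimes>\<^bsub>A\<^esub> (f \<otimes>\<^bsub>F\<^esub> g) w"
    unfolding F_ops(1) using assms by (intro A.finsum_rdistr[symmetric]) auto
  finally show ?thesis .
qed

lemma conv_zero_left: "total g \<Longrightarrow> ((\<lambda>u. \<zero>\<^bsub>A\<^esub>) \<otimes>\<^bsub>F\<^esub> g) w = \<zero>\<^bsub>A\<^esub>"
  by (simp add: F_ops)

text \<open>The shift of a product by one letter is \<open>f []\<close> times the shift of g, plus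
  the product of the shift of f with g. Left linearity and the induction hypothesis for the shifted
  f then settle the case \<open>x # w\<close>; this is why f is generalised.\<close>

lemma conv_assoc:
  assumes "total f" "total g" "total h"
  shows "((f \<otimes>\<^bsub>F\<^esub> g) \<otimes>\<^bsub>F\<^esub> h) w = (f \<otimes>\<^bsub>F\<^esub> (g \<otimes>\<^bsub>F\<^esub> h)) w"
  using assms
proof (induction w arbitrary: f g)
  case Nil
  then show ?case by (simp add: conv_Nil conv_closed A.m_assoc)
next
  case (Cons x w)
  let ?fx = "\<lambda>u. f (x # u)" and ?gx = "\<lambda>u. g (x # u)"
  have fg: "(\<lambda>u. (f \<otimes>\<^bsub>F\<^esub> g) (x # u)) = (f [] \<odot>\<^bsub>F\<^esub> ?gx) \<oplus>\<^bsub>F\<^esub> (?fx \<otimes>\<^bsub>F\<^esub> g)"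
    using Cons.prems by (auto simp: conv_Cons F_ops(2,3))
  have t: "total (f [] \<odot>\<^bsub>F\<^esub> ?gx)" "total (?fx \<otimes>\<^bsub>F\<^esub> g)" "total (f \<otimes>\<^bsub>F\<^esub> g)" "total (g \<otimes>\<^bsub>F\<^esub> h)"
    "total ((?fx \<otimes>\<^bsub>F\<^esub> g) \<otimes>\<^bsub>F\<^esub> h)" "total (?gx \<otimes>\<^bsub>F\<^esub> h)" "total (?fx \<otimes>\<^bsub>F\<^esub> (g \<otimes>\<^bsub>F\<^esub> h))"
    using Cons.prems by (simp_all add: F_ops(3) conv_closed)
  have "((f \<otimes>\<^bsub>F\<^esub> g) \<otimes>\<^bsub>F\<^esub> h) (x # w)
      = f [] \<otimes>\<^bsub>A\<^esub> g [] \<otimes>\<^bsub>A\<^esub> h (x # w) \<oplus>\<^bsub>A\<^esub> (f [] \<otimes>\<^bsub>A\<^esub> (?gx \<otimes>\<^bsub>F\<^esub> h) w \<oplus>\<^bsub>A\<^esub> ((?fx \<otimes>\<^bsub>F\<^esub> g) \<otimes>\<^bsub>F\<^esub> h) w)"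
    using Cons.prems t by (simp add: conv_Cons[OF t(3)] fg conv_add_left conv_smult_left conv_Nil)
  also have "((?fx \<otimes>\<^bsub>F\<^esub> g) \<otimes>\<^bsub>F\<^esub> h) w = (?fx \<otimes>\<^bsub>F\<^esub> (g \<otimes>\<^bsub>F\<^esub> h)) w"
    using Cons.prems by (intro Cons.IH) auto
  also have "f [] \<otimes>\<^bsub>A\<^esub> g [] \<otimes>\<^bsub>A\<^esub> h (x # w) \<oplus>\<^bsub>A\<^esub> (f [] \<otimes>\<^bsub>A\<^esub> (?gx \<otimes>\<^bsub>F\<^esub> h) w \<oplus>\<^bsub>A\<^esub> (?fx \<otimes>\<^bsub>F\<^esub> (g \<otimes>\<^bsub>F\<^esub> h)) w)
      = f [] \<otimes>\<^bsub>A\<^esub> (g \<otimes>\<^bsub>F\<^esub> h) (x # w) \<oplus>\<^bsub>A\<^esub> (?fx \<otimes>\<^bsub>F\<^esub> (g \<otimes>\<^bsub>F\<^esub> h)) w"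
    using Cons.prems t by (simp add: conv_Cons A.r_distr A.m_assoc A.a_assoc)
  also have "\<dots> = (f \<otimes>\<^bsub>F\<^esub> (g \<otimes>\<^bsub>F\<^esub> h)) (x # w)"
    using Cons.prems t by (simp add: conv_Cons[of f])
  finally show ?case .
qed

lemma conv_one_left:
  assumes "total g" shows "(\<one>\<^bsub>F\<^esub> \<otimes>\<^bsub>F\<^esub> g) w = g w"
proof (cases w)
  case (Cons x u)
  have "(\<lambda>u. \<one>\<^bsub>F\<^esub> (x # u)) = (\<lambda>u. \<zero>\<^bsub>A\<^esub>)" by (simp add: F_ops)
  then show ?thesis using assms Cons by (simp add: conv_Cons F_ops(5) conv_zero_left)
qed (use assms in \<open>simp add: conv_Nil F_ops(5)\<close>)

lemma conv_one_right:
  assumes "total f" shows "(f \<otimes>\<^bsub>F\<^esub> \<one>\<^bsub>F\<^esub>) w = f w"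
  using assms
proof (induction w arbitrary: f)
  case (Cons x w)
  have "((\<lambda>u. f (x # u)) \<otimes>\<^bsub>F\<^esub> \<one>\<^bsub>F\<^esub>) w = f (x # w)"
    using Cons by simp
  moreover have "total \<one>\<^bsub>F\<^esub>" "\<one>\<^bsub>F\<^esub> (x # w) = \<zero>\<^bsub>A\<^esub>" by (simp_all add: F_ops(5))
  ultimately show ?case using Cons.prems by (simp add: conv_Cons)
qed (simp add: conv_Nil F_ops(5))

section \<open>Closure properties and the ring structure of the free algebra\<close>

lemma F_closedI:
  assumes "total f" "\<And>w. w \<notin> lists (carrier G) \<Longrightarrow> f w = \<zero>\<^bsub>A\<^esub>"
    and "{w. f w \<noteq> \<zero>\<^bsub>A\<^esub>} \<subseteq> S" "finite S"
  shows "f \<in> carrier F"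
  using assms by (auto simp: F_carrier finite_subset)

lemma F_outside: "f \<in> carrier F \<Longrightarrow> w \<notin> lists (carrier G) \<Longrightarrow> f w = \<zero>\<^bsub>A\<^esub>"
  by (simp add: F_carrier)

lemma F_finite: "f \<in> carrier F \<Longrightarrow> finite {w. f w \<noteq> \<zero>\<^bsub>A\<^esub>}"
  by (simp add: F_carrier)

lemma conv_nonzeroE:
  assumes "total f" "total g" "(f \<otimes>\<^bsub>F\<^esub> g) w \<noteq> \<zero>\<^bsub>A\<^esub>"
  obtains u v where "w = u @ v" "f u \<noteq> \<zero>\<^bsub>A\<^esub>" "g v \<noteq> \<zero>\<^bsub>A\<^esub>"
proof -
  have "\<exists>k. f (take k w) \<otimes>\<^bsub>A\<^esub> g (drop k w) \<noteq> \<zero>\<^bsub>A\<^esub>"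
    using assms(3) by (auto simp: F_ops(1) intro: ccontr)
  then obtain k where "f (take k w) \<otimes>\<^bsub>A\<^esub> g (drop k w) \<noteq> \<zero>\<^bsub>A\<^esub>" ..
  then have "f (take k w) \<noteq> \<zero>\<^bsub>A\<^esub>" "g (drop k w) \<noteq> \<zero>\<^bsub>A\<^esub>"
    using assms(1,2) by auto
  then show thesis using that by (metis append_take_drop_id)
qed

lemma F_mult_closed:
  assumes "f \<in> carrier F" "g \<in> carrier F"
  shows "f \<otimes>\<^bsub>F\<^esub> g \<in> carrier F"
proof -
  show ?thesis
  proof (rule F_closedI[where S = "(\<lambda>(u, v). u @ v) ` ({u. f u \<noteq> \<zero>\<^bsub>A\<^esub>} \<times> {v. g v \<noteq> \<zero>\<^bsub>A\<^esub>})"])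
    show "{w. (f \<otimes>\<^bsub>F\<^esub> g) w \<noteq> \<zero>\<^bsub>A\<^esub>} \<subseteq> (\<lambda>(u, v). u @ v) ` ({u. f u \<noteq> \<zero>\<^bsub>A\<^esub>} \<times> {v. g v \<noteq> \<zero>\<^bsub>A\<^esub>})"
    proof
      fix w assume "w \<in> {w. (f \<otimes>\<^bsub>F\<^esub> g) w \<noteq> \<zero>\<^bsub>A\<^esub>}"
      then have "(f \<otimes>\<^bsub>F\<^esub> g) w \<noteq> \<zero>\<^bsub>A\<^esub>" by simp
      from conv_nonzeroE[OF _ _ this] obtain u v where "w = u @ v" "f u \<noteq> \<zero>\<^bsub>A\<^esub>" "g v \<noteq> \<zero>\<^bsub>A\<^esub>"
        using assms by blast
      then show "w \<in> (\<lambda>(u, v). u @ v) ` ({u. f u \<noteq> \<zero>\<^bsub>A\<^esub>} \<times> {v. g v \<noteq> \<zero>\<^bsub>A\<^esub>})"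
        by force
    qed
    show "total (f \<otimes>\<^bsub>F\<^esub> g)"
      using assms by (intro conv_closed) auto
    fix w assume "w \<notin> lists (carrier G)"
    then show "(f \<otimes>\<^bsub>F\<^esub> g) w = \<zero>\<^bsub>A\<^esub>"
      using assms conv_nonzeroE[of f g w "(f \<otimes>\<^bsub>F\<^esub> g) w = \<zero>\<^bsub>A\<^esub>"] F_outside[of f] F_outside[of g]
      by (metis F_val append_in_lists_conv)
  qed (use assms in \<open>simp add: F_finite\<close>)
qed

lemma F_add_closed: "f \<in> carrier F \<Longrightarrow> g \<in> carrier F \<Longrightarrow> f \<oplus>\<^bsub>F\<^esub> g \<in> carrier F"
  by (rule F_closedI[where S = "{w. f w \<noteq> \<zero>\<^bsub>A\<^esub>} \<union> {w. g w \<noteq> \<zero>\<^bsub>A\<^esub>}"])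
    (auto simp: F_ops(2) F_outside F_finite)

lemma F_smult_closed: "a \<in> carrier A \<Longrightarrow> f \<in> carrier F \<Longrightarrow> a \<odot>\<^bsub>F\<^esub> f \<in> carrier F"
  by (rule F_closedI[where S = "{w. f w \<noteq> \<zero>\<^bsub>A\<^esub>}"])
    (auto simp: F_ops(3) F_outside F_finite)

lemma F_zero_closed: "\<zero>\<^bsub>F\<^esub> \<in> carrier F"
  by (rule F_closedI[where S = "{}"]) (auto simp: F_ops(4))

lemma F_one_closed: "\<one>\<^bsub>F\<^esub> \<in> carrier F"
  by (rule F_closedI[where S = "{[]}"]) (auto simp: F_ops(5))

lemma F_abelian_group: "abelian_group F"
proof (rule abelian_groupI)
  fix f assume f: "f \<in> carrier F"
  have "(\<lambda>w. \<ominus>\<^bsub>A\<^esub> f w) \<in> carrier F"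
    by (rule F_closedI[where S = "{w. f w \<noteq> \<zero>\<^bsub>A\<^esub>}"]) (use f in \<open>auto simp: F_outside F_finite\<close>)
  then show "\<exists>g\<in>carrier F. g \<oplus>\<^bsub>F\<^esub> f = \<zero>\<^bsub>F\<^esub>"
    using f by (intro bexI[of _ "\<lambda>w. \<ominus>\<^bsub>A\<^esub> f w"] ext) (simp_all add: F_ops(2,4) A.l_neg)
qed (auto intro!: ext simp: F_add_closed F_zero_closed F_ops(2,4) A.a_assoc A.a_comm[of "x w" "y w" for x y w])

lemma F_ring: "ring F"
proof (rule ringI)
  show "monoid F"
    by (intro monoidI ext)
      (auto simp: F_one_closed F_mult_closed conv_assoc conv_one_left conv_one_right)
qed (auto intro!: ext simp: F_abelian_group conv_add_left conv_add_right F_ops(2))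

sublocale F: ring F
  by (rule F_ring)

section \<open>Monomials\<close>

definition monomial :: "'a \<Rightarrow> 'g list \<Rightarrow> 'g list \<Rightarrow> 'a" where
  "monomial a u = (\<lambda>w. if w = u then a else \<zero>\<^bsub>A\<^esub>)"

lemma monomial_closed [simp]: "a \<in> carrier A \<Longrightarrow> u \<in> lists (carrier G) \<Longrightarrow> monomial a u \<in> carrier F"
  by (rule F_closedI[where S = "{u}"]) (auto simp: monomial_def)

lemma word_eq_mono: "word A u = monomial \<one>\<^bsub>A\<^esub> u"
  by (simp add: word_def monomial_def)

lemma word_closed [simp]: "u \<in> lists (carrier G) \<Longrightarrow> word A u \<in> carrier F"
  by (simp add: word_eq_mono)

lemma smult_word: "a \<in> carrier A \<Longrightarrow> a \<odot>\<^bsub>F\<^esub> word A u = monomial a u"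
  by (auto simp: word_def monomial_def F_ops)

lemma one_eq_mono: "\<one>\<^bsub>F\<^esub> = monomial \<one>\<^bsub>A\<^esub> []"
  by (auto simp: monomial_def F_ops(2-5))

lemma zero_eq_mono: "\<zero>\<^bsub>F\<^esub> = monomial \<zero>\<^bsub>A\<^esub> u"
  by (auto simp: monomial_def F_ops(2-5))

lemma monomial_add: "a \<in> carrier A \<Longrightarrow> b \<in> carrier A \<Longrightarrow> monomial (a \<oplus>\<^bsub>A\<^esub> b) u = monomial a u \<oplus>\<^bsub>F\<^esub> monomial b u"
  by (auto simp: monomial_def F_ops(2-5))

lemma monomial_Nil_mult: "a \<in> carrier A \<Longrightarrow> total g \<Longrightarrow> monomial a [] \<otimes>\<^bsub>F\<^esub> g = a \<odot>\<^bsub>F\<^esub> g"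
proof
  fix w assume "a \<in> carrier A" "total g"
  then show "(monomial a [] \<otimes>\<^bsub>F\<^esub> g) w = (a \<odot>\<^bsub>F\<^esub> g) w"
    by (cases w) (simp_all add: conv_Nil conv_Cons monomial_def F_ops(3) conv_zero_left)
qed

lemma monomial_mult:
  assumes "a \<in> carrier A" "b \<in> carrier A"
  shows "monomial a u \<otimes>\<^bsub>F\<^esub> monomial b v = monomial (a \<otimes>\<^bsub>A\<^esub> b) (u @ v)"
proof -
  have tot: "total (monomial c w)" if "c \<in> carrier A" for c w
    using that by (simp add: monomial_def)
  show ?thesis
  proof (induction u)
    case Nil
    then show ?case using assms tot by (simp add: monomial_Nil_mult) (auto simp: monomial_def F_ops(2-5))
  next
    case (Cons x u)
    show ?case
    proof
      fix w
      show "(monomial a (x # u) \<otimes>\<^bsub>F\<^esub> monomial b v) w = monomial (a \<otimes>\<^bsub>A\<^esub> b) ((x # u) @ v) w"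
      proof (cases w)
        case Nil
        then show ?thesis using assms tot by (simp add: conv_Nil) (simp add: monomial_def)
      next
        case (Cons y w')
        have "(\<lambda>u'. monomial a (x # u) (y # u')) = (if x = y then monomial a u else (\<lambda>_. \<zero>\<^bsub>A\<^esub>))"
          by (auto simp: monomial_def)
        then have "(monomial a (x # u) \<otimes>\<^bsub>F\<^esub> monomial b v) w
            = (if x = y then (monomial a u \<otimes>\<^bsub>F\<^esub> monomial b v) w' else \<zero>\<^bsub>A\<^esub>)"
          using assms tot Cons by (simp add: conv_Cons conv_zero_left conv_closed) (simp add: monomial_def)
        then show ?thesis
          using Cons.IH Cons by (simp add: monomial_def)
      qed
    qed
  qed
qed

text \<open>The monomial case is required only for the terms that occur in f, with their actual
  coefficients. Thus a property of f such as homogeneity restricts the words to be treated, although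
  the summands in the additive step are arbitrary.\<close>

lemma F_induct [consumes 1, case_names zero add monomial]:
  assumes "f \<in> carrier F"
    and "P \<zero>\<^bsub>F\<^esub>"
    and "\<And>g h. g \<in> carrier F \<Longrightarrow> h \<in> carrier F \<Longrightarrow> P g \<Longrightarrow> P h \<Longrightarrow> P (g \<oplus>\<^bsub>F\<^esub> h)"
    and monomial: "\<And>w. w \<in> lists (carrier G) \<Longrightarrow> f w \<noteq> \<zero>\<^bsub>A\<^esub> \<Longrightarrow> P (monomial (f w) w)"
  shows "P f"
proof -
  \<comment> \<open>Induction on the support, for every g agreeing with f on it: after one word has
    been deleted, the remaining coefficients are still those of f.\<close>
  have "P g" if "g \<in> carrier F" "{w. g w \<noteq> \<zero>\<^bsub>A\<^esub>} = S" "\<forall>w\<in>S. g w = f w" "finite S" for S g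
    using that(4,1-3)
  proof (induction S arbitrary: g rule: finite_induct)
    case empty
    then have "g = \<zero>\<^bsub>F\<^esub>" by (auto simp: F_ops(4))
    then show ?case using assms(2) by simp
  next
    case (insert u S)
    have "g u \<noteq> \<zero>\<^bsub>A\<^esub>"
      using insert.prems(2) by auto
    then have u: "u \<in> lists (carrier G)" "g u = f u" "f u \<noteq> \<zero>\<^bsub>A\<^esub>"
      using insert.prems(1,3) F_outside[of g u] by auto
    define h where "h = g(u := \<zero>\<^bsub>A\<^esub>)"
    have "h \<in> carrier F"
      by (rule F_closedI[where S = "{w. g w \<noteq> \<zero>\<^bsub>A\<^esub>}"])
        (use insert.prems F_finite[of g] in \<open>auto simp: h_def F_outside\<close>)
    moreover have "{w. h w \<noteq> \<zero>\<^bsub>A\<^esub>} = S"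
      using insert.hyps insert.prems(2) by (auto simp: h_def)
    ultimately have h: "h \<in> carrier F" "{w. h w \<noteq> \<zero>\<^bsub>A\<^esub>} = S" by blast+
    have "P h" by (rule insert.IH[OF h]) (use insert in \<open>auto simp: h_def\<close>)
    moreover have "g = monomial (f u) u \<oplus>\<^bsub>F\<^esub> h"
      using insert.prems(1) u F_val[OF insert.prems(1), of u]
      by (intro ext) (auto simp: h_def monomial_def F_ops(2))
    moreover have "monomial (f u) u \<in> carrier F"
      using u assms(1) by simp
    ultimately show ?case
      using assms(3) h(1) monomial u by simp
  qed
  then show ?thesis using assms(1) by (auto simp: F_finite)
qed

end

section \<open>Rings and signs\<close>

text \<open>\<open>ext_algebra\<close> and \<open>restrict_scalars\<close> change the scalar
  multiplication and the record type but keep the ring operations, so the ring axioms only have to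
  be transported.\<close>

lemma ring_cong:
  assumes "ring R"
    and [simp]: "carrier S = carrier R" "mult S = mult R" "one S = one R" "zero S = zero R"
      "add S = add R"
  shows "ring S"
proof -
  interpret R: ring R by fact
  show ?thesis
    by (intro ringI abelian_groupI monoidI)
      (auto simp: R.m_assoc R.l_distr R.r_distr R.a_assoc intro: R.l_neg R.a_comm)
qed

context ring
begin

lemma sign_pow_closed [simp]: "x \<in> carrier R \<Longrightarrow> sign_pow R n x \<in> carrier R"
  by (simp add: sign_pow_def)

lemma sign_pow_mult_left:
  "x \<in> carrier R \<Longrightarrow> y \<in> carrier R \<Longrightarrow> sign_pow R n x \<otimes> y = sign_pow R n (x \<otimes> y)"
  by (simp add: sign_pow_def l_minus)

lemma sign_pow_mult_right:
  "x \<in> carrier R \<Longrightarrow> y \<in> carrier R \<Longrightarrow> x \<otimes> sign_pow R n y = sign_pow R n (x \<otimes> y)"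
  by (simp add: sign_pow_def r_minus)

lemma sign_pow_add:
  "x \<in> carrier R \<Longrightarrow> y \<in> carrier R \<Longrightarrow> sign_pow R n (x \<oplus> y) = sign_pow R n x \<oplus> sign_pow R n y"
  by (simp add: sign_pow_def minus_add)

lemma sign_pow_zero [simp]: "sign_pow R n \<zero> = \<zero>"
  by (simp add: sign_pow_def)

lemma sign_pow_sign_pow:
  "x \<in> carrier R \<Longrightarrow> sign_pow R m (sign_pow R n x) = sign_pow R (m + n) x"
  by (auto simp: sign_pow_def)

text \<open>Once minus signs are exponents, all signs of a term merge through
  \<open>sign_pow_sign_pow\<close>, and only the parity of a sum remains to be compared.\<close>

lemma minus_eq_sign_pow: "\<ominus> x = sign_pow R 1 x"
  by (simp add: sign_pow_def)

lemma minus_eq_zeroD: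
  assumes "x \<in> carrier R" "y \<in> carrier R" "x \<ominus> y = \<zero>" shows "x = y"
proof -
  have "x = (x \<ominus> y) \<oplus> y" using assms(1,2) by algebra
  then show ?thesis using assms by simp
qed

lemma sign_pow_even: "even n \<Longrightarrow> sign_pow R n x = x"
  by (simp add: sign_pow_def)

lemma sign_pow_cong: "even (m - n) \<Longrightarrow> sign_pow R m x = sign_pow R n x"
  by (simp add: sign_pow_def)

end

section \<open>The exterior algebra\<close>

context exterior_algebra
begin

section \<open>The homogeneous ideal of relations\<close>

definition relators :: "('g list \<Rightarrow> 'a) set" where
  "relators =
    {word A [x \<oplus>\<^bsub>G\<^esub> y] \<ominus>\<^bsub>F\<^esub> (word A [x] \<oplus>\<^bsub>F\<^esub> word A [y]) | x y. x \<in> carrier G \<and> y \<in> carrier G} \<union>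
    {word A [a \<odot>\<^bsub>G\<^esub> x] \<ominus>\<^bsub>F\<^esub> a \<odot>\<^bsub>F\<^esub> word A [x] | a x. a \<in> carrier A \<and> x \<in> carrier G} \<union>
    {word A [x, x] | x. x \<in> carrier G}"

definition FP :: "int \<Rightarrow> ('g list \<Rightarrow> 'a) set" where
  "FP p = {f \<in> carrier F. \<forall>w. int (length w) \<noteq> p \<longrightarrow> f w = \<zero>\<^bsub>A\<^esub>}"

lemma ext_ideal_eq: "I = Idl\<^bsub>F\<^esub> relators"
  by (simp add: ext_ideal_def relators_def Let_def)

lemma FP_closed: "f \<in> FP p \<Longrightarrow> f \<in> carrier F"
  by (simp add: FP_def)

lemma FP_add: "f \<in> FP p \<Longrightarrow> g \<in> FP p \<Longrightarrow> f \<oplus>\<^bsub>F\<^esub> g \<in> FP p"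
  by (auto simp: FP_def F_add_closed F_ops(2))

lemma FP_smult: "a \<in> carrier A \<Longrightarrow> f \<in> FP p \<Longrightarrow> a \<odot>\<^bsub>F\<^esub> f \<in> FP p"
  by (auto simp: FP_def F_smult_closed F_ops(3))

lemma F_minus: "f \<in> carrier F \<Longrightarrow> (\<ominus>\<^bsub>F\<^esub> f) w = \<ominus>\<^bsub>A\<^esub> f w"
  by (metis A.minus_equality F.a_inv_closed F.l_neg F_ops(2) F_ops(4) F_val)

lemma FP_minus: "f \<in> FP p \<Longrightarrow> g \<in> FP p \<Longrightarrow> f \<ominus>\<^bsub>F\<^esub> g \<in> FP p"
  by (auto simp: FP_def a_minus_def F_ops(2) F_minus)

lemma FP_zero: "\<zero>\<^bsub>F\<^esub> \<in> FP p"
  by (auto simp: FP_def F_ops(4))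

lemma FP_mult:
  assumes "f \<in> FP p" "g \<in> FP q"
  shows "f \<otimes>\<^bsub>F\<^esub> g \<in> FP (p + q)"
proof -
  have "(f \<otimes>\<^bsub>F\<^esub> g) w = \<zero>\<^bsub>A\<^esub>" if "int (length w) \<noteq> p + q" for w
  proof (rule ccontr)
    assume "(f \<otimes>\<^bsub>F\<^esub> g) w \<noteq> \<zero>\<^bsub>A\<^esub>"
    from conv_nonzeroE[OF _ _ this] obtain u v where "w = u @ v" "f u \<noteq> \<zero>\<^bsub>A\<^esub>" "g v \<noteq> \<zero>\<^bsub>A\<^esub>"
      using assms[THEN FP_closed] by blast
    then show False using that assms by (auto simp: FP_def)
  qed
  then show ?thesis using assms by (simp add: FP_def)
qed

lemma FP_monomial: "a \<in> carrier A \<Longrightarrow> u \<in> lists (carrier G) \<Longrightarrow> monomial a u \<in> FP (int (length u))"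
  unfolding FP_def by (simp del: in_lists_conv_set) (simp add: monomial_def)

text \<open>The two linearity relations live in degree 1 and the squares in degree 2. This is what
  makes the ideal graded.\<close>

lemma relators_homogeneous: "r \<in> relators \<Longrightarrow> \<exists>n. r \<in> FP n"
proof -
  have w: "word A u \<in> FP (int (length u))" if "u \<in> lists (carrier G)" for u
    using that by (simp add: word_eq_mono FP_monomial)
  have 1: "word A [x] \<in> FP 1" if "x \<in> carrier G" for x
    using w[of "[x]"] that by simp
  show "r \<in> relators \<Longrightarrow> \<exists>n. r \<in> FP n"
    unfolding relators_def
    using w[of "[x, x]" for x] by (auto intro: FP_minus FP_add FP_smult 1 exI[of _ 1])
qed

lemma relators_subset: "relators \<subseteq> carrier F"
  using relators_homogeneous FP_closed by blast

sublocale I: ideal I F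
  unfolding ext_ideal_eq by (rule F.genideal_ideal) (rule relators_subset)

lemma relators_I: "r \<in> relators \<Longrightarrow> r \<in> I"
  unfolding ext_ideal_eq using F.genideal_self[OF relators_subset] by blast

lemma monomial_uminus: "a \<in> carrier A \<Longrightarrow> u \<in> lists (carrier G) \<Longrightarrow> monomial (\<ominus>\<^bsub>A\<^esub> a) u = \<ominus>\<^bsub>F\<^esub> (monomial a u)"
  by (rule ext) (simp add: F_minus, simp add: monomial_def)

text \<open>The elements whose two-sided multiples by monomials all satisfy P form an ideal J: a
  monomial times a monomial is a monomial, and \<open>F_induct\<close> reduces general multipliers
  to monomials. J contains the relators, hence the whole ideal; unit coefficients and empty words
  then give P itself.\<close>

lemma I_induct [consumes 1, case_names zero add relator]:
  assumes "f \<in> I"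
    and zero: "P \<zero>\<^bsub>F\<^esub>"
    and add: "\<And>g h. g \<in> carrier F \<Longrightarrow> h \<in> carrier F \<Longrightarrow> P g \<Longrightarrow> P h \<Longrightarrow> P (g \<oplus>\<^bsub>F\<^esub> h)"
    and relator: "\<And>a u r b v. \<lbrakk>a \<in> carrier A; u \<in> lists (carrier G); r \<in> relators; b \<in> carrier A;
      v \<in> lists (carrier G)\<rbrakk> \<Longrightarrow> P (monomial a u \<otimes>\<^bsub>F\<^esub> r \<otimes>\<^bsub>F\<^esub> monomial b v)"
  shows "P f"
proof -
  define J where "J = {f \<in> carrier F. \<forall>a\<in>carrier A. \<forall>u\<in>lists (carrier G). \<forall>b\<in>carrier A.
    \<forall>v\<in>lists (carrier G). P (monomial a u \<otimes>\<^bsub>F\<^esub> f \<otimes>\<^bsub>F\<^esub> monomial b v)}"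
  have JI: "g \<in> J" if "g \<in> carrier F" "\<And>a u b v. \<lbrakk>a \<in> carrier A; u \<in> lists (carrier G); b \<in> carrier A;
      v \<in> lists (carrier G)\<rbrakk> \<Longrightarrow> P (monomial a u \<otimes>\<^bsub>F\<^esub> g \<otimes>\<^bsub>F\<^esub> monomial b v)" for g
    using that by (simp add: J_def)
  have JD: "P (monomial a u \<otimes>\<^bsub>F\<^esub> g \<otimes>\<^bsub>F\<^esub> monomial b v)"
    if "g \<in> J" "a \<in> carrier A" "u \<in> lists (carrier G)" "b \<in> carrier A" "v \<in> lists (carrier G)" for a u b v g
    using that by (simp add: J_def)
  have JF: "g \<in> carrier F" if "g \<in> J" for g using that by (simp add: J_def)
  have Jadd: "g \<oplus>\<^bsub>F\<^esub> h \<in> J" if "g \<in> J" "h \<in> J" for g h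
    by (rule JI) (use that JF JD in \<open>simp_all add: F.r_distr F.l_distr add del: in_lists_conv_set\<close>)
  have J0: "\<zero>\<^bsub>F\<^esub> \<in> J"
    by (rule JI) (simp_all add: zero del: in_lists_conv_set)
  have "ideal J F"
  proof (rule idealI)
    show "subgroup J (add_monoid F)"
    proof (rule F.add.subgroupI)
      fix g assume g: "g \<in> J"
      show "\<ominus>\<^bsub>F\<^esub> g \<in> J"
      proof (rule JI)
        fix a u b v
        assume *: "a \<in> carrier A" "u \<in> lists (carrier G)" "b \<in> carrier A" "v \<in> lists (carrier G)"
        \<comment> \<open>P is not assumed to be stable under negation; the sign is absorbed by the
          coefficient of the left monomial.\<close>
        have "P (monomial (\<ominus>\<^bsub>A\<^esub> a) u \<otimes>\<^bsub>F\<^esub> g \<otimes>\<^bsub>F\<^esub> monomial b v)"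
          using * g by (intro JD) auto
        then show "P (monomial a u \<otimes>\<^bsub>F\<^esub> (\<ominus>\<^bsub>F\<^esub> g) \<otimes>\<^bsub>F\<^esub> monomial b v)"
          using * g JF by (simp add: monomial_uminus F.l_minus F.r_minus del: in_lists_conv_set)
      qed (use g JF in simp)
    qed (use J0 Jadd in \<open>auto simp: JF\<close>)
  next
    fix g h assume g: "g \<in> J" and h: "h \<in> carrier F"
    from h show "h \<otimes>\<^bsub>F\<^esub> g \<in> J"
    proof (induction h rule: F_induct)
      case (monomial w)
      show ?case
      proof (rule JI)
        fix a u b v
        assume *: "a \<in> carrier A" "u \<in> lists (carrier G)" "b \<in> carrier A" "v \<in> lists (carrier G)"
        have "P (monomial (a \<otimes>\<^bsub>A\<^esub> h w) (u @ w) \<otimes>\<^bsub>F\<^esub> g \<otimes>\<^bsub>F\<^esub> monomial b v)"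
          using * g h monomial by (intro JD) auto
        then show "P (monomial a u \<otimes>\<^bsub>F\<^esub> (monomial (h w) w \<otimes>\<^bsub>F\<^esub> g) \<otimes>\<^bsub>F\<^esub> monomial b v)"
          using * g h monomial JF by (simp add: F.m_assoc[symmetric] monomial_mult del: in_lists_conv_set)
      qed (use g h JF monomial in simp)
    qed (use g JF J0 Jadd in \<open>auto simp: F.l_distr\<close>)
    from h show "g \<otimes>\<^bsub>F\<^esub> h \<in> J"
    proof (induction h rule: F_induct)
      case (monomial w)
      show ?case
      proof (rule JI)
        fix a u b v
        assume *: "a \<in> carrier A" "u \<in> lists (carrier G)" "b \<in> carrier A" "v \<in> lists (carrier G)"
        have "P (monomial a u \<otimes>\<^bsub>F\<^esub> g \<otimes>\<^bsub>F\<^esub> monomial (h w \<otimes>\<^bsub>A\<^esub> b) (w @ v))"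
          using * g h monomial by (intro JD) auto
        then show "P (monomial a u \<otimes>\<^bsub>F\<^esub> (g \<otimes>\<^bsub>F\<^esub> monomial (h w) w) \<otimes>\<^bsub>F\<^esub> monomial b v)"
          using * g h monomial JF by (simp add: F.m_assoc monomial_mult del: in_lists_conv_set)
      qed (use g h JF monomial in simp)
    qed (use g JF J0 Jadd in \<open>auto simp: F.r_distr\<close>)
  qed (rule F.ring_axioms)
  moreover have "relators \<subseteq> J"
  proof
    fix r assume "r \<in> relators"
    then show "r \<in> J"
      by (intro JI relator) (use relators_subset in blast)
  qed
  ultimately have "f \<in> J"
    using F.genideal_minimal[of J relators] assms(1) unfolding ext_ideal_eq by blast
  then show "P f"
    using JD[of f "\<one>\<^bsub>A\<^esub>" "[]" "\<one>\<^bsub>A\<^esub>" "[]"] JF by (simp add: one_eq_mono[symmetric])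
qed

section \<open>Homogeneous parts in the free algebra\<close>

definition proj :: "int \<Rightarrow> ('g list \<Rightarrow> 'a) \<Rightarrow> 'g list \<Rightarrow> 'a" where
  "proj n f = (\<lambda>w. if int (length w) = n then f w else \<zero>\<^bsub>A\<^esub>)"

lemma proj_FP: "f \<in> carrier F \<Longrightarrow> proj n f \<in> FP n"
  unfolding FP_def mem_Collect_eq
  by (intro conjI F_closedI[where S = "{w. f w \<noteq> \<zero>\<^bsub>A\<^esub>}"])
    (auto simp: proj_def F_finite F_outside simp del: in_lists_conv_set)

lemma proj_closed [simp]: "f \<in> carrier F \<Longrightarrow> proj n f \<in> carrier F"
  using proj_FP FP_closed by blast

lemma proj_add: "proj n (f \<oplus>\<^bsub>F\<^esub> g) = proj n f \<oplus>\<^bsub>F\<^esub> proj n g"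
  by (auto simp: proj_def F_ops(2,4))

lemma proj_minus: "f \<in> carrier F \<Longrightarrow> g \<in> carrier F \<Longrightarrow> proj n (f \<ominus>\<^bsub>F\<^esub> g) = proj n f \<ominus>\<^bsub>F\<^esub> proj n g"
  unfolding a_minus_def
  by (rule ext) (simp add: F_minus F_ops(2), simp add: proj_def F_minus F_ops(2))

lemma proj_homogeneous: "f \<in> FP m \<Longrightarrow> proj n f = (if n = m then f else \<zero>\<^bsub>F\<^esub>)"
  by (auto simp: proj_def FP_def F_ops(4))

text \<open>A multiple of a relator by monomials is homogeneous, so each of its projections is
  either the multiple itself or zero. Consequently the grading descends to the quotient.\<close>

lemma proj_I: "f \<in> I \<Longrightarrow> proj n f \<in> I"
proof (induction f rule: I_induct)
  case zero
  then show ?case using proj_homogeneous[OF FP_zero] by simp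
next
  case (add g h)
  then show ?case by (simp add: proj_add)
next
  case (relator a u r b v)
  then obtain k where "r \<in> FP k" using relators_homogeneous by blast
  then have "monomial a u \<otimes>\<^bsub>F\<^esub> r \<otimes>\<^bsub>F\<^esub> monomial b v \<in> FP (int (length u) + k + int (length v))"
    using relator by (intro FP_mult FP_monomial)
  moreover have "monomial a u \<otimes>\<^bsub>F\<^esub> r \<otimes>\<^bsub>F\<^esub> monomial b v \<in> I"
    using relator relators_I by (intro I.I_l_closed I.I_r_closed) auto
  ultimately show ?case by (simp add: proj_homogeneous)
qed


section \<open>The quotient: constants, generators and wedges\<close>

abbreviation \<pi> :: "('g list \<Rightarrow> 'a) \<Rightarrow> ('g list \<Rightarrow> 'a) set" where "\<pi> \<equiv> ext_class A G"

lemma Quot_simps: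
  "carrier (F Quot I) = \<pi> ` carrier F"
  "f \<in> carrier F \<Longrightarrow> g \<in> carrier F \<Longrightarrow> \<pi> f \<otimes>\<^bsub>F Quot I\<^esub> \<pi> g = \<pi> (f \<otimes>\<^bsub>F\<^esub> g)"
  "f \<in> carrier F \<Longrightarrow> g \<in> carrier F \<Longrightarrow> \<pi> f \<oplus>\<^bsub>F Quot I\<^esub> \<pi> g = \<pi> (f \<oplus>\<^bsub>F\<^esub> g)"
  "\<one>\<^bsub>F Quot I\<^esub> = \<pi> \<one>\<^bsub>F\<^esub>"
  using I.rcos_ring_hom
  by (auto simp: FactRing_def A_RCOSETS_def' ext_class_def I.rcoset_mult_add I.a_rcos_sum)

lemma E_eq_Quot:
  "carrier E = carrier (F Quot I)" "mult E = mult (F Quot I)" "add E = add (F Quot I)"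
  "zero E = zero (F Quot I)" "one E = one (F Quot I)"
  by (simp_all add: ext_algebra_def Let_def)

lemma E_ring: "ring E"
  by (rule ring_cong[OF I.quotient_is_ring]) (simp_all add: E_eq_Quot)

sublocale E: ring E
  by (rule E_ring)

lemma E_carrier: "carrier E = \<pi> ` carrier F"
  by (simp add: E_eq_Quot Quot_simps)

lemma \<pi>_closed [simp, intro]: "f \<in> carrier F \<Longrightarrow> \<pi> f \<in> carrier E"
  by (simp add: E_carrier)

lemma \<pi>_mult: "f \<in> carrier F \<Longrightarrow> g \<in> carrier F \<Longrightarrow> \<pi> (f \<otimes>\<^bsub>F\<^esub> g) = \<pi> f \<otimes>\<^bsub>E\<^esub> \<pi> g"
  by (simp add: E_eq_Quot Quot_simps)

lemma \<pi>_add: "f \<in> carrier F \<Longrightarrow> g \<in> carrier F \<Longrightarrow> \<pi> (f \<oplus>\<^bsub>F\<^esub> g) = \<pi> f \<oplus>\<^bsub>E\<^esub> \<pi> g"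
  by (simp add: E_eq_Quot Quot_simps)

lemma \<pi>_one: "\<pi> \<one>\<^bsub>F\<^esub> = \<one>\<^bsub>E\<^esub>"
  by (simp add: E_eq_Quot Quot_simps)

lemma \<pi>_zero: "\<pi> \<zero>\<^bsub>F\<^esub> = \<zero>\<^bsub>E\<^esub>"
  by (metis E.r_zero E.add.l_cancel_one F.r_zero F.zero_closed \<pi>_add \<pi>_closed)

lemma \<pi>_minus: "f \<in> carrier F \<Longrightarrow> g \<in> carrier F \<Longrightarrow> \<pi> (f \<ominus>\<^bsub>F\<^esub> g) = \<pi> f \<ominus>\<^bsub>E\<^esub> \<pi> g"
proof -
  assume *: "f \<in> carrier F" "g \<in> carrier F"
  have "\<pi> (f \<ominus>\<^bsub>F\<^esub> g) \<oplus>\<^bsub>E\<^esub> \<pi> g = \<pi> f"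
    using * by (simp add: \<pi>_add[symmetric] a_minus_def F.a_assoc F.l_neg)
  then show ?thesis
    using * by (metis E.add.inv_solve_right F.minus_closed a_minus_def \<pi>_closed)
qed

lemma \<pi>_eq_zero: "f \<in> I \<Longrightarrow> \<pi> f = \<zero>\<^bsub>E\<^esub>"
  using F.a_rcos_zero[OF I.is_ideal, of f]
  by (simp add: ext_class_def E_eq_Quot FactRing_def)

lemma \<pi>_eqD:
  assumes "f \<in> carrier F" "g \<in> carrier F" "\<pi> f = \<pi> g" shows "f \<ominus>\<^bsub>F\<^esub> g \<in> I"
proof -
  have "f \<in> I +>\<^bsub>F\<^esub> g"
    using I.a_rcos_self[OF assms(1)] assms(3) by (simp add: ext_class_def)
  then obtain h where h: "h \<in> I" "f = h \<oplus>\<^bsub>F\<^esub> g"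
    by (auto simp: a_r_coset_def r_coset_def)
  then have "f \<ominus>\<^bsub>F\<^esub> g = h"
    using assms(2) by (simp add: a_minus_def F.a_assoc F.r_neg)
  with h show ?thesis by simp
qed

abbreviation cst :: "'a \<Rightarrow> ('g list \<Rightarrow> 'a) set" where "cst \<equiv> ext_const A G"
abbreviation gen :: "'g \<Rightarrow> ('g list \<Rightarrow> 'a) set" where "gen x \<equiv> \<pi> (word A [x])"
abbreviation W :: "'g list \<Rightarrow> ('g list \<Rightarrow> 'a) set" where "W \<equiv> wedge A G"
abbreviation \<Lambda> :: "int \<Rightarrow> ('g list \<Rightarrow> 'a) set set" where "\<Lambda> \<equiv> ext_power A G"
abbreviation sg :: "int \<Rightarrow> ('g list \<Rightarrow> 'a) set \<Rightarrow> ('g list \<Rightarrow> 'a) set" where "sg \<equiv> sign_pow E"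

lemma \<Lambda>_eq: "\<Lambda> p = \<pi> ` FP p"
  by (simp add: ext_power_def FP_def)

lemma \<Lambda>_closed: "P \<in> \<Lambda> p \<Longrightarrow> P \<in> carrier E"
  by (auto simp: \<Lambda>_eq dest: FP_closed)

lemma cst_eq: "a \<in> carrier A \<Longrightarrow> cst a = \<pi> (monomial a [])"
  by (simp add: ext_const_def smult_word)

lemma cst_closed [simp]: "a \<in> carrier A \<Longrightarrow> cst a \<in> carrier E"
  by (simp add: cst_eq)

lemma cst_add: "a \<in> carrier A \<Longrightarrow> b \<in> carrier A \<Longrightarrow> cst (a \<oplus>\<^bsub>A\<^esub> b) = cst a \<oplus>\<^bsub>E\<^esub> cst b"
  by (simp add: cst_eq monomial_add \<pi>_add)

lemma cst_mult: "a \<in> carrier A \<Longrightarrow> b \<in> carrier A \<Longrightarrow> cst (a \<otimes>\<^bsub>A\<^esub> b) = cst a \<otimes>\<^bsub>E\<^esub> cst b"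
  by (simp add: cst_eq \<pi>_mult[symmetric] monomial_mult)

lemma cst_zero [simp]: "cst \<zero>\<^bsub>A\<^esub> = \<zero>\<^bsub>E\<^esub>"
  by (simp add: cst_eq zero_eq_mono[symmetric] \<pi>_zero)

lemma cst_one [simp]: "cst \<one>\<^bsub>A\<^esub> = \<one>\<^bsub>E\<^esub>"
  by (simp add: cst_eq one_eq_mono[symmetric] \<pi>_one)

lemma cst_minus: "a \<in> carrier A \<Longrightarrow> cst (\<ominus>\<^bsub>A\<^esub> a) = \<ominus>\<^bsub>E\<^esub> cst a"
  by (metis A.add.inv_closed A.l_neg E.minus_equality cst_add cst_closed cst_zero)

lemma smult_E: "a \<odot>\<^bsub>E\<^esub> P = cst a \<otimes>\<^bsub>E\<^esub> P"
  by (simp add: ext_algebra_def Let_def)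

lemma gen_closed [simp]: "x \<in> carrier G \<Longrightarrow> gen x \<in> carrier E"
  by simp

lemma W_Nil [simp]: "W [] = \<one>\<^bsub>E\<^esub>"
  by (simp add: wedge_def)

lemma W_Cons [simp]: "W (x # w) = gen x \<otimes>\<^bsub>E\<^esub> W w"
  by (simp add: wedge_def)

lemma W_eq: "w \<in> lists (carrier G) \<Longrightarrow> W w = \<pi> (word A w)"
proof (induction w)
  case Nil
  then show ?case by (simp add: word_eq_mono one_eq_mono[symmetric] \<pi>_one)
next
  case (Cons x w)
  then show ?case by (simp add: \<pi>_mult[symmetric] word_eq_mono monomial_mult)
qed

lemma W_closed [simp]: "w \<in> lists (carrier G) \<Longrightarrow> W w \<in> carrier E"
  by (simp add: W_eq)

lemma W_append: "u \<in> lists (carrier G) \<Longrightarrow> v \<in> lists (carrier G) \<Longrightarrow> W (u @ v) = W u \<otimes>\<^bsub>E\<^esub> W v"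
  by (induction u) (simp_all add: E.m_assoc)

lemma \<pi>_monomial: "a \<in> carrier A \<Longrightarrow> w \<in> lists (carrier G) \<Longrightarrow> \<pi> (monomial a w) = cst a \<otimes>\<^bsub>E\<^esub> W w"
  by (simp add: cst_eq W_eq word_eq_mono \<pi>_mult[symmetric] monomial_mult)

lemma gen_add: "x \<in> carrier G \<Longrightarrow> y \<in> carrier G \<Longrightarrow> gen (x \<oplus>\<^bsub>G\<^esub> y) = gen x \<oplus>\<^bsub>E\<^esub> gen y"
proof -
  assume *: "x \<in> carrier G" "y \<in> carrier G"
  then have "word A [x \<oplus>\<^bsub>G\<^esub> y] \<ominus>\<^bsub>F\<^esub> (word A [x] \<oplus>\<^bsub>F\<^esub> word A [y]) \<in> I"
    by (intro relators_I) (auto simp: relators_def)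
  then have "gen (x \<oplus>\<^bsub>G\<^esub> y) \<ominus>\<^bsub>E\<^esub> (gen x \<oplus>\<^bsub>E\<^esub> gen y) = \<zero>\<^bsub>E\<^esub>"
    using * \<pi>_eq_zero by (simp add: \<pi>_minus[symmetric] \<pi>_add[symmetric])
  from E.minus_eq_zeroD[OF _ _ this] show ?thesis using * by simp
qed

lemma gen_smult: "a \<in> carrier A \<Longrightarrow> x \<in> carrier G \<Longrightarrow> gen (a \<odot>\<^bsub>G\<^esub> x) = cst a \<otimes>\<^bsub>E\<^esub> gen x"
proof -
  assume *: "a \<in> carrier A" "x \<in> carrier G"
  then have "word A [a \<odot>\<^bsub>G\<^esub> x] \<ominus>\<^bsub>F\<^esub> a \<odot>\<^bsub>F\<^esub> word A [x] \<in> I"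
    by (intro relators_I) (auto simp: relators_def)
  then have "gen (a \<odot>\<^bsub>G\<^esub> x) \<ominus>\<^bsub>E\<^esub> \<pi> (a \<odot>\<^bsub>F\<^esub> word A [x]) = \<zero>\<^bsub>E\<^esub>"
    using * \<pi>_eq_zero by (simp add: \<pi>_minus[symmetric] F_smult_closed)
  from E.minus_eq_zeroD[OF _ _ this] have "gen (a \<odot>\<^bsub>G\<^esub> x) = \<pi> (a \<odot>\<^bsub>F\<^esub> word A [x])"
    using * by (simp add: F_smult_closed)
  moreover have "\<pi> (a \<odot>\<^bsub>F\<^esub> word A [x]) = cst a \<otimes>\<^bsub>E\<^esub> gen x"
    using * by (simp add: smult_word \<pi>_monomial)
  ultimately show ?thesis by simp
qed

lemma gen_square: "x \<in> carrier G \<Longrightarrow> gen x \<otimes>\<^bsub>E\<^esub> gen x = \<zero>\<^bsub>E\<^esub>"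
proof -
  assume *: "x \<in> carrier G"
  then have "word A [x, x] \<in> I"
    by (intro relators_I) (auto simp: relators_def)
  then show ?thesis
    using * W_eq[of "[x, x]"] \<pi>_eq_zero by simp
qed

lemma gen_zero: "gen \<zero>\<^bsub>G\<^esub> = \<zero>\<^bsub>E\<^esub>"
  using gen_smult[of "\<zero>\<^bsub>A\<^esub>" "\<zero>\<^bsub>G\<^esub>"] by simp

lemma gen_minus: "x \<in> carrier G \<Longrightarrow> gen (\<ominus>\<^bsub>G\<^esub> x) = \<ominus>\<^bsub>E\<^esub> gen x"
  by (metis G.M.add.inv_closed G.M.l_neg E.minus_equality gen_add gen_closed gen_zero)

lemma E_induct [consumes 1, case_names zero add monomial]:
  assumes "P \<in> carrier E"
    and "Pr \<zero>\<^bsub>E\<^esub>"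
    and "\<And>P Q. P \<in> carrier E \<Longrightarrow> Q \<in> carrier E \<Longrightarrow> Pr P \<Longrightarrow> Pr Q \<Longrightarrow> Pr (P \<oplus>\<^bsub>E\<^esub> Q)"
    and "\<And>a w. a \<in> carrier A \<Longrightarrow> w \<in> lists (carrier G) \<Longrightarrow> Pr (cst a \<otimes>\<^bsub>E\<^esub> W w)"
  shows "Pr P"
proof -
  obtain f where f: "f \<in> carrier F" "P = \<pi> f" using assms(1) by (auto simp: E_carrier)
  from f(1) have "Pr (\<pi> f)"
    by (induction rule: F_induct) (use f assms(2-) in \<open>auto simp: \<pi>_zero \<pi>_add \<pi>_monomial simp del: in_lists_conv_set\<close>)
  with f show ?thesis by simp
qed

text \<open>For a homogeneous representative, \<open>F_induct\<close> meets only words of its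
  support, and these have length p.\<close>

lemma \<Lambda>_induct [consumes 1, case_names zero add monomial]:
  assumes "P \<in> \<Lambda> p"
    and "Pr \<zero>\<^bsub>E\<^esub>"
    and "\<And>P Q. P \<in> carrier E \<Longrightarrow> Q \<in> carrier E \<Longrightarrow> Pr P \<Longrightarrow> Pr Q \<Longrightarrow> Pr (P \<oplus>\<^bsub>E\<^esub> Q)"
    and "\<And>a w. a \<in> carrier A \<Longrightarrow> w \<in> lists (carrier G) \<Longrightarrow> int (length w) = p \<Longrightarrow> Pr (cst a \<otimes>\<^bsub>E\<^esub> W w)"
  shows "Pr P"
proof -
  obtain f where f: "f \<in> FP p" "P = \<pi> f" using assms(1) by (auto simp: \<Lambda>_eq)
  from FP_closed[OF f(1)] have "Pr (\<pi> f)"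
  proof (induction rule: F_induct)
    case (monomial w)
    then have "int (length w) = p" using f(1) by (auto simp: FP_def)
    with monomial show ?case
      using assms(4)[of "f w" w] FP_closed[OF f(1)] by (simp add: \<pi>_monomial)
  qed (use assms(2,3) in \<open>simp_all add: \<pi>_zero \<pi>_add\<close>)
  with f show ?thesis by simp
qed

section \<open>The grading and graded commutativity\<close>

lemma \<Lambda>_zero [simp]: "\<zero>\<^bsub>E\<^esub> \<in> \<Lambda> p"
  using FP_zero[of p] \<pi>_zero by (force simp: \<Lambda>_eq)

lemma \<Lambda>_add [simp]: "P \<in> \<Lambda> p \<Longrightarrow> Q \<in> \<Lambda> p \<Longrightarrow> P \<oplus>\<^bsub>E\<^esub> Q \<in> \<Lambda> p"
  by (auto simp: \<Lambda>_eq \<pi>_add[symmetric] FP_add FP_closed)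

lemma \<Lambda>_mult: "P \<in> \<Lambda> p \<Longrightarrow> Q \<in> \<Lambda> q \<Longrightarrow> P \<otimes>\<^bsub>E\<^esub> Q \<in> \<Lambda> (p + q)"
  by (auto simp: \<Lambda>_eq \<pi>_mult[symmetric] FP_mult FP_closed)

lemma \<Lambda>_cst [simp]: "a \<in> carrier A \<Longrightarrow> cst a \<in> \<Lambda> 0"
  using FP_monomial[of a "[]"] by (simp add: \<Lambda>_eq cst_eq)

lemma \<Lambda>_W: "w \<in> lists (carrier G) \<Longrightarrow> W w \<in> \<Lambda> (int (length w))"
  using FP_monomial[of "\<one>\<^bsub>A\<^esub>" w] by (simp add: \<Lambda>_eq W_eq word_eq_mono)

lemma \<Lambda>_gen [simp]: "x \<in> carrier G \<Longrightarrow> gen x \<in> \<Lambda> 1"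
  using \<Lambda>_W[of "[x]"] by simp

lemma \<Lambda>_cst_mult [simp]: "a \<in> carrier A \<Longrightarrow> P \<in> \<Lambda> p \<Longrightarrow> cst a \<otimes>\<^bsub>E\<^esub> P \<in> \<Lambda> p"
  using \<Lambda>_mult[OF \<Lambda>_cst] by fastforce

lemma \<Lambda>_minus [simp]: "P \<in> \<Lambda> p \<Longrightarrow> \<ominus>\<^bsub>E\<^esub> P \<in> \<Lambda> p"
  using \<Lambda>_cst_mult[of "\<ominus>\<^bsub>A\<^esub> \<one>\<^bsub>A\<^esub>" P p] by (simp add: cst_minus E.l_minus \<Lambda>_closed)

lemma \<Lambda>_sg [simp]: "P \<in> \<Lambda> p \<Longrightarrow> sg n P \<in> \<Lambda> p"
  by (simp add: sign_pow_def)

text \<open>The scheme fits statements that behave well under products of homogeneous elements. The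
  degree is an argument of the predicate because the signs involve it and the element alone does not
  determine it.\<close>

lemma homogeneous_induct [consumes 1, case_names zero add cst gen mult]:
  assumes "P \<in> \<Lambda> p"
    and "\<And>p. Pr p \<zero>\<^bsub>E\<^esub>"
    and "\<And>p P Q. P \<in> \<Lambda> p \<Longrightarrow> Q \<in> \<Lambda> p \<Longrightarrow> Pr p P \<Longrightarrow> Pr p Q \<Longrightarrow> Pr p (P \<oplus>\<^bsub>E\<^esub> Q)"
    and "\<And>a. a \<in> carrier A \<Longrightarrow> Pr 0 (cst a)"
    and "\<And>x. x \<in> carrier G \<Longrightarrow> Pr 1 (gen x)"
    and mult: "\<And>p q P Q. P \<in> \<Lambda> p \<Longrightarrow> Q \<in> \<Lambda> q \<Longrightarrow> Pr p P \<Longrightarrow> Pr q Q \<Longrightarrow> Pr (p + q) (P \<otimes>\<^bsub>E\<^esub> Q)"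
  shows "Pr p P"
proof -
  have W: "Pr (int (length w)) (W w)" if "w \<in> lists (carrier G)" for w
    using that
  proof (induction w)
    case Nil
    then show ?case using assms(4)[of "\<one>\<^bsub>A\<^esub>"] by simp
  next
    case (Cons x w)
    then show ?case using mult[of "gen x" 1 "W w"] assms(5) \<Lambda>_W by simp
  qed
  \<comment> \<open>\<open>\<Lambda>_induct\<close> supplies summands that are merely in the
    carrier, so their degree is carried along in the claim.\<close>
  have "P \<in> \<Lambda> p \<and> Pr p P"
    using assms(1)
  proof (induction rule: \<Lambda>_induct)
    case (monomial a w)
    then show ?case
      using mult[of "cst a" 0 "W w" p] assms(4) W \<Lambda>_W[of w] by (auto simp del: in_lists_conv_set)
  qed (use assms(2,3) in auto)
  then show ?thesis ..
qed

lemma cst_central: "a \<in> carrier A \<Longrightarrow> P \<in> carrier E \<Longrightarrow> P \<otimes>\<^bsub>E\<^esub> cst a = cst a \<otimes>\<^bsub>E\<^esub> P"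
proof -
  assume a: "a \<in> carrier A"
  assume "P \<in> carrier E"
  then show ?thesis
  proof (induction rule: E_induct)
    case (monomial b w)
    have "\<pi> (monomial b w \<otimes>\<^bsub>F\<^esub> monomial a []) = \<pi> (monomial a [] \<otimes>\<^bsub>F\<^esub> monomial b w)"
      using monomial a by (simp add: monomial_mult A.m_comm)
    then show ?case
      using monomial a by (simp add: \<pi>_mult \<pi>_monomial[symmetric] cst_eq[symmetric])
  qed (use a in \<open>simp_all add: E.l_distr E.r_distr\<close>)
qed

lemma anticommute_gen:
  assumes "x \<in> carrier G" "y \<in> carrier G"
  shows "gen x \<otimes>\<^bsub>E\<^esub> gen y = \<ominus>\<^bsub>E\<^esub> (gen y \<otimes>\<^bsub>E\<^esub> gen x)"
proof -
  have "(gen x \<oplus>\<^bsub>E\<^esub> gen y) \<otimes>\<^bsub>E\<^esub> (gen x \<oplus>\<^bsub>E\<^esub> gen y) = \<zero>\<^bsub>E\<^esub>"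
    using assms gen_square[of "x \<oplus>\<^bsub>G\<^esub> y"] by (simp add: gen_add)
  then have "gen x \<otimes>\<^bsub>E\<^esub> gen y \<oplus>\<^bsub>E\<^esub> gen y \<otimes>\<^bsub>E\<^esub> gen x = \<zero>\<^bsub>E\<^esub>"
    using assms by (simp add: E.l_distr E.r_distr gen_square E.a_comm)
  then show ?thesis
    using assms by (intro E.minus_equality[symmetric]) auto
qed

lemma gen_commute:
  assumes "P \<in> \<Lambda> p" "x \<in> carrier G"
  shows "gen x \<otimes>\<^bsub>E\<^esub> P = sg p (P \<otimes>\<^bsub>E\<^esub> gen x)"
  using assms
proof (induction rule: homogeneous_induct)
  case (cst a)
  then show ?case by (simp add: cst_central sign_pow_def)
next
  case (gen y)
  then show ?case by (simp add: anticommute_gen[of x y] sign_pow_def)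
next
  case (mult p q P Q)
  then have [simp]: "P \<in> carrier E" "Q \<in> carrier E" by (simp_all add: \<Lambda>_closed)
  have "gen x \<otimes>\<^bsub>E\<^esub> (P \<otimes>\<^bsub>E\<^esub> Q) = sg p (P \<otimes>\<^bsub>E\<^esub> gen x) \<otimes>\<^bsub>E\<^esub> Q"
    using mult by (simp add: E.m_assoc[symmetric])
  also have "\<dots> = sg p (P \<otimes>\<^bsub>E\<^esub> (gen x \<otimes>\<^bsub>E\<^esub> Q))"
    using mult.prems by (simp add: E.m_assoc E.sign_pow_mult_left)
  also have "\<dots> = sg (p + q) (P \<otimes>\<^bsub>E\<^esub> Q \<otimes>\<^bsub>E\<^esub> gen x)"
    unfolding mult.IH(2)[OF mult.prems]
    using mult.prems by (simp add: E.sign_pow_mult_right E.sign_pow_sign_pow E.m_assoc)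
  finally show ?case .
next
  case (add p P Q)
  then show ?case by (simp add: E.l_distr E.r_distr E.sign_pow_add \<Lambda>_closed)
qed simp

lemma graded_commute:
  assumes "P \<in> \<Lambda> p" "Q \<in> \<Lambda> q"
  shows "P \<otimes>\<^bsub>E\<^esub> Q = sg (p * q) (Q \<otimes>\<^bsub>E\<^esub> P)"
proof -
  have [simp]: "Q \<in> carrier E" using assms by (simp add: \<Lambda>_closed)
  from assms(1) show ?thesis
  proof (induction rule: homogeneous_induct)
    case (cst a)
    then show ?case by (simp add: cst_central sign_pow_def)
  next
    case (gen y)
    then show ?case using gen_commute assms by simp
  next
    case (mult p p' P P')
    then have [simp]: "P \<in> carrier E" "P' \<in> carrier E" by (simp_all add: \<Lambda>_closed)
    have "P \<otimes>\<^bsub>E\<^esub> P' \<otimes>\<^bsub>E\<^esub> Q = sg (p' * q) (P \<otimes>\<^bsub>E\<^esub> Q \<otimes>\<^bsub>E\<^esub> P')"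
      using mult.hyps by (simp add: E.m_assoc mult.IH(2) E.sign_pow_mult_right)
    also have "\<dots> = sg (p' * q + p * q) (Q \<otimes>\<^bsub>E\<^esub> (P \<otimes>\<^bsub>E\<^esub> P'))"
      by (simp add: mult.IH(1) E.sign_pow_mult_left E.sign_pow_sign_pow E.m_assoc)
    finally show ?case by (simp add: algebra_simps)
  next
    case (add p P Q)
    then show ?case by (simp add: E.l_distr E.r_distr E.sign_pow_add \<Lambda>_closed)
  qed simp
qed

section \<open>Decomposition into homogeneous components\<close>

definition component :: "int \<Rightarrow> ('g list \<Rightarrow> 'a) set \<Rightarrow> ('g list \<Rightarrow> 'a) set" where
  "component n P = \<pi> (proj n (SOME f. f \<in> carrier F \<and> \<pi> f = P))"

text \<open>The choice of a representative is harmless: two of them differ by an element of the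
  ideal, whose projections lie in the ideal again.\<close>

lemma component_\<pi>: "f \<in> carrier F \<Longrightarrow> component n (\<pi> f) = \<pi> (proj n f)"
proof -
  assume f: "f \<in> carrier F"
  define g where "g = (SOME g. g \<in> carrier F \<and> \<pi> g = \<pi> f)"
  have g: "g \<in> carrier F \<and> \<pi> g = \<pi> f"
    unfolding g_def by (rule someI[of _ f]) (use f in simp)
  then have "proj n g \<ominus>\<^bsub>F\<^esub> proj n f \<in> I"
    using f proj_I[OF \<pi>_eqD[of g f], of n] by (simp add: proj_minus)
  then have "\<pi> (proj n g) \<ominus>\<^bsub>E\<^esub> \<pi> (proj n f) = \<zero>\<^bsub>E\<^esub>"
    using f g by (simp add: \<pi>_minus[symmetric] \<pi>_eq_zero)
  from E.minus_eq_zeroD[OF _ _ this] show ?thesis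
    using f g by (simp add: component_def g_def)
qed

lemma component_\<Lambda> [simp]: "P \<in> carrier E \<Longrightarrow> component n P \<in> \<Lambda> n"
  by (auto simp: E_carrier component_\<pi> \<Lambda>_eq proj_FP)

lemma component_closed [simp]: "P \<in> carrier E \<Longrightarrow> component n P \<in> carrier E"
  using component_\<Lambda> \<Lambda>_closed by blast

lemma component_add: "P \<in> carrier E \<Longrightarrow> Q \<in> carrier E \<Longrightarrow> component n (P \<oplus>\<^bsub>E\<^esub> Q) = component n P \<oplus>\<^bsub>E\<^esub> component n Q"
  by (auto simp: E_carrier component_\<pi> proj_add \<pi>_add[symmetric] F_add_closed)

lemma component_homogeneous: "P \<in> \<Lambda> m \<Longrightarrow> component n P = (if n = m then P else \<zero>\<^bsub>E\<^esub>)"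
  by (auto simp: \<Lambda>_eq component_\<pi> FP_closed proj_homogeneous \<pi>_zero)

lemma component_zero [simp]: "component n \<zero>\<^bsub>E\<^esub> = \<zero>\<^bsub>E\<^esub>"
  using component_homogeneous[of "\<zero>\<^bsub>E\<^esub>" n n] by simp

lemma finsum_support:
  assumes "finite T" "\<forall>n. n \<notin> T \<longrightarrow> c n = \<zero>\<^bsub>E\<^esub>" "\<forall>n. c n \<in> carrier E"
  shows "(\<Oplus>\<^bsub>E\<^esub> n\<in>T. c n) = (\<Oplus>\<^bsub>E\<^esub> n\<in>{n. c n \<noteq> \<zero>\<^bsub>E\<^esub>}. c n)"
  using assms by (intro E.add.finprod_mono_neutral_cong_right) auto

lemma component_finite_sum:
  assumes "P \<in> carrier E"
  shows "finite {n. component n P \<noteq> \<zero>\<^bsub>E\<^esub>} \<and> P = (\<Oplus>\<^bsub>E\<^esub> n\<in>{n. component n P \<noteq> \<zero>\<^bsub>E\<^esub>}. component n P)"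
proof -
  \<comment> \<open>Any finite index set containing the support is allowed, so that the union of two
    such sets serves for a sum, where components may cancel.\<close>
  have "\<exists>T. finite T \<and> (\<forall>n. n \<notin> T \<longrightarrow> component n P = \<zero>\<^bsub>E\<^esub>) \<and> P = (\<Oplus>\<^bsub>E\<^esub> n\<in>T. component n P)"
    using assms
  proof (induction rule: E_induct)
    case zero
    show ?case by (rule exI[of _ "{}"]) simp
  next
    case (add P Q)
    then obtain S T where S: "finite S" "\<forall>n. n \<notin> S \<longrightarrow> component n P = \<zero>\<^bsub>E\<^esub>" "P = (\<Oplus>\<^bsub>E\<^esub> n\<in>S. component n P)"
      and T: "finite T" "\<forall>n. n \<notin> T \<longrightarrow> component n Q = \<zero>\<^bsub>E\<^esub>" "Q = (\<Oplus>\<^bsub>E\<^esub> n\<in>T. component n Q)"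
      by blast
    have "P = (\<Oplus>\<^bsub>E\<^esub> n\<in>S \<union> T. component n P)"
      using S T add by (subst S(3), intro E.add.finprod_mono_neutral_cong_left) auto
    moreover have "Q = (\<Oplus>\<^bsub>E\<^esub> n\<in>S \<union> T. component n Q)"
      using S T add by (subst T(3), intro E.add.finprod_mono_neutral_cong_left) auto
    ultimately have "P \<oplus>\<^bsub>E\<^esub> Q = (\<Oplus>\<^bsub>E\<^esub> n\<in>S \<union> T. component n (P \<oplus>\<^bsub>E\<^esub> Q))"
      using add by (simp add: component_add E.finsum_addf)
    moreover have "\<forall>n. n \<notin> S \<union> T \<longrightarrow> component n (P \<oplus>\<^bsub>E\<^esub> Q) = \<zero>\<^bsub>E\<^esub>"
      using S(2) T(2) add by (simp add: component_add)
    ultimately show ?case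
      using S(1) T(1) by (intro exI[of _ "S \<union> T"] conjI) auto
  next
    case (monomial a w)
    then have "cst a \<otimes>\<^bsub>E\<^esub> W w \<in> \<Lambda> (int (length w))"
      using \<Lambda>_W by (intro \<Lambda>_cst_mult)
    from component_homogeneous[OF this] \<Lambda>_closed[OF this] show ?case
      by (intro exI[of _ "{int (length w)}"]) simp
  qed
  then obtain T where T: "finite T" "\<forall>n. n \<notin> T \<longrightarrow> component n P = \<zero>\<^bsub>E\<^esub>" "P = (\<Oplus>\<^bsub>E\<^esub> n\<in>T. component n P)"
    by blast
  have "{n. component n P \<noteq> \<zero>\<^bsub>E\<^esub>} \<subseteq> T"
    using T by auto
  moreover have "(\<Oplus>\<^bsub>E\<^esub> n\<in>T. component n P) = (\<Oplus>\<^bsub>E\<^esub> n\<in>{n. component n P \<noteq> \<zero>\<^bsub>E\<^esub>}. component n P)"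
    using T assms by (intro finsum_support) auto
  ultimately show ?thesis
    using T finite_subset by auto
qed

lemma component_finite: "P \<in> carrier E \<Longrightarrow> finite {n. component n P \<noteq> \<zero>\<^bsub>E\<^esub>}"
  using component_finite_sum by blast

lemma E_graded_induct [consumes 1, case_names homogeneous add]:
  assumes "P \<in> carrier E"
    and hom: "\<And>p P. P \<in> \<Lambda> p \<Longrightarrow> Pr P"
    and "\<And>P Q. P \<in> carrier E \<Longrightarrow> Q \<in> carrier E \<Longrightarrow> Pr P \<Longrightarrow> Pr Q \<Longrightarrow> Pr (P \<oplus>\<^bsub>E\<^esub> Q)"
  shows "Pr P"
  using assms(1)
proof (induction rule: E_induct)
  case (monomial a w)
  then show ?case using hom[OF \<Lambda>_cst_mult[OF _ \<Lambda>_W]] by blast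
qed (use assms(3) hom[OF \<Lambda>_zero] in auto)

lemma component_finsum:
  assumes "finite T" "\<forall>n. c n \<in> carrier E"
  shows "component m (\<Oplus>\<^bsub>E\<^esub> n\<in>T. c n) = (\<Oplus>\<^bsub>E\<^esub> n\<in>T. component m (c n))"
  using assms by (induction rule: finite_induct) (simp_all add: component_add Pi_def)

text \<open>Applying \<open>component m\<close> to the sum retains only the summand of degree
  m.\<close>

lemma decomposition_unique:
  assumes "\<forall>n. c n \<in> \<Lambda> n" "finite {n. c n \<noteq> \<zero>\<^bsub>E\<^esub>}" "P = (\<Oplus>\<^bsub>E\<^esub> n\<in>{n. c n \<noteq> \<zero>\<^bsub>E\<^esub>}. c n)"
  shows "c m = component m P"
proof -
  have c: "c n \<in> carrier E" for n using assms(1) \<Lambda>_closed by blast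
  have "component m P = (\<Oplus>\<^bsub>E\<^esub> n\<in>{n. c n \<noteq> \<zero>\<^bsub>E\<^esub>}. component m (c n))"
    using assms c by (simp add: component_finsum)
  also have "\<dots> = (\<Oplus>\<^bsub>E\<^esub> n\<in>{n. c n \<noteq> \<zero>\<^bsub>E\<^esub>}. if m = n then c n else \<zero>\<^bsub>E\<^esub>)"
    using assms(1) c component_homogeneous[of "c n" n m for n]
    by (intro E.finsum_cong') auto
  also have "\<dots> = c m"
  proof (cases "c m = \<zero>\<^bsub>E\<^esub>")
    case True
    then have "(if m = n then c n else \<zero>\<^bsub>E\<^esub>) = \<zero>\<^bsub>E\<^esub>" for n by auto
    then show ?thesis using True by simp
  next
    case False
    then show ?thesis using assms(2) c by (intro E.finsum_singleton) auto
  qed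
  finally show ?thesis by simp
qed

section \<open>Graded derivations\<close>

text \<open>Only additivity is required, not linearity over A, because \<open>[x, \<cdot>]\<close>
  acts on the coefficients through the anchor. The sign involves the degree of the left factor only,
  so the right factor may be inhomogeneous.\<close>

definition graded_derivation :: "int \<Rightarrow> (('g list \<Rightarrow> 'a) set \<Rightarrow> ('g list \<Rightarrow> 'a) set) \<Rightarrow> bool" where
  "graded_derivation d \<delta> \<longleftrightarrow>
    (\<forall>P\<in>carrier E. \<delta> P \<in> carrier E) \<and>
    (\<forall>P\<in>carrier E. \<forall>Q\<in>carrier E. \<delta> (P \<oplus>\<^bsub>E\<^esub> Q) = \<delta> P \<oplus>\<^bsub>E\<^esub> \<delta> Q) \<and>
    (\<forall>p. \<forall>P\<in>\<Lambda> p. \<delta> P \<in> \<Lambda> (p + d)) \<and>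
    (\<forall>p. \<forall>P\<in>\<Lambda> p. \<forall>Q\<in>carrier E. \<delta> (P \<otimes>\<^bsub>E\<^esub> Q) = \<delta> P \<otimes>\<^bsub>E\<^esub> Q \<oplus>\<^bsub>E\<^esub> sg (d * p) (P \<otimes>\<^bsub>E\<^esub> \<delta> Q))"

lemma gderI:
  assumes "\<And>P. P \<in> carrier E \<Longrightarrow> \<delta> P \<in> carrier E"
    and "\<And>P Q. P \<in> carrier E \<Longrightarrow> Q \<in> carrier E \<Longrightarrow> \<delta> (P \<oplus>\<^bsub>E\<^esub> Q) = \<delta> P \<oplus>\<^bsub>E\<^esub> \<delta> Q"
    and "\<And>p P. P \<in> \<Lambda> p \<Longrightarrow> \<delta> P \<in> \<Lambda> (p + d)"
    and "\<And>p P Q. P \<in> \<Lambda> p \<Longrightarrow> P \<in> carrier E \<Longrightarrow> Q \<in> carrier E \<Longrightarrow>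
      \<delta> (P \<otimes>\<^bsub>E\<^esub> Q) = \<delta> P \<otimes>\<^bsub>E\<^esub> Q \<oplus>\<^bsub>E\<^esub> sg (d * p) (P \<otimes>\<^bsub>E\<^esub> \<delta> Q)"
  shows "graded_derivation d \<delta>"
  using assms \<Lambda>_closed by (simp add: graded_derivation_def)

lemma graded_derivation_closed [simp]: "graded_derivation d \<delta> \<Longrightarrow> P \<in> carrier E \<Longrightarrow> \<delta> P \<in> carrier E"
  by (simp add: graded_derivation_def)

lemma graded_derivation_add: "graded_derivation d \<delta> \<Longrightarrow> P \<in> carrier E \<Longrightarrow> Q \<in> carrier E \<Longrightarrow> \<delta> (P \<oplus>\<^bsub>E\<^esub> Q) = \<delta> P \<oplus>\<^bsub>E\<^esub> \<delta> Q"
  by (simp add: graded_derivation_def)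

lemma graded_derivation_\<Lambda>: "graded_derivation d \<delta> \<Longrightarrow> P \<in> \<Lambda> p \<Longrightarrow> \<delta> P \<in> \<Lambda> (p + d)"
  by (simp add: graded_derivation_def)

lemma graded_derivation_mult: "graded_derivation d \<delta> \<Longrightarrow> P \<in> \<Lambda> p \<Longrightarrow> Q \<in> carrier E \<Longrightarrow>
    \<delta> (P \<otimes>\<^bsub>E\<^esub> Q) = \<delta> P \<otimes>\<^bsub>E\<^esub> Q \<oplus>\<^bsub>E\<^esub> sg (d * p) (P \<otimes>\<^bsub>E\<^esub> \<delta> Q)"
  by (simp add: graded_derivation_def)

lemma graded_derivation_zero [simp]: "graded_derivation d \<delta> \<Longrightarrow> \<delta> \<zero>\<^bsub>E\<^esub> = \<zero>\<^bsub>E\<^esub>"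
  using graded_derivation_add[of d \<delta> "\<zero>\<^bsub>E\<^esub>" "\<zero>\<^bsub>E\<^esub>"] graded_derivation_closed[of d \<delta> "\<zero>\<^bsub>E\<^esub>"] by (simp add: E.add.r_cancel_one)

lemma graded_derivation_one: "graded_derivation d \<delta> \<Longrightarrow> \<delta> \<one>\<^bsub>E\<^esub> = \<zero>\<^bsub>E\<^esub>"
  using graded_derivation_mult[of d \<delta> "\<one>\<^bsub>E\<^esub>" 0 "\<one>\<^bsub>E\<^esub>"] graded_derivation_closed[of d \<delta> "\<one>\<^bsub>E\<^esub>"] \<Lambda>_cst[of "\<one>\<^bsub>A\<^esub>"]
  by (simp add: sign_pow_def E.add.r_cancel_one)

lemma graded_derivation_minus: "graded_derivation d \<delta> \<Longrightarrow> P \<in> carrier E \<Longrightarrow> \<delta> (\<ominus>\<^bsub>E\<^esub> P) = \<ominus>\<^bsub>E\<^esub> \<delta> P"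
  using graded_derivation_add[of d \<delta> "\<ominus>\<^bsub>E\<^esub> P" P] E.minus_equality[of "\<delta> (\<ominus>\<^bsub>E\<^esub> P)" "\<delta> P"] by (simp add: E.l_neg)

lemma graded_derivation_sg: "graded_derivation d \<delta> \<Longrightarrow> P \<in> carrier E \<Longrightarrow> \<delta> (sg n P) = sg n (\<delta> P)"
  by (simp add: sign_pow_def graded_derivation_minus)

lemma graded_derivation_unique:
  assumes "graded_derivation d \<delta>" "graded_derivation d \<epsilon>"
    and "\<And>a. a \<in> carrier A \<Longrightarrow> \<delta> (cst a) = \<epsilon> (cst a)"
    and "\<And>x. x \<in> carrier G \<Longrightarrow> \<delta> (gen x) = \<epsilon> (gen x)"
    and "P \<in> carrier E"
  shows "\<delta> P = \<epsilon> P"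
  using assms(5)
proof (induction rule: E_graded_induct)
  case (homogeneous p P)
  then show ?case
  proof (induction rule: homogeneous_induct)
    case (mult p q P Q)
    then show ?case
      using assms(1,2) by (simp add: graded_derivation_mult \<Lambda>_closed)
  qed (use assms(1-4) in \<open>simp_all add: graded_derivation_add \<Lambda>_closed\<close>)
qed (use assms(1,2) in \<open>simp add: graded_derivation_add\<close>)

text \<open>By graded commutativity the derivations form a left module over the exterior algebra:
  moving C past P contributes the parity \<open>c * p\<close> by which the new sign
  \<open>(c + d) * p\<close> differs from the old one.\<close>

lemma graded_derivation_times:
  assumes "C \<in> \<Lambda> c" "graded_derivation d \<delta>"
  shows "graded_derivation (c + d) (\<lambda>P. C \<otimes>\<^bsub>E\<^esub> \<delta> P)"
proof (rule gderI)
  fix p P Q assume *: "P \<in> \<Lambda> p" "P \<in> carrier E" "Q \<in> carrier E"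
  have C: "C \<in> carrier E" using assms \<Lambda>_closed by blast
  have "C \<otimes>\<^bsub>E\<^esub> \<delta> (P \<otimes>\<^bsub>E\<^esub> Q) = C \<otimes>\<^bsub>E\<^esub> \<delta> P \<otimes>\<^bsub>E\<^esub> Q \<oplus>\<^bsub>E\<^esub> sg (d * p) ((C \<otimes>\<^bsub>E\<^esub> P) \<otimes>\<^bsub>E\<^esub> \<delta> Q)"
    using * assms(2) C by (simp add: graded_derivation_mult E.r_distr E.sign_pow_mult_right E.m_assoc)
  also have "(C \<otimes>\<^bsub>E\<^esub> P) \<otimes>\<^bsub>E\<^esub> \<delta> Q = sg (c * p) (P \<otimes>\<^bsub>E\<^esub> (C \<otimes>\<^bsub>E\<^esub> \<delta> Q))"
    using * assms C by (simp add: graded_commute[of C c P p] E.sign_pow_mult_left E.m_assoc)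
  finally show "C \<otimes>\<^bsub>E\<^esub> \<delta> (P \<otimes>\<^bsub>E\<^esub> Q) = C \<otimes>\<^bsub>E\<^esub> \<delta> P \<otimes>\<^bsub>E\<^esub> Q \<oplus>\<^bsub>E\<^esub> sg ((c + d) * p) (P \<otimes>\<^bsub>E\<^esub> (C \<otimes>\<^bsub>E\<^esub> \<delta> Q))"
    using * assms(2) C by (simp add: E.sign_pow_sign_pow algebra_simps)
next
  fix p P assume "P \<in> \<Lambda> p"
  then show "C \<otimes>\<^bsub>E\<^esub> \<delta> P \<in> \<Lambda> (p + (c + d))"
    using \<Lambda>_mult[OF assms(1) graded_derivation_\<Lambda>[OF assms(2)], of P p] by (simp add: algebra_simps)
qed (use assms \<Lambda>_closed in \<open>auto simp: graded_derivation_add E.r_distr\<close>)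

lemma graded_derivation_plus:
  assumes "graded_derivation d \<delta>" "graded_derivation d \<epsilon>"
  shows "graded_derivation d (\<lambda>P. \<delta> P \<oplus>\<^bsub>E\<^esub> \<epsilon> P)"
proof (rule gderI)
  fix p P Q assume *: "P \<in> \<Lambda> p" "P \<in> carrier E" "Q \<in> carrier E"
  show "\<delta> (P \<otimes>\<^bsub>E\<^esub> Q) \<oplus>\<^bsub>E\<^esub> \<epsilon> (P \<otimes>\<^bsub>E\<^esub> Q) = (\<delta> P \<oplus>\<^bsub>E\<^esub> \<epsilon> P) \<otimes>\<^bsub>E\<^esub> Q \<oplus>\<^bsub>E\<^esub> sg (d * p) (P \<otimes>\<^bsub>E\<^esub> (\<delta> Q \<oplus>\<^bsub>E\<^esub> \<epsilon> Q))"
    using * assms by (simp add: graded_derivation_mult E.l_distr E.r_distr E.sign_pow_add E.a_ac)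
qed (use assms in \<open>simp_all add: graded_derivation_add graded_derivation_\<Lambda> E.a_ac\<close>)

lemma graded_derivation_sign:
  assumes "graded_derivation d \<delta>"
  shows "graded_derivation d (\<lambda>P. sg n (\<delta> P))"
proof (rule gderI)
  fix p P Q assume *: "P \<in> \<Lambda> p" "P \<in> carrier E" "Q \<in> carrier E"
  show "sg n (\<delta> (P \<otimes>\<^bsub>E\<^esub> Q)) = sg n (\<delta> P) \<otimes>\<^bsub>E\<^esub> Q \<oplus>\<^bsub>E\<^esub> sg (d * p) (P \<otimes>\<^bsub>E\<^esub> sg n (\<delta> Q))"
    using * assms by (simp add: graded_derivation_mult E.sign_pow_add E.sign_pow_sign_pow E.sign_pow_mult_left
        E.sign_pow_mult_right add.commute)
qed (use assms in \<open>simp_all add: graded_derivation_add graded_derivation_\<Lambda> E.sign_pow_add\<close>)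

text \<open>The exponent \<open>d * e + 1\<close> is the sign of the graded commutator: the
  composite in the other order is subtracted with the factor \<open>(-1)^(d * e)\<close>. With this
  sign the mixed terms cancel.\<close>

lemma graded_derivation_commutator:
  assumes "graded_derivation d \<delta>" "graded_derivation e \<epsilon>"
  shows "graded_derivation (d + e) (\<lambda>P. \<delta> (\<epsilon> P) \<oplus>\<^bsub>E\<^esub> sg (d * e + 1) (\<epsilon> (\<delta> P)))"
proof (rule gderI)
  fix p P Q assume *: "P \<in> \<Lambda> p" "P \<in> carrier E" "Q \<in> carrier E"
  \<comment> \<open>Here u, v, u', v' are the terms in which both derivations hit the same factor; x
    and y are the mixed terms \<open>\<epsilon> P \<otimes> \<delta> Q\<close> and
    \<open>\<delta> P \<otimes> \<epsilon> Q\<close>, which occur in both composites.\<close>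
  have aux: "(u \<oplus>\<^bsub>E\<^esub> sg (d * (p + e)) x) \<oplus>\<^bsub>E\<^esub> (sg (e * p) y \<oplus>\<^bsub>E\<^esub> sg (e * p + d * p) v) \<oplus>\<^bsub>E\<^esub>
      sg (d * e + 1) ((u' \<oplus>\<^bsub>E\<^esub> sg (e * (p + d)) y) \<oplus>\<^bsub>E\<^esub> (sg (d * p) x \<oplus>\<^bsub>E\<^esub> sg (d * p + e * p) v')) =
      (u \<oplus>\<^bsub>E\<^esub> sg (d * e + 1) u') \<oplus>\<^bsub>E\<^esub> sg ((d + e) * p) (v \<oplus>\<^bsub>E\<^esub> sg (d * e + 1) v')"
    if [simp]: "u \<in> carrier E" "v \<in> carrier E" "x \<in> carrier E" "y \<in> carrier E" "u' \<in> carrier E" "v' \<in> carrier E" for u v x y u' v'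
  proof -
    have x: "sg (d * (p + e)) x \<oplus>\<^bsub>E\<^esub> sg (d * e + 1) (sg (d * p) x) = \<zero>\<^bsub>E\<^esub>"
      and y: "sg (e * p) y \<oplus>\<^bsub>E\<^esub> sg (d * e + 1) (sg (e * (p + d)) y) = \<zero>\<^bsub>E\<^esub>"
      by (auto simp: sign_pow_def E.l_neg E.r_neg)
    have v: "sg (e * p + d * p) v = sg ((d + e) * p) v"
      "sg (d * e + 1) (sg (d * p + e * p) v') = sg ((d + e) * p) (sg (d * e + 1) v')"
      by (simp_all add: E.sign_pow_sign_pow algebra_simps)
    have "(u \<oplus>\<^bsub>E\<^esub> sg (d * (p + e)) x) \<oplus>\<^bsub>E\<^esub> (sg (e * p) y \<oplus>\<^bsub>E\<^esub> sg (e * p + d * p) v) \<oplus>\<^bsub>E\<^esub>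
      sg (d * e + 1) ((u' \<oplus>\<^bsub>E\<^esub> sg (e * (p + d)) y) \<oplus>\<^bsub>E\<^esub> (sg (d * p) x \<oplus>\<^bsub>E\<^esub> sg (d * p + e * p) v')) =
      (u \<oplus>\<^bsub>E\<^esub> sg (d * e + 1) u') \<oplus>\<^bsub>E\<^esub>
      (sg (e * p + d * p) v \<oplus>\<^bsub>E\<^esub> sg (d * e + 1) (sg (d * p + e * p) v')) \<oplus>\<^bsub>E\<^esub>
      ((sg (d * (p + e)) x \<oplus>\<^bsub>E\<^esub> sg (d * e + 1) (sg (d * p) x)) \<oplus>\<^bsub>E\<^esub>
       (sg (e * p) y \<oplus>\<^bsub>E\<^esub> sg (d * e + 1) (sg (e * (p + d)) y)))"
      by (simp add: E.sign_pow_add E.a_ac)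
    then show ?thesis
      unfolding x y v by (simp add: E.sign_pow_add)
  qed
  have 1: "\<delta> (\<epsilon> (P \<otimes>\<^bsub>E\<^esub> Q)) = (\<delta> (\<epsilon> P) \<otimes>\<^bsub>E\<^esub> Q \<oplus>\<^bsub>E\<^esub> sg (d * (p + e)) (\<epsilon> P \<otimes>\<^bsub>E\<^esub> \<delta> Q)) \<oplus>\<^bsub>E\<^esub>
      (sg (e * p) (\<delta> P \<otimes>\<^bsub>E\<^esub> \<epsilon> Q) \<oplus>\<^bsub>E\<^esub> sg (e * p + d * p) (P \<otimes>\<^bsub>E\<^esub> \<delta> (\<epsilon> Q)))"
    using * assms
    by (simp add: graded_derivation_mult[OF assms(2)] graded_derivation_mult[OF assms(1)] graded_derivation_mult[OF assms(1) graded_derivation_\<Lambda>]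
        graded_derivation_add graded_derivation_sg[OF assms(1)] E.sign_pow_add E.sign_pow_sign_pow)
  have 2: "\<epsilon> (\<delta> (P \<otimes>\<^bsub>E\<^esub> Q)) = (\<epsilon> (\<delta> P) \<otimes>\<^bsub>E\<^esub> Q \<oplus>\<^bsub>E\<^esub> sg (e * (p + d)) (\<delta> P \<otimes>\<^bsub>E\<^esub> \<epsilon> Q)) \<oplus>\<^bsub>E\<^esub>
      (sg (d * p) (\<epsilon> P \<otimes>\<^bsub>E\<^esub> \<delta> Q) \<oplus>\<^bsub>E\<^esub> sg (d * p + e * p) (P \<otimes>\<^bsub>E\<^esub> \<epsilon> (\<delta> Q)))"
    using * assms
    by (simp add: graded_derivation_mult[OF assms(1)] graded_derivation_mult[OF assms(2)] graded_derivation_mult[OF assms(2) graded_derivation_\<Lambda>]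
        graded_derivation_add graded_derivation_sg[OF assms(2)] E.sign_pow_add E.sign_pow_sign_pow)
  show "\<delta> (\<epsilon> (P \<otimes>\<^bsub>E\<^esub> Q)) \<oplus>\<^bsub>E\<^esub> sg (d * e + 1) (\<epsilon> (\<delta> (P \<otimes>\<^bsub>E\<^esub> Q))) =
      (\<delta> (\<epsilon> P) \<oplus>\<^bsub>E\<^esub> sg (d * e + 1) (\<epsilon> (\<delta> P))) \<otimes>\<^bsub>E\<^esub> Q \<oplus>\<^bsub>E\<^esub>
      sg ((d + e) * p) (P \<otimes>\<^bsub>E\<^esub> (\<delta> (\<epsilon> Q) \<oplus>\<^bsub>E\<^esub> sg (d * e + 1) (\<epsilon> (\<delta> Q))))"
    unfolding 1 2 using * assms
    by (subst aux) (simp_all add: E.l_distr E.r_distr E.sign_pow_mult_left E.sign_pow_mult_right)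
next
  fix p P assume "P \<in> \<Lambda> p"
  then have "\<delta> (\<epsilon> P) \<in> \<Lambda> (p + e + d)" "\<epsilon> (\<delta> P) \<in> \<Lambda> (p + d + e)"
    using graded_derivation_\<Lambda>[OF assms(1) graded_derivation_\<Lambda>[OF assms(2)]] graded_derivation_\<Lambda>[OF assms(2) graded_derivation_\<Lambda>[OF assms(1)]] by auto
  then show "\<delta> (\<epsilon> P) \<oplus>\<^bsub>E\<^esub> sg (d * e + 1) (\<epsilon> (\<delta> P)) \<in> \<Lambda> (p + (d + e))"
    by (simp add: algebra_simps)
qed (use assms in \<open>simp_all add: graded_derivation_add E.sign_pow_add E.a_ac\<close>)

section \<open>Derivations with prescribed values on generators\<close>

primrec der_word :: "int \<Rightarrow> ('g \<Rightarrow> ('g list \<Rightarrow> 'a) set) \<Rightarrow> 'g list \<Rightarrow> ('g list \<Rightarrow> 'a) set" where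
  "der_word d \<delta>1 [] = \<zero>\<^bsub>E\<^esub>"
| "der_word d \<delta>1 (x # w) = \<delta>1 x \<otimes>\<^bsub>E\<^esub> W w \<oplus>\<^bsub>E\<^esub> sg d (gen x \<otimes>\<^bsub>E\<^esub> der_word d \<delta>1 w)"

end

text \<open>Two product rules suffice, for \<open>a b\<close> and \<open>a x\<close>, the products
  of generators that are generators again. One factor is a constant, of degree 0, so no sign
  appears.\<close>

locale derivation_data = exterior_algebra A G
  for A :: "('a, 'm) ring_scheme" and G :: "('a, 'g, 'n) module_scheme" +
  fixes d :: int and \<delta>0 :: "'a \<Rightarrow> ('g list \<Rightarrow> 'a) set" and \<delta>1 :: "'g \<Rightarrow> ('g list \<Rightarrow> 'a) set"
  assumes \<delta>0_\<Lambda>: "a \<in> carrier A \<Longrightarrow> \<delta>0 a \<in> \<Lambda> d"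
    and \<delta>1_\<Lambda>: "x \<in> carrier G \<Longrightarrow> \<delta>1 x \<in> \<Lambda> (1 + d)"
    and \<delta>0_add: "a \<in> carrier A \<Longrightarrow> b \<in> carrier A \<Longrightarrow> \<delta>0 (a \<oplus>\<^bsub>A\<^esub> b) = \<delta>0 a \<oplus>\<^bsub>E\<^esub> \<delta>0 b"
    and \<delta>0_mult: "a \<in> carrier A \<Longrightarrow> b \<in> carrier A \<Longrightarrow> \<delta>0 (a \<otimes>\<^bsub>A\<^esub> b) = cst b \<otimes>\<^bsub>E\<^esub> \<delta>0 a \<oplus>\<^bsub>E\<^esub> cst a \<otimes>\<^bsub>E\<^esub> \<delta>0 b"
    and \<delta>1_add: "x \<in> carrier G \<Longrightarrow> y \<in> carrier G \<Longrightarrow> \<delta>1 (x \<oplus>\<^bsub>G\<^esub> y) = \<delta>1 x \<oplus>\<^bsub>E\<^esub> \<delta>1 y"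
    and \<delta>1_smult: "a \<in> carrier A \<Longrightarrow> x \<in> carrier G \<Longrightarrow> \<delta>1 (a \<odot>\<^bsub>G\<^esub> x) = \<delta>0 a \<otimes>\<^bsub>E\<^esub> gen x \<oplus>\<^bsub>E\<^esub> cst a \<otimes>\<^bsub>E\<^esub> \<delta>1 x"
begin

abbreviation "\<Delta> \<equiv> der_word d \<delta>1"

lemma \<delta>0_closed [simp]: "a \<in> carrier A \<Longrightarrow> \<delta>0 a \<in> carrier E"
  using \<delta>0_\<Lambda> \<Lambda>_closed by blast

lemma \<delta>1_closed [simp]: "x \<in> carrier G \<Longrightarrow> \<delta>1 x \<in> carrier E"
  using \<delta>1_\<Lambda> \<Lambda>_closed by blast

lemma \<Delta>_\<Lambda>: "w \<in> lists (carrier G) \<Longrightarrow> \<Delta> w \<in> \<Lambda> (int (length w) + d)"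
proof (induction w)
  case (Cons x w)
  then have "\<delta>1 x \<otimes>\<^bsub>E\<^esub> W w \<in> \<Lambda> (1 + d + int (length w))"
    "gen x \<otimes>\<^bsub>E\<^esub> \<Delta> w \<in> \<Lambda> (1 + (int (length w) + d))"
    by (auto intro!: \<Lambda>_mult \<delta>1_\<Lambda> \<Lambda>_W \<Lambda>_gen)
  then show ?case by (simp add: algebra_simps)
qed simp

lemma \<Delta>_closed [simp]: "w \<in> lists (carrier G) \<Longrightarrow> \<Delta> w \<in> carrier E"
  using \<Delta>_\<Lambda> \<Lambda>_closed by blast

lemma \<Delta>_append:
  assumes "u \<in> lists (carrier G)" "v \<in> lists (carrier G)"
  shows "\<Delta> (u @ v) = \<Delta> u \<otimes>\<^bsub>E\<^esub> W v \<oplus>\<^bsub>E\<^esub> sg (d * int (length u)) (W u \<otimes>\<^bsub>E\<^esub> \<Delta> v)"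
  using assms(1)
proof (induction u)
  case Nil
  then show ?case using assms by (simp add: sign_pow_def)
next
  case (Cons x u)
  then show ?case
    using assms(2)
    by (simp add: W_append E.l_distr E.r_distr E.sign_pow_add E.sign_pow_mult_left
        E.sign_pow_mult_right E.sign_pow_sign_pow E.m_assoc E.a_assoc algebra_simps)
qed

lemma \<delta>0_zero [simp]: "\<delta>0 \<zero>\<^bsub>A\<^esub> = \<zero>\<^bsub>E\<^esub>"
  using \<delta>0_add[of "\<zero>\<^bsub>A\<^esub>" "\<zero>\<^bsub>A\<^esub>"] \<delta>0_closed[of "\<zero>\<^bsub>A\<^esub>"] by (simp add: E.add.r_cancel_one)

lemma \<delta>0_one [simp]: "\<delta>0 \<one>\<^bsub>A\<^esub> = \<zero>\<^bsub>E\<^esub>"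
  using \<delta>0_mult[of "\<one>\<^bsub>A\<^esub>" "\<one>\<^bsub>A\<^esub>"] \<delta>0_closed[of "\<one>\<^bsub>A\<^esub>"] by (simp add: E.add.r_cancel_one)

definition der_monomial :: "'a \<Rightarrow> 'g list \<Rightarrow> ('g list \<Rightarrow> 'a) set" where
  "der_monomial a w = \<delta>0 a \<otimes>\<^bsub>E\<^esub> W w \<oplus>\<^bsub>E\<^esub> cst a \<otimes>\<^bsub>E\<^esub> \<Delta> w"

text \<open>The source is the free algebra, which has the words as a basis over A, so nothing has to
  be well defined yet. The values lie in the quotient already, and D becomes a derivation along
  \<open>\<pi>\<close>.\<close>

definition D :: "('g list \<Rightarrow> 'a) \<Rightarrow> ('g list \<Rightarrow> 'a) set" where
  "D f = (\<Oplus>\<^bsub>E\<^esub> w\<in>{w. f w \<noteq> \<zero>\<^bsub>A\<^esub>}. der_monomial (f w) w)"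

lemma der_monomial_closed [simp]: "a \<in> carrier A \<Longrightarrow> w \<in> lists (carrier G) \<Longrightarrow> der_monomial a w \<in> carrier E"
  by (simp add: der_monomial_def)

lemma der_monomial_zero: "w \<in> lists (carrier G) \<Longrightarrow> der_monomial \<zero>\<^bsub>A\<^esub> w = \<zero>\<^bsub>E\<^esub>"
  by (simp add: der_monomial_def)

lemma der_monomial_add:
  "a \<in> carrier A \<Longrightarrow> b \<in> carrier A \<Longrightarrow> w \<in> lists (carrier G) \<Longrightarrow> der_monomial (a \<oplus>\<^bsub>A\<^esub> b) w = der_monomial a w \<oplus>\<^bsub>E\<^esub> der_monomial b w"
  by (simp add: der_monomial_def \<delta>0_add cst_add E.l_distr E.a_ac)

lemma der_monomial_\<Lambda>: "a \<in> carrier A \<Longrightarrow> w \<in> lists (carrier G) \<Longrightarrow> der_monomial a w \<in> \<Lambda> (int (length w) + d)"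
  unfolding der_monomial_def
  using \<Lambda>_mult[OF \<delta>0_\<Lambda> \<Lambda>_W, of a w] \<Lambda>_cst_mult[OF _ \<Delta>_\<Lambda>, of a w] by (simp add: add.commute)

lemma D_eq:
  assumes "f \<in> carrier F" "finite T" "{w. f w \<noteq> \<zero>\<^bsub>A\<^esub>} \<subseteq> T" "T \<subseteq> lists (carrier G)"
  shows "D f = (\<Oplus>\<^bsub>E\<^esub> w\<in>T. der_monomial (f w) w)"
  unfolding D_def using assms
  by (intro E.add.finprod_mono_neutral_cong_left)
    (auto simp: der_monomial_zero subset_iff simp del: in_lists_conv_set)

lemma supp_lists: "f \<in> carrier F \<Longrightarrow> {w. f w \<noteq> \<zero>\<^bsub>A\<^esub>} \<subseteq> lists (carrier G)"
  using F_outside by blast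

lemma D_monomial: "a \<in> carrier A \<Longrightarrow> u \<in> lists (carrier G) \<Longrightarrow> D (monomial a u) = der_monomial a u"
proof -
  assume *: "a \<in> carrier A" "u \<in> lists (carrier G)"
  have "D (monomial a u) = (\<Oplus>\<^bsub>E\<^esub> w\<in>{u}. der_monomial (monomial a u w) w)"
    by (rule D_eq) (use * in \<open>simp_all add: subset_iff\<close>, simp add: monomial_def)
  then show ?thesis
    using * by (simp add: monomial_def)
qed

lemma D_add:
  assumes "f \<in> carrier F" "g \<in> carrier F" shows "D (f \<oplus>\<^bsub>F\<^esub> g) = D f \<oplus>\<^bsub>E\<^esub> D g"
proof -
  let ?T = "{w. f w \<noteq> \<zero>\<^bsub>A\<^esub>} \<union> {w. g w \<noteq> \<zero>\<^bsub>A\<^esub>}"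
  have T: "finite ?T" "?T \<subseteq> lists (carrier G)" "{w. (f \<oplus>\<^bsub>F\<^esub> g) w \<noteq> \<zero>\<^bsub>A\<^esub>} \<subseteq> ?T"
    using assms supp_lists by (auto simp: F_finite F_ops(2))
  have c: "(\<lambda>w. der_monomial (f w) w) \<in> ?T \<rightarrow> carrier E" "(\<lambda>w. der_monomial (g w) w) \<in> ?T \<rightarrow> carrier E"
    using T(2) assms by (auto simp: subset_iff simp del: in_lists_conv_set)
  have "D (f \<oplus>\<^bsub>F\<^esub> g) = (\<Oplus>\<^bsub>E\<^esub> w\<in>?T. der_monomial ((f \<oplus>\<^bsub>F\<^esub> g) w) w)"
    using T assms by (intro D_eq) auto
  also have "\<dots> = (\<Oplus>\<^bsub>E\<^esub> w\<in>?T. der_monomial (f w) w \<oplus>\<^bsub>E\<^esub> der_monomial (g w) w)"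
    using T(2) assms
    by (intro E.finsum_cong') (auto simp: F_ops(2) der_monomial_add subset_iff simp del: in_lists_conv_set)
  also have "\<dots> = (\<Oplus>\<^bsub>E\<^esub> w\<in>?T. der_monomial (f w) w) \<oplus>\<^bsub>E\<^esub> (\<Oplus>\<^bsub>E\<^esub> w\<in>?T. der_monomial (g w) w)"
    using c by (rule E.finsum_addf)
  also have "(\<Oplus>\<^bsub>E\<^esub> w\<in>?T. der_monomial (f w) w) = D f"
    using T assms by (intro D_eq[symmetric]) auto
  also have "(\<Oplus>\<^bsub>E\<^esub> w\<in>?T. der_monomial (g w) w) = D g"
    using T assms by (intro D_eq[symmetric]) auto
  finally show ?thesis .
qed

lemma D_zero [simp]: "D \<zero>\<^bsub>F\<^esub> = \<zero>\<^bsub>E\<^esub>"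
  by (simp add: zero_eq_mono[of "[]"] D_monomial der_monomial_zero)

lemma D_closed [simp]: "f \<in> carrier F \<Longrightarrow> D f \<in> carrier E"
proof -
  assume f: "f \<in> carrier F"
  then show ?thesis
    by (induction f rule: F_induct) (use f in \<open>simp_all add: D_add D_monomial del: in_lists_conv_set\<close>)
qed

lemma D_minus: "f \<in> carrier F \<Longrightarrow> g \<in> carrier F \<Longrightarrow> D (f \<ominus>\<^bsub>F\<^esub> g) = D f \<ominus>\<^bsub>E\<^esub> D g"
proof -
  assume *: "f \<in> carrier F" "g \<in> carrier F"
  have "D (f \<ominus>\<^bsub>F\<^esub> g) \<oplus>\<^bsub>E\<^esub> D g = D f"
    using * by (simp add: D_add[symmetric] a_minus_def F.a_assoc F.l_neg)
  then show ?thesis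
    using * by (metis E.add.inv_solve_right F.minus_closed a_minus_def D_closed)
qed

text \<open>The term with \<open>\<delta>0 b\<close> has this factor in front of \<open>W u\<close>
  on the left-hand side and behind it on the right-hand side. Moving it past \<open>W u\<close>
  costs exactly the sign in the Leibniz rule, so the two signs cancel.\<close>

lemma der_monomial_mult:
  assumes "a \<in> carrier A" "b \<in> carrier A" "u \<in> lists (carrier G)" "v \<in> lists (carrier G)"
  shows "der_monomial (a \<otimes>\<^bsub>A\<^esub> b) (u @ v) = der_monomial a u \<otimes>\<^bsub>E\<^esub> (cst b \<otimes>\<^bsub>E\<^esub> W v) \<oplus>\<^bsub>E\<^esub>
    sg (d * int (length u)) (cst a \<otimes>\<^bsub>E\<^esub> W u \<otimes>\<^bsub>E\<^esub> der_monomial b v)"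
proof -
  have c: "x \<otimes>\<^bsub>E\<^esub> (cst b \<otimes>\<^bsub>E\<^esub> y) = cst b \<otimes>\<^bsub>E\<^esub> (x \<otimes>\<^bsub>E\<^esub> y)" if "x \<in> carrier E" "y \<in> carrier E" for x y
    using that assms(2) by (simp add: cst_central E.m_assoc[symmetric])
  have w: "W u \<otimes>\<^bsub>E\<^esub> \<delta>0 b = sg (d * int (length u)) (\<delta>0 b \<otimes>\<^bsub>E\<^esub> W u)"
    using assms graded_commute[OF \<Lambda>_W \<delta>0_\<Lambda>, of u b] by (simp add: mult.commute)
  have w': "sg (d * int (length u)) (cst a \<otimes>\<^bsub>E\<^esub> (W u \<otimes>\<^bsub>E\<^esub> (\<delta>0 b \<otimes>\<^bsub>E\<^esub> W v))) =
      cst a \<otimes>\<^bsub>E\<^esub> (\<delta>0 b \<otimes>\<^bsub>E\<^esub> (W u \<otimes>\<^bsub>E\<^esub> W v))"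
    using assms by (simp add: E.m_assoc[symmetric] w E.sign_pow_mult_left E.sign_pow_mult_right
        E.sign_pow_sign_pow E.sign_pow_even)
  show ?thesis
    using assms
    by (simp add: der_monomial_def \<delta>0_mult cst_mult \<Delta>_append W_append E.l_distr E.r_distr E.sign_pow_add
        E.m_assoc E.sign_pow_mult_right c[of "\<delta>0 a"] c[of "W u"] c[of "\<Delta> u"] w' E.a_ac)
qed

lemma D_\<Lambda>:
  assumes "f \<in> FP p" shows "D f \<in> \<Lambda> (p + d)"
  using FP_closed[OF assms]
proof (induction f rule: F_induct)
  case (monomial w)
  then have "int (length w) = p"
    using assms by (auto simp: FP_def)
  then show ?case
    using monomial der_monomial_\<Lambda>[of "f w" w] FP_closed[OF assms] by (simp add: D_monomial)
qed (simp_all add: D_add)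

lemma D_mult:
  assumes f: "f \<in> FP p" and g: "g \<in> carrier F"
  shows "D (f \<otimes>\<^bsub>F\<^esub> g) = D f \<otimes>\<^bsub>E\<^esub> \<pi> g \<oplus>\<^bsub>E\<^esub> sg (d * p) (\<pi> f \<otimes>\<^bsub>E\<^esub> D g)"
  using FP_closed[OF f]
proof (induction f rule: F_induct)
  case zero
  then show ?case using g by (simp add: \<pi>_zero)
next
  case (add f1 f2)
  then show ?case
    using g by (simp add: F.l_distr D_add \<pi>_add E.l_distr E.sign_pow_add E.a_ac)
next
  case (monomial u)
  then have u: "int (length u) = p" "u \<in> lists (carrier G)" "f u \<in> carrier A"
    using f FP_closed[OF f] by (auto simp: FP_def)
  from g show ?case
  proof (induction g rule: F_induct)
    case zero
    then show ?case using u by (simp add: \<pi>_zero del: in_lists_conv_set)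
  next
    case (add g1 g2)
    then show ?case
      using u by (simp add: F.r_distr D_add \<pi>_add E.r_distr E.sign_pow_add E.a_ac del: in_lists_conv_set)
  next
    case (monomial v)
    then show ?case
      using u g
      by (simp add: monomial_mult D_monomial \<pi>_monomial der_monomial_mult del: in_lists_conv_set)
  qed
qed

lemma D_relator:
  assumes "r \<in> relators" shows "D r = \<zero>\<^bsub>E\<^esub>"
proof -
  have D1: "D (word A [x]) = \<delta>1 x" if "x \<in> carrier G" for x
    using that by (simp add: word_eq_mono D_monomial der_monomial_def)
  have D2: "D (a \<odot>\<^bsub>F\<^esub> word A [x]) = \<delta>0 a \<otimes>\<^bsub>E\<^esub> gen x \<oplus>\<^bsub>E\<^esub> cst a \<otimes>\<^bsub>E\<^esub> \<delta>1 x" if "a \<in> carrier A" "x \<in> carrier G" for a x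
    using that by (simp add: smult_word D_monomial der_monomial_def)
  have z: "P \<ominus>\<^bsub>E\<^esub> P = \<zero>\<^bsub>E\<^esub>" if "P \<in> carrier E" for P
    using that by (simp add: a_minus_def E.r_neg)
  have D3: "D (word A [x, x]) = \<zero>\<^bsub>E\<^esub>" if "x \<in> carrier G" for x
  proof -
    \<comment> \<open>In \<open>D (word A [x, x])\<close> this product carries the sign with
      exponent d. Together with \<open>1 + d\<close> the exponent is odd, and the product cancels
      \<open>\<delta>1 x \<otimes> gen x\<close>.\<close>
    have "gen x \<otimes>\<^bsub>E\<^esub> \<delta>1 x = sg (1 + d) (\<delta>1 x \<otimes>\<^bsub>E\<^esub> gen x)"
      using that gen_commute[OF \<delta>1_\<Lambda>] by simp
    then show ?thesis
      using that by (simp add: word_eq_mono D_monomial der_monomial_def E.sign_pow_sign_pow)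
        (simp add: sign_pow_def E.r_neg)
  qed
  show ?thesis
    using assms unfolding relators_def
    by (elim UnE CollectE exE conjE)
      (simp_all add: D_minus D_add D1 D2 D3 \<delta>1_add \<delta>1_smult F_smult_closed F_add_closed
        z)
qed

text \<open>A relator is killed by D as well as by \<open>\<pi>\<close>, so every term in the
  Leibniz expansion of its multiples vanishes.\<close>

lemma D_I: "f \<in> I \<Longrightarrow> D f = \<zero>\<^bsub>E\<^esub>"
proof (induction f rule: I_induct)
  case (add g h)
  then show ?case by (simp add: D_add)
next
  case (relator a u r b v)
  then obtain n where n: "r \<in> FP n" using relators_homogeneous by blast
  have r: "r \<in> carrier F" "\<pi> r = \<zero>\<^bsub>E\<^esub>" "D r = \<zero>\<^bsub>E\<^esub>"
    using relator relators_I relators_subset \<pi>_eq_zero D_relator by auto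
  have "monomial a u \<otimes>\<^bsub>F\<^esub> r \<in> FP (int (length u) + n)"
    using relator n by (intro FP_mult FP_monomial)
  moreover have "D (monomial a u \<otimes>\<^bsub>F\<^esub> r) = \<zero>\<^bsub>E\<^esub>"
    using relator r D_mult[OF FP_monomial, of a u r] by (simp del: in_lists_conv_set)
  moreover have "\<pi> (monomial a u \<otimes>\<^bsub>F\<^esub> r) = \<zero>\<^bsub>E\<^esub>"
    using relator r by (simp add: \<pi>_mult del: in_lists_conv_set)
  ultimately show ?case
    using relator D_mult[of "monomial a u \<otimes>\<^bsub>F\<^esub> r" _ "monomial b v"] by (simp del: in_lists_conv_set)
qed simp

lemma derivation_exists:
  "\<exists>\<delta>. graded_derivation d \<delta> \<and> (\<forall>a\<in>carrier A. \<delta> (cst a) = \<delta>0 a) \<and> (\<forall>x\<in>carrier G. \<delta> (gen x) = \<delta>1 x)"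
proof -
  define \<delta> where "\<delta> P = D (SOME f. f \<in> carrier F \<and> \<pi> f = P)" for P
  have \<delta>: "\<delta> (\<pi> f) = D f" if f: "f \<in> carrier F" for f
  proof -
    define g where "g = (SOME g. g \<in> carrier F \<and> \<pi> g = \<pi> f)"
    have g: "g \<in> carrier F \<and> \<pi> g = \<pi> f"
      unfolding g_def by (rule someI[of _ f]) (use f in simp)
    then have "D g \<ominus>\<^bsub>E\<^esub> D f = \<zero>\<^bsub>E\<^esub>"
      using f D_I[OF \<pi>_eqD[of g f]] by (simp add: D_minus)
    from E.minus_eq_zeroD[OF _ _ this] show ?thesis
      using f g by (simp add: \<delta>_def g_def)
  qed
  have "graded_derivation d \<delta>"
  proof (rule gderI)
    fix p P Q assume "P \<in> \<Lambda> p" "Q \<in> carrier E"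
    then obtain f g where "P = \<pi> f" "f \<in> FP p" "Q = \<pi> g" "g \<in> carrier F"
      by (auto simp: \<Lambda>_eq E_carrier)
    then show "\<delta> (P \<otimes>\<^bsub>E\<^esub> Q) = \<delta> P \<otimes>\<^bsub>E\<^esub> Q \<oplus>\<^bsub>E\<^esub> sg (d * p) (P \<otimes>\<^bsub>E\<^esub> \<delta> Q)"
      using FP_closed[of f p] D_mult[of f p g] by (simp add: \<delta> \<pi>_mult[symmetric])
  next
    fix p P assume "P \<in> \<Lambda> p"
    then obtain f where f: "P = \<pi> f" "f \<in> FP p"
      by (auto simp: \<Lambda>_eq)
    then show "\<delta> P \<in> \<Lambda> (p + d)"
      using D_\<Lambda>[of f p] FP_closed[of f p] by (simp add: \<delta>)
  next
    fix P Q assume "P \<in> carrier E" "Q \<in> carrier E"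
    then obtain f g where "P = \<pi> f" "f \<in> carrier F" "Q = \<pi> g" "g \<in> carrier F"
      by (auto simp: E_carrier)
    then show "\<delta> (P \<oplus>\<^bsub>E\<^esub> Q) = \<delta> P \<oplus>\<^bsub>E\<^esub> \<delta> Q"
      by (simp add: \<delta> \<pi>_add[symmetric] D_add F_add_closed)
  next
    fix P assume "P \<in> carrier E"
    then obtain f where "P = \<pi> f" "f \<in> carrier F"
      by (auto simp: E_carrier)
    then show "\<delta> P \<in> carrier E"
      by (simp add: \<delta>)
  qed
  moreover have "\<delta> (cst a) = \<delta>0 a" if "a \<in> carrier A" for a
    using that by (simp add: cst_eq \<delta> D_monomial der_monomial_def)
  moreover have "\<delta> (gen x) = \<delta>1 x" if "x \<in> carrier G" for x
    using that by (simp add: \<delta> word_eq_mono D_monomial der_monomial_def)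
  ultimately show ?thesis by blast
qed

end

section \<open>Restriction of scalars\<close>

lemma restrict_scalars_simps [simp]:
  "carrier (restrict_scalars A M) = carrier M" "mult (restrict_scalars A M) = mult M"
  "one (restrict_scalars A M) = one M" "zero (restrict_scalars A M) = zero M"
  "add (restrict_scalars A M) = add M"
  "smult (restrict_scalars A M) k x = (k \<odot>\<^bsub>A\<^esub> \<one>\<^bsub>A\<^esub>) \<odot>\<^bsub>M\<^esub> x"
  by (simp_all add: restrict_scalars_def)

lemma a_inv_restrict_scalars [simp]: "a_inv (restrict_scalars A M) = a_inv M"
  by (simp add: a_inv_def m_inv_def fun_eq_iff)

lemma sign_pow_restrict_scalars [simp]: "sign_pow (restrict_scalars A M) = sign_pow M"
  by (simp add: sign_pow_def fun_eq_iff)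

lemma finsum_restrict_scalars [simp]: "finsum (restrict_scalars A M) = finsum M"
  by (simp add: finsum_def finprod_def fun_eq_iff)

section \<open>The bracket of a Lie--Rinehart algebra\<close>

sublocale lie_rinehart \<subseteq> exterior_algebra A G
  by (intro exterior_algebra.intro module algebra.M_cring[OF algebra])

context lie_rinehart
begin

section \<open>Consequences of the Lie--Rinehart axioms\<close>

sublocale KA: algebra K A
  by (rule algebra)

lemma br_bilinear: "bilinear_op K (restrict_scalars A G) br"
  using lie_algebra by (simp add: lie_algebra_def)

lemma br_closed [simp]: "x \<in> carrier G \<Longrightarrow> y \<in> carrier G \<Longrightarrow> br x y \<in> carrier G"
  using br_bilinear by (auto simp: bilinear_op_def)

lemma br_add_left: "x \<in> carrier G \<Longrightarrow> y \<in> carrier G \<Longrightarrow> z \<in> carrier G \<Longrightarrow> br (x \<oplus>\<^bsub>G\<^esub> y) z = br x z \<oplus>\<^bsub>G\<^esub> br y z"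
  using br_bilinear by (simp add: bilinear_op_def)

lemma br_add_right: "x \<in> carrier G \<Longrightarrow> y \<in> carrier G \<Longrightarrow> z \<in> carrier G \<Longrightarrow> br x (y \<oplus>\<^bsub>G\<^esub> z) = br x y \<oplus>\<^bsub>G\<^esub> br x z"
  using br_bilinear by (simp add: bilinear_op_def)

lemma br_self: "x \<in> carrier G \<Longrightarrow> br x x = \<zero>\<^bsub>G\<^esub>"
  using lie_algebra.alternating[OF lie_algebra, of x] by simp

lemma br_jacobi: "x \<in> carrier G \<Longrightarrow> y \<in> carrier G \<Longrightarrow> z \<in> carrier G \<Longrightarrow>
    br x (br y z) \<oplus>\<^bsub>G\<^esub> br y (br z x) \<oplus>\<^bsub>G\<^esub> br z (br x y) = \<zero>\<^bsub>G\<^esub>"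
  using lie_algebra.jacobi[OF lie_algebra, of x y z] by simp

lemma br_anticommute:
  assumes "x \<in> carrier G" "y \<in> carrier G" shows "br x y = \<ominus>\<^bsub>G\<^esub> br y x"
proof -
  have "br (x \<oplus>\<^bsub>G\<^esub> y) (x \<oplus>\<^bsub>G\<^esub> y) = \<zero>\<^bsub>G\<^esub>"
    using assms by (intro br_self) simp
  then have "br x y \<oplus>\<^bsub>G\<^esub> br y x = \<zero>\<^bsub>G\<^esub>"
    using assms by (simp add: br_add_left br_add_right br_self[of x] br_self[of y] G.M.a_comm)
  then show ?thesis
    using assms by (intro G.M.minus_equality[symmetric]) auto
qed

lemma \<rho>_derivation: "x \<in> carrier G \<Longrightarrow> \<rho> x \<in> derivations K A"
  using anchor_closed by blast

lemma \<rho>_closed [simp]: "x \<in> carrier G \<Longrightarrow> a \<in> carrier A \<Longrightarrow> \<rho> x a \<in> carrier A"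
  using \<rho>_derivation[of x] by (auto simp: derivations_def)

lemma \<rho>_add: "x \<in> carrier G \<Longrightarrow> a \<in> carrier A \<Longrightarrow> b \<in> carrier A \<Longrightarrow> \<rho> x (a \<oplus>\<^bsub>A\<^esub> b) = \<rho> x a \<oplus>\<^bsub>A\<^esub> \<rho> x b"
  using \<rho>_derivation[of x] by (auto simp: derivations_def)

lemma \<rho>_mult: "x \<in> carrier G \<Longrightarrow> a \<in> carrier A \<Longrightarrow> b \<in> carrier A \<Longrightarrow> \<rho> x (a \<otimes>\<^bsub>A\<^esub> b) = a \<otimes>\<^bsub>A\<^esub> \<rho> x b \<oplus>\<^bsub>A\<^esub> \<rho> x a \<otimes>\<^bsub>A\<^esub> b"
  using \<rho>_derivation[of x] by (auto simp: derivations_def)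

lemma \<rho>_mult': "x \<in> carrier G \<Longrightarrow> a \<in> carrier A \<Longrightarrow> b \<in> carrier A \<Longrightarrow> \<rho> x (a \<otimes>\<^bsub>A\<^esub> b) = b \<otimes>\<^bsub>A\<^esub> \<rho> x a \<oplus>\<^bsub>A\<^esub> a \<otimes>\<^bsub>A\<^esub> \<rho> x b"
  by (simp add: \<rho>_mult A.m_comm[of b "\<rho> x a"] A.a_comm)

lemma \<rho>_one [simp]: "x \<in> carrier G \<Longrightarrow> \<rho> x \<one>\<^bsub>A\<^esub> = \<zero>\<^bsub>A\<^esub>"
  using \<rho>_mult[of x "\<one>\<^bsub>A\<^esub>" "\<one>\<^bsub>A\<^esub>"] \<rho>_closed[of x "\<one>\<^bsub>A\<^esub>"] by (simp add: A.add.r_cancel_one)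

lemma \<rho>_scalar: "x \<in> carrier G \<Longrightarrow> k \<in> carrier K \<Longrightarrow> \<rho> x (k \<odot>\<^bsub>A\<^esub> \<one>\<^bsub>A\<^esub>) = \<zero>\<^bsub>A\<^esub>"
  using \<rho>_derivation[of x] by (simp add: derivations_def)

text \<open>\<open>ad x\<close> and \<open>contraction a\<close> are the brackets \<open>[x, \<cdot>]\<close> and \<open>[a, \<cdot>]\<close>.\<close>

definition ad :: "'g \<Rightarrow> ('g list \<Rightarrow> 'a) set \<Rightarrow> ('g list \<Rightarrow> 'a) set" where
  "ad x = (SOME \<delta>. graded_derivation 0 \<delta> \<and> (\<forall>a\<in>carrier A. \<delta> (cst a) = cst (\<rho> x a)) \<and>
    (\<forall>y\<in>carrier G. \<delta> (gen y) = gen (br x y)))"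

definition contraction :: "'a \<Rightarrow> ('g list \<Rightarrow> 'a) set \<Rightarrow> ('g list \<Rightarrow> 'a) set" where
  "contraction a = (SOME \<delta>. graded_derivation (-1) \<delta> \<and> (\<forall>b\<in>carrier A. \<delta> (cst b) = \<zero>\<^bsub>E\<^esub>) \<and>
    (\<forall>y\<in>carrier G. \<delta> (gen y) = \<ominus>\<^bsub>E\<^esub> cst (\<rho> y a)))"

text \<open>This is the Lie derivative along x. The product rules asked of its values are the
  derivation property of \<open>\<rho> x\<close> on A and the axiom \<open>leibniz\<close> on
  G.\<close>

lemma ad:
  assumes "x \<in> carrier G"
  shows ad_gder: "graded_derivation 0 (ad x)"
    and ad_cst: "a \<in> carrier A \<Longrightarrow> ad x (cst a) = cst (\<rho> x a)"
    and ad_gen: "y \<in> carrier G \<Longrightarrow> ad x (gen y) = gen (br x y)"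
proof -
  interpret derivation_data A G 0 "\<lambda>a. cst (\<rho> x a)" "\<lambda>y. gen (br x y)"
    by unfold_locales
      (use assms in \<open>simp_all add: \<rho>_add \<rho>_mult' cst_add cst_mult gen_add gen_smult br_add_right
        leibniz E.a_comm\<close>)
  note * = someI_ex[OF derivation_exists, folded ad_def]
  show "graded_derivation 0 (ad x)" "a \<in> carrier A \<Longrightarrow> ad x (cst a) = cst (\<rho> x a)"
    "y \<in> carrier G \<Longrightarrow> ad x (gen y) = gen (br x y)"
    using * by blast+
qed

text \<open>Up to sign this is the interior product with the form that sends y to
  \<open>\<rho> y a\<close>. The form is A-linear by \<open>anchor_smult\<close>, which is
  compatible with the value zero on constants.\<close>

lemma contraction:
  assumes "a \<in> carrier A"
  shows contraction_gder: "graded_derivation (-1) (contraction a)"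
    and contraction_cst: "b \<in> carrier A \<Longrightarrow> contraction a (cst b) = \<zero>\<^bsub>E\<^esub>"
    and contraction_gen: "y \<in> carrier G \<Longrightarrow> contraction a (gen y) = \<ominus>\<^bsub>E\<^esub> cst (\<rho> y a)"
proof -
  interpret derivation_data A G "-1" "\<lambda>b. \<zero>\<^bsub>E\<^esub>" "\<lambda>y. \<ominus>\<^bsub>E\<^esub> cst (\<rho> y a)"
  proof unfold_locales
    fix x assume "x \<in> carrier G"
    then show "\<ominus>\<^bsub>E\<^esub> cst (\<rho> x a) \<in> \<Lambda> (1 + - 1)"
      using assms by simp
  next
    fix x y assume "x \<in> carrier G" "y \<in> carrier G"
    then show "\<ominus>\<^bsub>E\<^esub> cst (\<rho> (x \<oplus>\<^bsub>G\<^esub> y) a) = \<ominus>\<^bsub>E\<^esub> cst (\<rho> x a) \<oplus>\<^bsub>E\<^esub> \<ominus>\<^bsub>E\<^esub> cst (\<rho> y a)"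
      using assms by (simp add: anchor_add cst_add E.minus_add)
  next
    fix b x assume "b \<in> carrier A" "x \<in> carrier G"
    then show "\<ominus>\<^bsub>E\<^esub> cst (\<rho> (b \<odot>\<^bsub>G\<^esub> x) a) = \<zero>\<^bsub>E\<^esub> \<otimes>\<^bsub>E\<^esub> gen x \<oplus>\<^bsub>E\<^esub> cst b \<otimes>\<^bsub>E\<^esub> (\<ominus>\<^bsub>E\<^esub> cst (\<rho> x a))"
      using assms by (simp add: anchor_smult cst_mult E.r_minus)
  qed simp_all
  note * = someI_ex[OF derivation_exists, folded contraction_def]
  show "graded_derivation (-1) (contraction a)" "b \<in> carrier A \<Longrightarrow> contraction a (cst b) = \<zero>\<^bsub>E\<^esub>"
    "y \<in> carrier G \<Longrightarrow> contraction a (gen y) = \<ominus>\<^bsub>E\<^esub> cst (\<rho> y a)"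
    using * by blast+
qed

lemma ad_closed [simp]: "x \<in> carrier G \<Longrightarrow> P \<in> carrier E \<Longrightarrow> ad x P \<in> carrier E"
  using ad_gder graded_derivation_closed by blast

lemma contraction_closed [simp]: "a \<in> carrier A \<Longrightarrow> P \<in> carrier E \<Longrightarrow> contraction a P \<in> carrier E"
  using contraction_gder graded_derivation_closed by blast

lemma ad_\<Lambda>: "x \<in> carrier G \<Longrightarrow> P \<in> \<Lambda> p \<Longrightarrow> ad x P \<in> \<Lambda> p"
  using graded_derivation_\<Lambda>[OF ad_gder] by fastforce

lemma contraction_\<Lambda>: "a \<in> carrier A \<Longrightarrow> P \<in> \<Lambda> p \<Longrightarrow> contraction a P \<in> \<Lambda> (p - 1)"
  using graded_derivation_\<Lambda>[OF contraction_gder] by fastforce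

lemma ad_add:
  assumes "x \<in> carrier G" "y \<in> carrier G" "P \<in> carrier E"
  shows "ad (x \<oplus>\<^bsub>G\<^esub> y) P = ad x P \<oplus>\<^bsub>E\<^esub> ad y P"
  by (rule graded_derivation_unique[where d = 0 and P = P and \<epsilon> = "\<lambda>P. ad x P \<oplus>\<^bsub>E\<^esub> ad y P"])
    (use assms in \<open>simp_all add: ad_gder graded_derivation_plus ad_cst ad_gen anchor_add cst_add br_add_left gen_add\<close>)

lemma contraction_add:
  assumes "a \<in> carrier A" "b \<in> carrier A" "P \<in> carrier E"
  shows "contraction (a \<oplus>\<^bsub>A\<^esub> b) P = contraction a P \<oplus>\<^bsub>E\<^esub> contraction b P"
  by (rule graded_derivation_unique[where d = "-1" and P = P and \<epsilon> = "\<lambda>P. contraction a P \<oplus>\<^bsub>E\<^esub> contraction b P"])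
    (use assms in \<open>simp_all add: contraction_gder graded_derivation_plus contraction_cst contraction_gen \<rho>_add cst_add E.minus_add\<close>)

text \<open>Read as a function of the subscript a, this is the product rule that the values of
  \<open>[P, \<cdot>]\<close> on constants must satisfy. On a generator y it reduces to the
  derivation property of \<open>\<rho> y\<close>.\<close>

lemma contraction_mult:
  assumes "a \<in> carrier A" "b \<in> carrier A" "P \<in> carrier E"
  shows "contraction (a \<otimes>\<^bsub>A\<^esub> b) P = cst b \<otimes>\<^bsub>E\<^esub> contraction a P \<oplus>\<^bsub>E\<^esub> cst a \<otimes>\<^bsub>E\<^esub> contraction b P"
proof (rule graded_derivation_unique[where d = "-1" and P = P])
  show "graded_derivation (-1) (\<lambda>P. cst b \<otimes>\<^bsub>E\<^esub> contraction a P \<oplus>\<^bsub>E\<^esub> cst a \<otimes>\<^bsub>E\<^esub> contraction b P)"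
    using assms graded_derivation_times[OF \<Lambda>_cst contraction_gder] by (intro graded_derivation_plus) auto
qed (use assms in \<open>simp_all add: contraction_gder contraction_cst contraction_gen \<rho>_mult' cst_add cst_mult
      E.minus_add E.r_minus\<close>)

lemma br_smult_left:
  assumes "a \<in> carrier A" "x \<in> carrier G" "y \<in> carrier G"
  shows "br (a \<odot>\<^bsub>G\<^esub> x) y = a \<odot>\<^bsub>G\<^esub> br x y \<oplus>\<^bsub>G\<^esub> (\<ominus>\<^bsub>A\<^esub> \<rho> y a) \<odot>\<^bsub>G\<^esub> x"
proof -
  have "br (a \<odot>\<^bsub>G\<^esub> x) y = \<ominus>\<^bsub>G\<^esub> (a \<odot>\<^bsub>G\<^esub> br y x \<oplus>\<^bsub>G\<^esub> \<rho> y a \<odot>\<^bsub>G\<^esub> x)"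
    using assms br_anticommute[of "a \<odot>\<^bsub>G\<^esub> x" y] leibniz by simp
  also have "\<dots> = a \<odot>\<^bsub>G\<^esub> (\<ominus>\<^bsub>G\<^esub> br y x) \<oplus>\<^bsub>G\<^esub> (\<ominus>\<^bsub>A\<^esub> \<rho> y a) \<odot>\<^bsub>G\<^esub> x"
    using assms by (simp add: G.M.minus_add G.smult_r_minus G.smult_l_minus)
  also have "\<ominus>\<^bsub>G\<^esub> br y x = br x y"
    using assms br_anticommute[of x y] by simp
  finally show ?thesis .
qed

text \<open>The values of \<open>[P, \<cdot>]\<close> on G are given through \<open>ad\<close>, so
  its failure to be A-linear in x has to be known. On generators the correction term comes from
  \<open>br_smult_left\<close>, where a derivative of a appears because the multiple stands in the
  first argument.\<close>

lemma ad_smult: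
  assumes "a \<in> carrier A" "x \<in> carrier G" "P \<in> carrier E"
  shows "ad (a \<odot>\<^bsub>G\<^esub> x) P = cst a \<otimes>\<^bsub>E\<^esub> ad x P \<oplus>\<^bsub>E\<^esub> gen x \<otimes>\<^bsub>E\<^esub> contraction a P"
proof (rule graded_derivation_unique[where d = 0 and P = P])
  show "graded_derivation 0 (\<lambda>P. cst a \<otimes>\<^bsub>E\<^esub> ad x P \<oplus>\<^bsub>E\<^esub> gen x \<otimes>\<^bsub>E\<^esub> contraction a P)"
    using assms graded_derivation_times[OF \<Lambda>_cst ad_gder, of a x] graded_derivation_times[OF \<Lambda>_gen contraction_gder, of x a]
    by (intro graded_derivation_plus) auto
next
  fix y assume y: "y \<in> carrier G"
  show "ad (a \<odot>\<^bsub>G\<^esub> x) (gen y) = cst a \<otimes>\<^bsub>E\<^esub> ad x (gen y) \<oplus>\<^bsub>E\<^esub> gen x \<otimes>\<^bsub>E\<^esub> contraction a (gen y)"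
    using assms y
    by (simp add: ad_gen contraction_gen br_smult_left gen_add gen_smult cst_minus E.l_minus E.r_minus
        cst_central[of _ "gen x"])
qed (use assms in \<open>simp_all add: ad_gder ad_cst contraction_cst anchor_smult cst_mult\<close>)

text \<open>The values of \<open>[P, \<cdot>]\<close> on generators are dictated by graded antisymmetry.\<close>

definition homogeneous_bracket :: "int \<Rightarrow> ('g list \<Rightarrow> 'a) set \<Rightarrow> ('g list \<Rightarrow> 'a) set \<Rightarrow> ('g list \<Rightarrow> 'a) set" where
  "homogeneous_bracket p P = (SOME \<delta>. graded_derivation (p - 1) \<delta> \<and> (\<forall>a\<in>carrier A. \<delta> (cst a) = sg p (contraction a P)) \<and>
    (\<forall>x\<in>carrier G. \<delta> (gen x) = \<ominus>\<^bsub>E\<^esub> ad x P))"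

lemma homogeneous_bracket:
  assumes "P \<in> \<Lambda> p"
  shows homogeneous_bracket_gder: "graded_derivation (p - 1) (homogeneous_bracket p P)"
    and homogeneous_bracket_cst: "a \<in> carrier A \<Longrightarrow> homogeneous_bracket p P (cst a) = sg p (contraction a P)"
    and homogeneous_bracket_gen: "x \<in> carrier G \<Longrightarrow> homogeneous_bracket p P (gen x) = \<ominus>\<^bsub>E\<^esub> ad x P"
proof -
  have [simp]: "P \<in> carrier E" using assms \<Lambda>_closed by blast
  interpret derivation_data A G "p - 1" "\<lambda>a. sg p (contraction a P)" "\<lambda>x. \<ominus>\<^bsub>E\<^esub> ad x P"
  proof unfold_locales
    fix a x assume *: "a \<in> carrier A" "x \<in> carrier G"
    \<comment> \<open>The contraction has degree p - 1. Exchanging it with x and adding the minus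
      sign of \<open>[P, x]\<close> gives the exponent p, the very sign prescribed on
      constants.\<close>
    have "gen x \<otimes>\<^bsub>E\<^esub> contraction a P = sg (p - 1) (contraction a P \<otimes>\<^bsub>E\<^esub> gen x)"
      using * gen_commute[OF contraction_\<Lambda>] assms by simp
    then have "\<ominus>\<^bsub>E\<^esub> (gen x \<otimes>\<^bsub>E\<^esub> contraction a P) = sg p (contraction a P) \<otimes>\<^bsub>E\<^esub> gen x"
      using * by (simp add: E.minus_eq_sign_pow E.sign_pow_sign_pow E.sign_pow_mult_left)
    then show "\<ominus>\<^bsub>E\<^esub> ad (a \<odot>\<^bsub>G\<^esub> x) P = sg p (contraction a P) \<otimes>\<^bsub>E\<^esub> gen x \<oplus>\<^bsub>E\<^esub> cst a \<otimes>\<^bsub>E\<^esub> (\<ominus>\<^bsub>E\<^esub> ad x P)"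
      using * by (simp add: ad_smult E.minus_add E.r_minus E.a_comm)
  qed (use assms in \<open>simp_all add: contraction_\<Lambda> ad_\<Lambda> contraction_add contraction_mult E.sign_pow_add
      E.sign_pow_mult_right ad_add E.minus_add\<close>)
  note * = someI_ex[OF derivation_exists, folded homogeneous_bracket_def]
  show "graded_derivation (p - 1) (homogeneous_bracket p P)" "a \<in> carrier A \<Longrightarrow> homogeneous_bracket p P (cst a) = sg p (contraction a P)"
    "x \<in> carrier G \<Longrightarrow> homogeneous_bracket p P (gen x) = \<ominus>\<^bsub>E\<^esub> ad x P"
    using * by blast+
qed

section \<open>Extension to inhomogeneous first arguments\<close>

lemma graded_derivation_const_zero: "graded_derivation d (\<lambda>P. \<zero>\<^bsub>E\<^esub>)"
  by (rule gderI) simp_all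

lemma homogeneous_bracket_zero: "Q \<in> carrier E \<Longrightarrow> homogeneous_bracket p \<zero>\<^bsub>E\<^esub> Q = \<zero>\<^bsub>E\<^esub>"
  by (rule graded_derivation_unique[where d = "p - 1" and P = Q and \<epsilon> = "\<lambda>_. \<zero>\<^bsub>E\<^esub>"])
    (simp_all add: homogeneous_bracket_gder homogeneous_bracket_cst homogeneous_bracket_gen graded_derivation_const_zero graded_derivation_zero[OF ad_gder]
      graded_derivation_zero[OF contraction_gder])

lemma homogeneous_bracket_add:
  assumes "P \<in> \<Lambda> p" "P' \<in> \<Lambda> p" "Q \<in> carrier E"
  shows "homogeneous_bracket p (P \<oplus>\<^bsub>E\<^esub> P') Q = homogeneous_bracket p P Q \<oplus>\<^bsub>E\<^esub> homogeneous_bracket p P' Q"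
  by (rule graded_derivation_unique[where d = "p - 1" and P = Q and \<epsilon> = "\<lambda>Q. homogeneous_bracket p P Q \<oplus>\<^bsub>E\<^esub> homogeneous_bracket p P' Q"])
    (use assms in \<open>simp_all add: homogeneous_bracket_gder homogeneous_bracket_cst homogeneous_bracket_gen graded_derivation_plus graded_derivation_add[OF ad_gder] graded_derivation_add[OF contraction_gder]
      \<Lambda>_closed E.sign_pow_add E.minus_add\<close>)

lemma homogeneous_bracket_closed [simp]: "P \<in> \<Lambda> p \<Longrightarrow> Q \<in> carrier E \<Longrightarrow> homogeneous_bracket p P Q \<in> carrier E"
  using homogeneous_bracket_gder graded_derivation_closed by blast

text \<open>Both the degree of \<open>[P, \<cdot>]\<close> and its sign on constants depend on the
  degree of P, hence the sum over components. By \<open>homogeneous_bracket_zero\<close> the sum may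
  run over any larger finite set, which gives additivity in P.\<close>

definition bracket :: "('g list \<Rightarrow> 'a) set \<Rightarrow> ('g list \<Rightarrow> 'a) set \<Rightarrow> ('g list \<Rightarrow> 'a) set" where
  "bracket P Q = (\<Oplus>\<^bsub>E\<^esub> p\<in>{p. component p P \<noteq> \<zero>\<^bsub>E\<^esub>}. homogeneous_bracket p (component p P) Q)"

lemma bracket_eq:
  assumes "P \<in> carrier E" "Q \<in> carrier E" "finite T" "{p. component p P \<noteq> \<zero>\<^bsub>E\<^esub>} \<subseteq> T"
  shows "bracket P Q = (\<Oplus>\<^bsub>E\<^esub> p\<in>T. homogeneous_bracket p (component p P) Q)"
  unfolding bracket_def using assms
  by (intro E.add.finprod_mono_neutral_cong_left) (auto simp: homogeneous_bracket_zero)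

lemma bracket_homogeneous:
  assumes "P \<in> \<Lambda> p" "Q \<in> carrier E" shows "bracket P Q = homogeneous_bracket p P Q"
proof -
  have "bracket P Q = (\<Oplus>\<^bsub>E\<^esub> q\<in>{p}. homogeneous_bracket q (component q P) Q)"
    using assms by (intro bracket_eq) (auto simp: component_homogeneous \<Lambda>_closed split: if_splits)
  then show ?thesis
    using assms by (simp add: component_homogeneous)
qed

lemma bracket_closed [simp]: "P \<in> carrier E \<Longrightarrow> Q \<in> carrier E \<Longrightarrow> bracket P Q \<in> carrier E"
  unfolding bracket_def by (rule E.finsum_closed) simp

lemma bracket_add_right:
  assumes "P \<in> carrier E" "Q \<in> carrier E" "Q' \<in> carrier E"
  shows "bracket P (Q \<oplus>\<^bsub>E\<^esub> Q') = bracket P Q \<oplus>\<^bsub>E\<^esub> bracket P Q'"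
proof -
  have "homogeneous_bracket p (component p P) (Q \<oplus>\<^bsub>E\<^esub> Q') = homogeneous_bracket p (component p P) Q \<oplus>\<^bsub>E\<^esub> homogeneous_bracket p (component p P) Q'" for p
    using assms by (intro graded_derivation_add[OF homogeneous_bracket_gder]) auto
  then show ?thesis
    using assms by (simp add: bracket_def E.finsum_addf Pi_def)
qed

lemma bracket_add_left:
  assumes "P \<in> carrier E" "P' \<in> carrier E" "Q \<in> carrier E"
  shows "bracket (P \<oplus>\<^bsub>E\<^esub> P') Q = bracket P Q \<oplus>\<^bsub>E\<^esub> bracket P' Q"
proof -
  let ?T = "{p. component p P \<noteq> \<zero>\<^bsub>E\<^esub>} \<union> {p. component p P' \<noteq> \<zero>\<^bsub>E\<^esub>}"
  have T: "finite ?T" "{p. component p (P \<oplus>\<^bsub>E\<^esub> P') \<noteq> \<zero>\<^bsub>E\<^esub>} \<subseteq> ?T"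
    using assms by (auto simp: component_finite component_add)
  have "bracket (P \<oplus>\<^bsub>E\<^esub> P') Q = (\<Oplus>\<^bsub>E\<^esub> p\<in>?T. homogeneous_bracket p (component p P) Q \<oplus>\<^bsub>E\<^esub> homogeneous_bracket p (component p P') Q)"
    using assms T by (subst bracket_eq[OF _ _ T]) (simp_all add: component_add homogeneous_bracket_add)
  also have "\<dots> = (\<Oplus>\<^bsub>E\<^esub> p\<in>?T. homogeneous_bracket p (component p P) Q) \<oplus>\<^bsub>E\<^esub> (\<Oplus>\<^bsub>E\<^esub> p\<in>?T. homogeneous_bracket p (component p P') Q)"
    using assms by (intro E.finsum_addf) auto
  also have "(\<Oplus>\<^bsub>E\<^esub> p\<in>?T. homogeneous_bracket p (component p P) Q) = bracket P Q"
    using assms T(1) by (intro bracket_eq[symmetric]) auto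
  also have "(\<Oplus>\<^bsub>E\<^esub> p\<in>?T. homogeneous_bracket p (component p P') Q) = bracket P' Q"
    using assms T(1) by (intro bracket_eq[symmetric]) auto
  finally show ?thesis .
qed

lemma graded_derivation_cong:
  assumes "\<And>P. P \<in> carrier E \<Longrightarrow> \<delta> P = \<epsilon> P" shows "graded_derivation d \<delta> \<longleftrightarrow> graded_derivation d \<epsilon>"
  using assms by (auto simp: graded_derivation_def \<Lambda>_closed)

lemma bracket_gder: "P \<in> \<Lambda> p \<Longrightarrow> graded_derivation (p - 1) (bracket P)"
  using homogeneous_bracket_gder[of P p] graded_derivation_cong[of "bracket P" "homogeneous_bracket p P"] bracket_homogeneous by blast

lemma bracket_cst: "P \<in> \<Lambda> p \<Longrightarrow> a \<in> carrier A \<Longrightarrow> bracket P (cst a) = sg p (contraction a P)"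
  by (simp add: bracket_homogeneous homogeneous_bracket_cst)

lemma bracket_gen: "P \<in> \<Lambda> p \<Longrightarrow> x \<in> carrier G \<Longrightarrow> bracket P (gen x) = \<ominus>\<^bsub>E\<^esub> ad x P"
  by (simp add: bracket_homogeneous homogeneous_bracket_gen)

text \<open>For P a constant, \<open>[P, \<cdot>]\<close> has now been constructed a second time, by
  the general prescription. It agrees with the earlier derivation because the values of
  \<open>ad\<close> and \<open>contraction\<close> on generators are antisymmetric already. The same
  has to be checked for P in G.\<close>

lemma bracket_cst_left:
  assumes "a \<in> carrier A" "P \<in> carrier E" shows "bracket (cst a) P = contraction a P"
  by (rule graded_derivation_unique[where d = "-1" and P = P])
    (use assms bracket_gder[OF \<Lambda>_cst, of a] in
      \<open>simp_all add: contraction_gder bracket_cst[OF \<Lambda>_cst] bracket_gen[OF \<Lambda>_cst] contraction_cst contraction_gen ad_cst\<close>)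

lemma bracket_gen_left:
  assumes "x \<in> carrier G" "P \<in> carrier E" shows "bracket (gen x) P = ad x P"
proof (rule graded_derivation_unique[where d = 0 and P = P])
  show "graded_derivation 0 (bracket (gen x))"
    using bracket_gder[OF \<Lambda>_gen] assms by fastforce
  fix a assume "a \<in> carrier A"
  then show "bracket (gen x) (cst a) = ad x (cst a)"
    using assms by (simp add: bracket_cst[OF \<Lambda>_gen] contraction_gen ad_cst) (simp add: sign_pow_def)
next
  fix y assume "y \<in> carrier G"
  then show "bracket (gen x) (gen y) = ad x (gen y)"
    using assms by (simp add: bracket_gen[OF \<Lambda>_gen] ad_gen br_anticommute[of x y] gen_minus)
qed (use assms ad_gder in auto)

text \<open>The last term has P' in front, in place of the customary \<open>[P, Q]\<close> followed
  by P'. Both terms are then left multiples of derivations in Q, and the sign does not involve the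
  degree of Q, so \<open>graded_derivation_unique\<close> applies.\<close>

lemma bracket_mult_left:
  assumes "P \<in> \<Lambda> p" "P' \<in> \<Lambda> p'" "Q \<in> carrier E"
  shows "bracket (P \<otimes>\<^bsub>E\<^esub> P') Q = P \<otimes>\<^bsub>E\<^esub> bracket P' Q \<oplus>\<^bsub>E\<^esub> sg (p * p') (P' \<otimes>\<^bsub>E\<^esub> bracket P Q)"
proof (rule graded_derivation_unique[where d = "p + p' - 1" and P = Q])
  have [simp]: "P \<in> carrier E" "P' \<in> carrier E" using assms \<Lambda>_closed by auto
  show "graded_derivation (p + p' - 1) (bracket (P \<otimes>\<^bsub>E\<^esub> P'))"
    using assms by (intro bracket_gder \<Lambda>_mult)
  have "graded_derivation (p + p' - 1) (\<lambda>Q. P \<otimes>\<^bsub>E\<^esub> bracket P' Q)" "graded_derivation (p + p' - 1) (\<lambda>Q. P' \<otimes>\<^bsub>E\<^esub> bracket P Q)"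
    using graded_derivation_times[OF assms(1) bracket_gder[OF assms(2)]] graded_derivation_times[OF assms(2) bracket_gder[OF assms(1)]]
    by (simp_all add: algebra_simps)
  then show "graded_derivation (p + p' - 1) (\<lambda>Q. P \<otimes>\<^bsub>E\<^esub> bracket P' Q \<oplus>\<^bsub>E\<^esub> sg (p * p') (P' \<otimes>\<^bsub>E\<^esub> bracket P Q))"
    by (intro graded_derivation_plus graded_derivation_sign)
  {
    fix a assume a: "a \<in> carrier A"
    have "contraction a (P \<otimes>\<^bsub>E\<^esub> P') = contraction a P \<otimes>\<^bsub>E\<^esub> P' \<oplus>\<^bsub>E\<^esub> sg p (P \<otimes>\<^bsub>E\<^esub> contraction a P')"
      using a assms by (simp add: graded_derivation_mult[OF contraction_gder]) (simp add: sign_pow_def)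
    moreover have "contraction a P \<otimes>\<^bsub>E\<^esub> P' = sg ((p - 1) * p') (P' \<otimes>\<^bsub>E\<^esub> contraction a P)"
      using a assms by (intro graded_commute contraction_\<Lambda>)
    ultimately show "bracket (P \<otimes>\<^bsub>E\<^esub> P') (cst a) =
        P \<otimes>\<^bsub>E\<^esub> bracket P' (cst a) \<oplus>\<^bsub>E\<^esub> sg (p * p') (P' \<otimes>\<^bsub>E\<^esub> bracket P (cst a))"
      using a assms
      by (cases "even p"; cases "even p'")
        (simp_all add: bracket_cst[OF \<Lambda>_mult] bracket_cst E.r_minus E.minus_add E.a_comm sign_pow_def)
  }
  fix x assume x: "x \<in> carrier G"
  have "ad x P \<otimes>\<^bsub>E\<^esub> P' = sg (p * p') (P' \<otimes>\<^bsub>E\<^esub> ad x P)"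
    using x assms by (intro graded_commute ad_\<Lambda>)
  then show "bracket (P \<otimes>\<^bsub>E\<^esub> P') (gen x) =
      P \<otimes>\<^bsub>E\<^esub> bracket P' (gen x) \<oplus>\<^bsub>E\<^esub> sg (p * p') (P' \<otimes>\<^bsub>E\<^esub> bracket P (gen x))"
    using x assms
    by (cases "even (p * p')")
      (simp_all add: bracket_gen[OF \<Lambda>_mult] bracket_gen graded_derivation_mult[OF ad_gder] E.r_minus E.a_comm
        E.minus_add sign_pow_def)
qed (use assms in simp)

text \<open>On generators Q this is how \<open>[P, \<cdot>]\<close> was prescribed. For products the
  Leibniz rule in the second argument is matched with \<open>bracket_mult_left\<close>, and graded
  commutativity restores the order of the factors.\<close>

lemma bracket_antisym:
  assumes "P \<in> \<Lambda> p" "Q \<in> \<Lambda> q"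
  shows "bracket P Q = \<ominus>\<^bsub>E\<^esub> sg ((p - 1) * (q - 1)) (bracket Q P)"
proof -
  have [simp]: "P \<in> carrier E" using assms \<Lambda>_closed by blast
  from assms(2) show ?thesis
  proof (induction rule: homogeneous_induct)
    case (zero q)
    then show ?case using graded_derivation_zero[OF bracket_gder] assms(1) bracket_homogeneous[OF \<Lambda>_zero] homogeneous_bracket_zero by simp
  next
    case (add q Q R)
    then show ?case
      by (simp add: bracket_add_left bracket_add_right \<Lambda>_closed E.sign_pow_add E.minus_add)
  next
    case (cst a)
    then show ?case
      using assms(1) by (simp add: bracket_cst bracket_cst_left) (simp add: sign_pow_def)
  next
    case (gen x)
    then show ?case
      using assms(1) by (simp add: bracket_gen bracket_gen_left) (simp add: sign_pow_def)
  next
    case (mult q r Q R)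
    then have [simp]: "Q \<in> carrier E" "R \<in> carrier E" by (simp_all add: \<Lambda>_closed)
    have QP: "bracket Q P \<in> \<Lambda> (p + (q - 1))"
      using graded_derivation_\<Lambda>[OF bracket_gder] mult assms by blast
    have "bracket P (Q \<otimes>\<^bsub>E\<^esub> R) = bracket P Q \<otimes>\<^bsub>E\<^esub> R \<oplus>\<^bsub>E\<^esub> sg ((p - 1) * q) (Q \<otimes>\<^bsub>E\<^esub> bracket P R)"
      using assms mult by (intro graded_derivation_mult[OF bracket_gder]) auto
    moreover have "R \<otimes>\<^bsub>E\<^esub> bracket Q P = sg (r * (p + (q - 1))) (bracket Q P \<otimes>\<^bsub>E\<^esub> R)"
      using mult QP by (intro graded_commute) auto
    ultimately show ?case
      using mult
      by (cases "even p"; cases "even q"; cases "even r")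
        (simp_all add: bracket_mult_left E.l_minus E.r_minus E.minus_add E.a_comm sign_pow_def)
  qed
qed

section \<open>The graded Jacobi identity\<close>

lemma bracket_\<Lambda>: "P \<in> \<Lambda> p \<Longrightarrow> Q \<in> \<Lambda> q \<Longrightarrow> bracket P Q \<in> \<Lambda> (p + q - 1)"
  using graded_derivation_\<Lambda>[OF bracket_gder, of P p Q q] by (simp add: algebra_simps)

definition cyclic_jacobi where
  "cyclic_jacobi p P q Q r R \<longleftrightarrow>
    sg ((p - 1) * (r - 1)) (bracket P (bracket Q R)) \<oplus>\<^bsub>E\<^esub>
    sg ((q - 1) * (p - 1)) (bracket Q (bracket R P)) \<oplus>\<^bsub>E\<^esub>
    sg ((r - 1) * (q - 1)) (bracket R (bracket P Q)) = \<zero>\<^bsub>E\<^esub>"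

lemma cyclic_jacobi_rotate:
  "P \<in> carrier E \<Longrightarrow> Q \<in> carrier E \<Longrightarrow> R \<in> carrier E \<Longrightarrow> cyclic_jacobi p P q Q r R \<Longrightarrow> cyclic_jacobi q Q r R p P"
  by (simp add: cyclic_jacobi_def E.a_ac mult.commute)

text \<open>Antisymmetry moves R to the last place in every term. Up to the global sign
  \<open>(-1)^((p - 1) * (r - 1))\<close> there remains the graded commutator of
  \<open>[P, \<cdot>]\<close> and \<open>[Q, \<cdot>]\<close> minus
  \<open>[[P, Q], \<cdot>]\<close>, evaluated at R: an expression that is a derivation in R.\<close>

lemma cyclic_jacobi_iff:
  assumes P: "P \<in> \<Lambda> p" and Q: "Q \<in> \<Lambda> q" and R: "R \<in> \<Lambda> r"
  shows "cyclic_jacobi p P q Q r R \<longleftrightarrow>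
    (bracket P (bracket Q R) \<oplus>\<^bsub>E\<^esub> sg ((p - 1) * (q - 1) + 1) (bracket Q (bracket P R))) \<oplus>\<^bsub>E\<^esub>
      sg 1 (bracket (bracket P Q) R) = \<zero>\<^bsub>E\<^esub>"
    (is "_ \<longleftrightarrow> ?S = \<zero>\<^bsub>E\<^esub>")
proof -
  have [simp]: "P \<in> carrier E" "Q \<in> carrier E" "R \<in> carrier E" using assms \<Lambda>_closed by auto
  have *: "bracket R P = sg ((r - 1) * (p - 1) + 1) (bracket P R)"
    using bracket_antisym[OF R P] by (simp add: E.minus_eq_sign_pow E.sign_pow_sign_pow add.commute)
  have 1: "bracket Q (bracket R P) = sg ((r - 1) * (p - 1) + 1) (bracket Q (bracket P R))"
    unfolding * by (rule graded_derivation_sg[OF bracket_gder[OF Q]]) simp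
  have 2: "bracket R (bracket P Q) = sg ((r - 1) * (p + q - 1 - 1) + 1) (bracket (bracket P Q) R)"
    using bracket_antisym[OF R bracket_\<Lambda>[OF P Q]]
    by (simp add: E.minus_eq_sign_pow E.sign_pow_sign_pow add.commute)
  have "sg ((p - 1) * (r - 1)) (bracket P (bracket Q R)) \<oplus>\<^bsub>E\<^esub> sg ((q - 1) * (p - 1)) (bracket Q (bracket R P)) \<oplus>\<^bsub>E\<^esub>
      sg ((r - 1) * (q - 1)) (bracket R (bracket P Q)) = sg ((p - 1) * (r - 1)) ?S"
    unfolding 1 2
    by (cases "even p"; cases "even q"; cases "even r")
      (simp_all add: sign_pow_def E.minus_add)
  moreover have "sg n X = \<zero>\<^bsub>E\<^esub> \<longleftrightarrow> X = \<zero>\<^bsub>E\<^esub>" if "X \<in> carrier E" for n X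
    using that E.minus_minus[of X] E.minus_zero unfolding sign_pow_def by metis
  ultimately show ?thesis
    by (simp add: cyclic_jacobi_def)
qed

definition generators :: "(int \<times> ('g list \<Rightarrow> 'a) set) set" where
  "generators = (\<lambda>a. (0, cst a)) ` carrier A \<union> (\<lambda>x. (1, gen x)) ` carrier G"

lemma generators_cst: "a \<in> carrier A \<Longrightarrow> (0, cst a) \<in> generators"
  and generators_gen: "x \<in> carrier G \<Longrightarrow> (1, gen x) \<in> generators"
  by (simp_all add: generators_def)

lemma generators_\<Lambda>: "(e, g) \<in> generators \<Longrightarrow> g \<in> \<Lambda> e"
  by (auto simp: generators_def simp del: One_nat_def)

lemma cyclic_jacobi_extend:
  assumes P: "P \<in> \<Lambda> p" and Q: "Q \<in> \<Lambda> q" and R: "R \<in> \<Lambda> r"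
    and gens: "\<And>e g. (e, g) \<in> generators \<Longrightarrow> cyclic_jacobi p P q Q e g"
  shows "cyclic_jacobi p P q Q r R"
proof -
  let ?S = "\<lambda>R. (bracket P (bracket Q R) \<oplus>\<^bsub>E\<^esub> sg ((p - 1) * (q - 1) + 1) (bracket Q (bracket P R))) \<oplus>\<^bsub>E\<^esub>
      sg 1 (bracket (bracket P Q) R)"
  have S: "?S g = \<zero>\<^bsub>E\<^esub>" if "(e, g) \<in> generators" for e g
    using gens[OF that] cyclic_jacobi_iff[OF P Q generators_\<Lambda>[OF that]] by simp
  \<comment> \<open>The degree of \<open>[[P, Q], \<cdot>]\<close> is (p + q - 1) - 1, that of the
    commutator, so the whole expression is a single graded derivation.\<close>
  have "graded_derivation ((p - 1) + (q - 1)) (bracket (bracket P Q))"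
    using bracket_gder[OF bracket_\<Lambda>[OF P Q]] by (simp add: algebra_simps)
  then have "graded_derivation ((p - 1) + (q - 1)) ?S"
    by (intro graded_derivation_plus graded_derivation_commutator graded_derivation_sign bracket_gder P Q)
  then have "?S R = \<zero>\<^bsub>E\<^esub>"
    by (rule graded_derivation_unique[where \<epsilon> = "\<lambda>_. \<zero>\<^bsub>E\<^esub>", OF _ graded_derivation_const_zero])
      (use S[OF generators_cst] S[OF generators_gen] \<Lambda>_closed[OF R] in simp_all)
  then show ?thesis
    using cyclic_jacobi_iff[OF P Q R] by simp
qed

text \<open>Up to rotation only the number of constants matters. With two or three of them every
  term vanishes; with one the identity says that the anchor respects brackets; with none it is the
  Jacobi identity in G.\<close>

lemma cyclic_jacobi_generators:
  assumes "(d, f) \<in> generators" "(e, g) \<in> generators" "(c, h) \<in> generators"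
  shows "cyclic_jacobi d f e g c h"
proof -
  note simps = cyclic_jacobi_def bracket_cst_left bracket_gen_left contraction_cst contraction_gen ad_cst ad_gen
    graded_derivation_zero[OF ad_gder] graded_derivation_zero[OF contraction_gder] graded_derivation_minus[OF ad_gder] graded_derivation_minus[OF contraction_gder]
  have aaa: "cyclic_jacobi 0 (cst a) 0 (cst b) 0 (cst b')" if "a \<in> carrier A" "b \<in> carrier A" "b' \<in> carrier A" for a b b'
    using that by (simp add: simps)
  have aax: "cyclic_jacobi 0 (cst a) 0 (cst b) 1 (gen x)" if "a \<in> carrier A" "b \<in> carrier A" "x \<in> carrier G" for a b x
    using that by (simp add: simps)
  have axx: "cyclic_jacobi 0 (cst a) 1 (gen x) 1 (gen y)" if "a \<in> carrier A" "x \<in> carrier G" "y \<in> carrier G" for a x y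
  proof -
    \<comment> \<open>The summands are \<open>[a, [x, y]]\<close>, with the anchor of the bracket
      written out, \<open>[x, [y, a]]\<close> and \<open>[y, [a, x]]\<close>. All three signs in the
      identity are even here.\<close>
    have "\<ominus>\<^bsub>A\<^esub> (\<rho> x (\<rho> y a) \<ominus>\<^bsub>A\<^esub> \<rho> y (\<rho> x a)) \<oplus>\<^bsub>A\<^esub> \<rho> x (\<rho> y a) \<oplus>\<^bsub>A\<^esub> \<ominus>\<^bsub>A\<^esub> \<rho> y (\<rho> x a) = \<zero>\<^bsub>A\<^esub>"
      using that \<rho>_closed by algebra
    then have "cst (\<ominus>\<^bsub>A\<^esub> \<rho> (br x y) a \<oplus>\<^bsub>A\<^esub> \<rho> x (\<rho> y a) \<oplus>\<^bsub>A\<^esub> \<ominus>\<^bsub>A\<^esub> \<rho> y (\<rho> x a)) = \<zero>\<^bsub>E\<^esub>"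
      using that by (simp add: anchor_bracket)
    then show ?thesis
      using that by (simp add: simps cst_add cst_minus) (simp add: sign_pow_def)
  qed
  have xxx: "cyclic_jacobi 1 (gen x) 1 (gen y) 1 (gen z)" if "x \<in> carrier G" "y \<in> carrier G" "z \<in> carrier G" for x y z
  proof -
    have "gen (br x (br y z) \<oplus>\<^bsub>G\<^esub> br y (br z x) \<oplus>\<^bsub>G\<^esub> br z (br x y)) = \<zero>\<^bsub>E\<^esub>"
      using that by (simp add: br_jacobi gen_zero)
    then show ?thesis
      using that by (simp add: simps gen_add) (simp add: sign_pow_def)
  qed
  note rot = cyclic_jacobi_rotate[rotated 3]
  show ?thesis
    using assms unfolding generators_def
    by (elim UnE imageE; simp only: prod.inject; elim conjE; hypsubst)
      (simp_all add: aaa aax axx xxx rot[OF aax] rot[OF axx] rot[OF rot[OF aax]] rot[OF rot[OF axx]])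
qed

text \<open>\<open>cyclic_jacobi_extend\<close> frees only the last argument from being a generator.
  A rotation then brings the next generator into the last place, so three extensions and two
  rotations suffice.\<close>

lemma cyclic_jacobi:
  assumes P: "P \<in> \<Lambda> p" and Q: "Q \<in> \<Lambda> q" and R: "R \<in> \<Lambda> r"
  shows "cyclic_jacobi p P q Q r R"
proof -
  note rot = cyclic_jacobi_rotate[rotated 3]
  have 1: "cyclic_jacobi e g r R d f"
    if "(d, f) \<in> generators" "(e, g) \<in> generators" "R \<in> \<Lambda> r" for d f e g r R
    by (rule rot, rule cyclic_jacobi_extend)
      (use that generators_\<Lambda> cyclic_jacobi_generators \<Lambda>_closed in blast)+
  have 2: "cyclic_jacobi r R q Q e g"
    if "(e, g) \<in> generators" "R \<in> \<Lambda> r" "Q \<in> \<Lambda> q" for e g q Q r R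
    by (rule rot, rule cyclic_jacobi_extend)
      (use that generators_\<Lambda> 1 \<Lambda>_closed in blast)+
  show ?thesis
    by (rule cyclic_jacobi_extend) (use assms 2 in blast)+
qed

section \<open>Expansion on decomposable elements\<close>

lemma finsum_swap:
  assumes "finite S" "finite T" "\<And>i j. i \<in> S \<Longrightarrow> j \<in> T \<Longrightarrow> f i j \<in> carrier E"
  shows "(\<Oplus>\<^bsub>E\<^esub> i\<in>S. \<Oplus>\<^bsub>E\<^esub> j\<in>T. f i j) = (\<Oplus>\<^bsub>E\<^esub> j\<in>T. \<Oplus>\<^bsub>E\<^esub> i\<in>S. f i j)"
  using assms
proof (induction S rule: finite_induct)
  case (insert s S)
  then have "(\<Oplus>\<^bsub>E\<^esub> i\<in>insert s S. \<Oplus>\<^bsub>E\<^esub> j\<in>T. f i j) = (\<Oplus>\<^bsub>E\<^esub> j\<in>T. f s j) \<oplus>\<^bsub>E\<^esub> (\<Oplus>\<^bsub>E\<^esub> j\<in>T. \<Oplus>\<^bsub>E\<^esub> i\<in>S. f i j)"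
    by (subst E.finsum_insert) (auto intro!: E.finsum_closed)
  also have "\<dots> = (\<Oplus>\<^bsub>E\<^esub> j\<in>T. f s j \<oplus>\<^bsub>E\<^esub> (\<Oplus>\<^bsub>E\<^esub> i\<in>S. f i j))"
    using insert by (intro E.finsum_addf[symmetric]) (auto intro!: E.finsum_closed)
  also have "\<dots> = (\<Oplus>\<^bsub>E\<^esub> j\<in>T. \<Oplus>\<^bsub>E\<^esub> i\<in>insert s S. f i j)"
    using insert by (intro E.finsum_cong') (auto intro!: E.finsum_closed simp: E.finsum_insert)
  finally show ?case .
qed simp

lemma finsum_sg:
  assumes "finite S" "\<And>i. i \<in> S \<Longrightarrow> f i \<in> carrier E"
  shows "sg n (\<Oplus>\<^bsub>E\<^esub> i\<in>S. f i) = (\<Oplus>\<^bsub>E\<^esub> i\<in>S. sg n (f i))"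
  using assms by (induction S rule: finite_induct) (simp_all add: E.sign_pow_add Pi_def)

lemma omit_closed: "ys \<in> lists (carrier G) \<Longrightarrow> omit j ys \<in> lists (carrier G)"
  unfolding omit_def by (auto dest: in_set_takeD in_set_dropD)

lemma nth_closed: "xs \<in> lists (carrier G) \<Longrightarrow> i \<in> {1..length xs} \<Longrightarrow> xs ! (i - 1) \<in> carrier G"
  by (auto simp: subset_iff)

text \<open>Passing the derivation over the first j - 1 factors costs \<open>d * (j - 1)\<close>,
  and moving its value, of degree 1 + d, back to the front costs \<open>(1 + d) * (j - 1)\<close>.
  The total parity is j - 1, whatever d is.\<close>

lemma graded_derivation_W:
  assumes \<delta>: "graded_derivation d \<delta>" and "ys \<in> lists (carrier G)"
  shows "\<delta> (W ys) =
    (\<Oplus>\<^bsub>E\<^esub> j\<in>{1..length ys}. sg (int j - 1) (\<delta> (gen (ys ! (j - 1))) \<otimes>\<^bsub>E\<^esub> W (omit j ys)))"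
  using assms(2)
proof (induction ys rule: list.induct)
  case Nil
  then show ?case using graded_derivation_one[OF \<delta>] by simp
next
  case (Cons y ys)
  let ?t = "\<lambda>ys j. sg (int j - 1) (\<delta> (gen (ys ! (j - 1))) \<otimes>\<^bsub>E\<^esub> W (omit j ys))"
  from Cons.prems have ys [simp]: "y \<in> carrier G" "ys \<in> lists (carrier G)" by simp_all
  have [simp]: "W ys \<in> carrier E" using ys(2) by (rule W_closed)
  have t: "?t zs j \<in> carrier E" if "zs \<in> lists (carrier G)" "j \<in> {1..length zs}" for zs j
    using nth_closed[OF that] that omit_closed[of zs j] \<delta> by (simp del: in_lists_conv_set)
  have t': "?t (y # ys) (Suc j) \<in> carrier E" if "j \<in> {1..length ys}" for j
    by (rule t[OF Cons.prems]) (use that in simp)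
  have "Suc ` {1..length ys} \<subseteq> {1..length (y # ys)}"
    by auto
  then have Pi_S: "?t (y # ys) \<in> Suc ` {1..length ys} \<rightarrow> carrier E"
    by (intro Pi_I t[OF Cons.prems]) blast
  have step: "sg d (gen y \<otimes>\<^bsub>E\<^esub> ?t ys j) = ?t (y # ys) (Suc j)" if j: "j \<in> {1..length ys}" for j
  proof -
    have g: "ys ! (j - 1) \<in> carrier G" using nth_closed[OF ys(2) j] .
    have c: "gen y \<otimes>\<^bsub>E\<^esub> \<delta> (gen (ys ! (j - 1))) = sg (1 + d) (\<delta> (gen (ys ! (j - 1))) \<otimes>\<^bsub>E\<^esub> gen y)"
      using g graded_derivation_\<Lambda>[OF \<delta> \<Lambda>_gen] by (intro gen_commute) auto
    have o: "omit (Suc j) (y # ys) = y # omit j ys" and n: "(y # ys) ! (Suc j - 1) = ys ! (j - 1)"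
      using j by (cases j; simp add: omit_def)+
    have W: "W (omit j ys) \<in> carrier E" using omit_closed[of ys j] by simp
    have "sg d (gen y \<otimes>\<^bsub>E\<^esub> ?t ys j) =
        sg (d + (int j - 1)) (gen y \<otimes>\<^bsub>E\<^esub> \<delta> (gen (ys ! (j - 1))) \<otimes>\<^bsub>E\<^esub> W (omit j ys))"
      using g W \<delta> by (simp add: E.sign_pow_mult_right E.sign_pow_sign_pow E.m_assoc)
    also have "\<dots> = sg (d + (int j - 1) + (1 + d)) (\<delta> (gen (ys ! (j - 1))) \<otimes>\<^bsub>E\<^esub> (gen y \<otimes>\<^bsub>E\<^esub> W (omit j ys)))"
      unfolding c using g W \<delta> by (simp add: E.sign_pow_mult_left E.sign_pow_sign_pow E.m_assoc)
    also have "\<dots> = ?t (y # ys) (Suc j)"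
      unfolding o n W_Cons by (intro E.sign_pow_cong) simp
    finally show ?thesis .
  qed
  have "\<delta> (W (y # ys)) = \<delta> (gen y) \<otimes>\<^bsub>E\<^esub> W ys \<oplus>\<^bsub>E\<^esub> sg d (gen y \<otimes>\<^bsub>E\<^esub> \<delta> (W ys))"
    using graded_derivation_mult[OF \<delta> \<Lambda>_gen, of y "W ys"] by simp
  also have "gen y \<otimes>\<^bsub>E\<^esub> \<delta> (W ys) = (\<Oplus>\<^bsub>E\<^esub> j\<in>{1..length ys}. gen y \<otimes>\<^bsub>E\<^esub> ?t ys j)"
    unfolding Cons.IH[OF ys(2)]
    by (rule E.finsum_rdistr) (use t[OF ys(2)] in \<open>simp_all add: Pi_def\<close>)
  also have "sg d \<dots> = (\<Oplus>\<^bsub>E\<^esub> j\<in>{1..length ys}. sg d (gen y \<otimes>\<^bsub>E\<^esub> ?t ys j))"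
    by (rule finsum_sg) (use t[OF ys(2)] in \<open>simp_all add: Pi_def\<close>)
  also have "\<dots> = (\<Oplus>\<^bsub>E\<^esub> j\<in>{1..length ys}. ?t (y # ys) (Suc j))"
    by (intro E.finsum_cong' step Pi_I t') simp_all
  also have "\<dots> = (\<Oplus>\<^bsub>E\<^esub> j\<in>Suc ` {1..length ys}. ?t (y # ys) j)"
    by (rule E.add.finprod_reindex[OF Pi_S, symmetric]) simp
  also have "\<delta> (gen y) \<otimes>\<^bsub>E\<^esub> W ys = ?t (y # ys) 1"
    by (simp add: omit_def sign_pow_def)
  also have "?t (y # ys) 1 \<oplus>\<^bsub>E\<^esub> (\<Oplus>\<^bsub>E\<^esub> j\<in>Suc ` {1..length ys}. ?t (y # ys) j) =
      (\<Oplus>\<^bsub>E\<^esub> j\<in>insert 1 (Suc ` {1..length ys}). ?t (y # ys) j)"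
    by (rule E.finsum_insert[OF _ _ Pi_S, symmetric]) (use t[OF Cons.prems, of 1] in simp_all)
  also have "insert 1 (Suc ` {1..length ys}) = {1..length (y # ys)}"
    by (auto simp: image_iff)
  finally show ?case .
qed

text \<open>Expanding over ys gives j - 1. Then \<open>[X, y] = - [y, X]\<close> gives 1, expanding
  \<open>ad y\<close> over xs gives i - 1, and turning \<open>br y x\<close> into
  \<open>- br x y\<close> gives 1 again. These exponents add up to i + j.\<close>

lemma bracket_W_W:
  assumes "xs \<in> lists (carrier G)" "ys \<in> lists (carrier G)"
  shows "bracket (W xs) (W ys) = (\<Oplus>\<^bsub>E\<^esub> i\<in>{1..length xs}. \<Oplus>\<^bsub>E\<^esub> j\<in>{1..length ys}.
    sg (int i + int j) (W [br (xs ! (i - 1)) (ys ! (j - 1))] \<otimes>\<^bsub>E\<^esub> W (omit i xs) \<otimes>\<^bsub>E\<^esub> W (omit j ys)))"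
proof -
  let ?t = "\<lambda>i j. sg (int i + int j)
    (W [br (xs ! (i - 1)) (ys ! (j - 1))] \<otimes>\<^bsub>E\<^esub> W (omit i xs) \<otimes>\<^bsub>E\<^esub> W (omit j ys))"
  note nth = nth_closed
  have W: "W (omit i xs) \<in> carrier E" "W (omit i ys) \<in> carrier E" for i
    by (intro W_closed omit_closed assms)+
  have t: "?t i j \<in> carrier E" if "i \<in> {1..length xs}" "j \<in> {1..length ys}" for i j
    using nth[OF assms(1) that(1)] nth[OF assms(2) that(2)] W by simp
  have step: "sg (int j - 1) (bracket (W xs) (gen (ys ! (j - 1))) \<otimes>\<^bsub>E\<^esub> W (omit j ys)) =
      (\<Oplus>\<^bsub>E\<^esub> i\<in>{1..length xs}. ?t i j)" if j: "j \<in> {1..length ys}" for j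
  proof -
    let ?y = "ys ! (j - 1)"
    let ?s = "\<lambda>i. sg (int i - 1) (gen (br ?y (xs ! (i - 1))) \<otimes>\<^bsub>E\<^esub> W (omit i xs))"
    have y: "?y \<in> carrier G" using nth assms(2) j .
    have s: "?s i \<in> carrier E" if "i \<in> {1..length xs}" for i
      using nth[OF assms(1) that] y W by simp
    have st: "sg (int j - 1) (sg 1 (?s i \<otimes>\<^bsub>E\<^esub> W (omit j ys))) = ?t i j" if i: "i \<in> {1..length xs}" for i
    proof -
      let ?x = "xs ! (i - 1)"
      have x: "?x \<in> carrier G" using nth assms(1) i .
      have g: "gen (br ?y ?x) = sg 1 (gen (br ?x ?y))"
        using br_anticommute[OF y x] gen_minus[OF br_closed[OF x y]] by (simp add: sign_pow_def)
      have "sg (int j - 1) (sg 1 (?s i \<otimes>\<^bsub>E\<^esub> W (omit j ys))) =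
          sg ((int j - 1) + (1 + ((int i - 1) + 1)))
            (gen (br ?x ?y) \<otimes>\<^bsub>E\<^esub> W (omit i xs) \<otimes>\<^bsub>E\<^esub> W (omit j ys))"
        unfolding g using x y W
        by (simp add: E.sign_pow_mult_left E.sign_pow_sign_pow)
      also have "\<dots> = ?t i j"
        using x y by (simp add: add.commute)
      finally show ?thesis .
    qed
    have "bracket (W xs) (gen ?y) = sg 1 (\<Oplus>\<^bsub>E\<^esub> i\<in>{1..length xs}. sg (int i - 1)
        (ad ?y (gen (xs ! (i - 1))) \<otimes>\<^bsub>E\<^esub> W (omit i xs)))"
      using y bracket_gen[OF \<Lambda>_W[OF assms(1)] y] graded_derivation_W[OF ad_gder[OF y] assms(1)]
      by (simp add: E.minus_eq_sign_pow)
    also have "\<dots> = sg 1 (\<Oplus>\<^bsub>E\<^esub> i\<in>{1..length xs}. ?s i)"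
      using nth[OF assms(1)] y s by (intro arg_cong[where f = "sg 1"] E.finsum_cong') (auto simp: ad_gen)
    finally have "bracket (W xs) (gen ?y) \<otimes>\<^bsub>E\<^esub> W (omit j ys) =
        sg 1 (\<Oplus>\<^bsub>E\<^esub> i\<in>{1..length xs}. ?s i \<otimes>\<^bsub>E\<^esub> W (omit j ys))"
      using s W E.finsum_ldistr[of "{1..length xs}" "W (omit j ys)" ?s]
      by (simp add: E.sign_pow_mult_left Pi_def)
    also have "\<dots> = (\<Oplus>\<^bsub>E\<^esub> i\<in>{1..length xs}. sg 1 (?s i \<otimes>\<^bsub>E\<^esub> W (omit j ys)))"
      using s W by (intro finsum_sg) simp_all
    finally have "sg (int j - 1) (bracket (W xs) (gen ?y) \<otimes>\<^bsub>E\<^esub> W (omit j ys)) =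
        sg (int j - 1) (\<Oplus>\<^bsub>E\<^esub> i\<in>{1..length xs}. sg 1 (?s i \<otimes>\<^bsub>E\<^esub> W (omit j ys)))"
      by simp
    also have "\<dots> = (\<Oplus>\<^bsub>E\<^esub> i\<in>{1..length xs}. sg (int j - 1) (sg 1 (?s i \<otimes>\<^bsub>E\<^esub> W (omit j ys))))"
      using s W by (intro finsum_sg) simp_all
    also have "\<dots> = (\<Oplus>\<^bsub>E\<^esub> i\<in>{1..length xs}. ?t i j)"
      using t j by (intro E.finsum_cong' st) auto
    finally show ?thesis .
  qed
  have "bracket (W xs) (W ys) =
      (\<Oplus>\<^bsub>E\<^esub> j\<in>{1..length ys}. sg (int j - 1) (bracket (W xs) (gen (ys ! (j - 1))) \<otimes>\<^bsub>E\<^esub> W (omit j ys)))"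
    using assms by (intro graded_derivation_W[OF bracket_gder[OF \<Lambda>_W]])
  also have "\<dots> = (\<Oplus>\<^bsub>E\<^esub> j\<in>{1..length ys}. \<Oplus>\<^bsub>E\<^esub> i\<in>{1..length xs}. ?t i j)"
    using t by (intro E.finsum_cong' step) (auto intro!: E.finsum_closed)
  also have "\<dots> = (\<Oplus>\<^bsub>E\<^esub> i\<in>{1..length xs}. \<Oplus>\<^bsub>E\<^esub> j\<in>{1..length ys}. ?t i j)"
    using t by (intro finsum_swap) auto
  finally show ?thesis .
qed

lemma contraction_W:
  assumes "xs \<in> lists (carrier G)" "a \<in> carrier A"
  shows "contraction a (W xs) =
    (\<Oplus>\<^bsub>E\<^esub> i\<in>{1..length xs}. sg (int i) (\<rho> (xs ! (i - 1)) a \<odot>\<^bsub>E\<^esub> W (omit i xs)))"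
proof -
  have "contraction a (W xs) = (\<Oplus>\<^bsub>E\<^esub> i\<in>{1..length xs}. sg (int i - 1)
      (contraction a (gen (xs ! (i - 1))) \<otimes>\<^bsub>E\<^esub> W (omit i xs)))"
    using assms by (intro graded_derivation_W[OF contraction_gder])
  also have "\<dots> = (\<Oplus>\<^bsub>E\<^esub> i\<in>{1..length xs}. sg (int i) (\<rho> (xs ! (i - 1)) a \<odot>\<^bsub>E\<^esub> W (omit i xs)))"
  proof (rule E.finsum_cong'[OF refl])
    have nth: "xs ! (i - 1) \<in> carrier G" "W (omit i xs) \<in> carrier E" if "i \<in> {1..length xs}" for i
      by (rule nth_closed[OF assms(1) that], rule W_closed[OF omit_closed[OF assms(1)]])
    then show "(\<lambda>i. sg (int i) (\<rho> (xs ! (i - 1)) a \<odot>\<^bsub>E\<^esub> W (omit i xs))) \<in>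
        {1..length xs} \<rightarrow> carrier E"
      using assms(2) by (simp add: smult_E Pi_def)
    fix i assume "i \<in> {1..length xs}"
    from nth[OF this] show "sg (int i - 1) (contraction a (gen (xs ! (i - 1))) \<otimes>\<^bsub>E\<^esub> W (omit i xs)) =
        sg (int i) (\<rho> (xs ! (i - 1)) a \<odot>\<^bsub>E\<^esub> W (omit i xs))"
      using assms(2)
      by (simp add: smult_E contraction_gen E.minus_eq_sign_pow E.sign_pow_mult_left E.sign_pow_sign_pow)
  qed
  finally show ?thesis .
qed

lemma bracket_W_cst:
  assumes "xs \<in> lists (carrier G)" "a \<in> carrier A"
  shows "bracket (W xs) (cst a) = (\<Oplus>\<^bsub>E\<^esub> i\<in>{1..length xs}.
    sg (int (length xs) - int i) (\<rho> (xs ! (i - 1)) a \<odot>\<^bsub>E\<^esub> W (omit i xs)))"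
proof -
  have c: "\<rho> (xs ! (i - 1)) a \<odot>\<^bsub>E\<^esub> W (omit i xs) \<in> carrier E" if "i \<in> {1..length xs}" for i
    using nth_closed[OF assms(1) that] assms(2) W_closed[OF omit_closed[OF assms(1), of i]]
    by (simp add: smult_E)
  have "bracket (W xs) (cst a) = sg (int (length xs))
      (\<Oplus>\<^bsub>E\<^esub> i\<in>{1..length xs}. sg (int i) (\<rho> (xs ! (i - 1)) a \<odot>\<^bsub>E\<^esub> W (omit i xs)))"
    using assms by (simp only: bracket_cst[OF \<Lambda>_W] contraction_W)
  also have "\<dots> = (\<Oplus>\<^bsub>E\<^esub> i\<in>{1..length xs}. sg (int (length xs))
      (sg (int i) (\<rho> (xs ! (i - 1)) a \<odot>\<^bsub>E\<^esub> W (omit i xs))))"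
    using c by (intro finsum_sg) simp_all
  also have "\<dots> = (\<Oplus>\<^bsub>E\<^esub> i\<in>{1..length xs}.
      sg (int (length xs) - int i) (\<rho> (xs ! (i - 1)) a \<odot>\<^bsub>E\<^esub> W (omit i xs)))"
    using c by (intro E.finsum_cong' Pi_I) (simp_all add: E.sign_pow_sign_pow E.sign_pow_cong)
  finally show ?thesis .
qed

section \<open>The Gerstenhaber algebra\<close>

text \<open>Scalars from K act through the constants \<open>k \<odot> \<one>\<close>, which every
  value of the anchor kills. Combined with the Leibniz rule this makes the bracket linear over
  K.\<close>

lemma contraction_scalar:
  assumes "k \<in> carrier K" "P \<in> carrier E" shows "contraction (k \<odot>\<^bsub>A\<^esub> \<one>\<^bsub>A\<^esub>) P = \<zero>\<^bsub>E\<^esub>"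
  by (rule graded_derivation_unique[where d = "-1" and P = P and \<epsilon> = "\<lambda>_. \<zero>\<^bsub>E\<^esub>"])
    (use assms in \<open>simp_all add: contraction_gder graded_derivation_const_zero contraction_cst contraction_gen \<rho>_scalar\<close>)

lemma bracket_scalar_right:
  assumes "k \<in> carrier K" "P \<in> carrier E" "Q \<in> carrier E"
  shows "bracket P (cst (k \<odot>\<^bsub>A\<^esub> \<one>\<^bsub>A\<^esub>) \<otimes>\<^bsub>E\<^esub> Q) = cst (k \<odot>\<^bsub>A\<^esub> \<one>\<^bsub>A\<^esub>) \<otimes>\<^bsub>E\<^esub> bracket P Q"
  using assms(2)
proof (induction rule: E_graded_induct)
  case (homogeneous p P)
  then have "bracket P (cst (k \<odot>\<^bsub>A\<^esub> \<one>\<^bsub>A\<^esub>)) = \<zero>\<^bsub>E\<^esub>"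
    using assms contraction_scalar[OF assms(1)] by (simp add: bracket_cst \<Lambda>_closed)
  then show ?case
    using homogeneous assms graded_derivation_mult[OF bracket_gder[OF homogeneous] \<Lambda>_cst[of "k \<odot>\<^bsub>A\<^esub> \<one>\<^bsub>A\<^esub>"] assms(3)]
    by (simp add: sign_pow_def \<Lambda>_closed)
next
  case (add P P')
  then show ?case using assms by (simp add: bracket_add_left E.r_distr)
qed

text \<open>Linearity is carried over from the second argument by antisymmetry, which is available
  for homogeneous elements only; hence the nested inductions over the grading.\<close>

lemma bracket_scalar_left:
  assumes "k \<in> carrier K" "P \<in> carrier E" "Q \<in> carrier E"
  shows "bracket (cst (k \<odot>\<^bsub>A\<^esub> \<one>\<^bsub>A\<^esub>) \<otimes>\<^bsub>E\<^esub> P) Q = cst (k \<odot>\<^bsub>A\<^esub> \<one>\<^bsub>A\<^esub>) \<otimes>\<^bsub>E\<^esub> bracket P Q"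
  using assms(2)
proof (induction rule: E_graded_induct)
  case P: (homogeneous p P)
  from assms(3) show ?case
  proof (induction rule: E_graded_induct)
    case (homogeneous q Q)
    then show ?case
      using P assms bracket_antisym[OF \<Lambda>_cst_mult[OF _ P], of "k \<odot>\<^bsub>A\<^esub> \<one>\<^bsub>A\<^esub>" Q q] bracket_antisym[OF P homogeneous]
      by (simp add: bracket_scalar_right \<Lambda>_closed E.sign_pow_mult_right E.r_minus)
  next
    case (add Q Q')
    then show ?case using P assms by (simp add: bracket_add_right E.r_distr \<Lambda>_closed)
  qed
next
  case (add P P')
  then show ?case using assms by (simp add: bracket_add_left E.r_distr)
qed

lemma bracket_bilinear: "bilinear_op K (restrict_scalars A E) bracket"
  by (simp add: bilinear_op_def Pi_def bracket_add_left bracket_add_right smult_E bracket_scalar_left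
      bracket_scalar_right)

lemma mult_bilinear: "bilinear_op K (restrict_scalars A E) (mult E)"
  by (simp add: bilinear_op_def Pi_def E.l_distr E.r_distr smult_E E.m_assoc[symmetric]
      cst_central)

section \<open>Characterisation by the Schouten--Nijenhuis formulas\<close>

definition restricted_bracket where
  "restricted_bracket = (\<lambda>P\<in>carrier E. \<lambda>Q\<in>carrier E. bracket P Q)"

lemma restricted_bracket_eq [simp]: "P \<in> carrier E \<Longrightarrow> Q \<in> carrier E \<Longrightarrow> restricted_bracket P Q = bracket P Q"
  by (simp add: restricted_bracket_def)

lemma restricted_bracket_bilinear: "bilinear_op K (restrict_scalars A E) restricted_bracket"
  using bracket_bilinear by (simp add: bilinear_op_def smult_E Pi_def)

lemma restricted_bracket_schouten: "is_schouten_bracket K A G br \<rho> restricted_bracket"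
  unfolding is_schouten_bracket_def Let_def
  by (simp add: restricted_bracket_bilinear bracket_W_W bracket_W_cst bracket_cst_left contraction_W contraction_cst
      del: in_lists_conv_set W_Cons)

text \<open>The defining formulas treat wedges without coefficients and constants separately. A
  coefficient is absorbed into the first factor of a nonempty wedge; the empty wedge is covered by
  the constants.\<close>

lemma E_wedge_induct [consumes 1, case_names add cst wedge]:
  assumes "P \<in> carrier E"
    and add: "\<And>P Q. P \<in> carrier E \<Longrightarrow> Q \<in> carrier E \<Longrightarrow> Pr P \<Longrightarrow> Pr Q \<Longrightarrow> Pr (P \<oplus>\<^bsub>E\<^esub> Q)"
    and cst: "\<And>a. a \<in> carrier A \<Longrightarrow> Pr (cst a)"
    and wedge: "\<And>xs. xs \<in> lists (carrier G) \<Longrightarrow> xs \<noteq> [] \<Longrightarrow> Pr (W xs)"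
  shows "Pr P"
  using assms(1)
proof (induction rule: E_induct)
  case zero
  then show ?case using cst[of "\<zero>\<^bsub>A\<^esub>"] by simp
next
  case (monomial a w)
  show ?case
  proof (cases w)
    case Nil
    then show ?thesis using cst monomial by simp
  next
    case (Cons x u)
    then have "cst a \<otimes>\<^bsub>E\<^esub> W w = W ((a \<odot>\<^bsub>G\<^esub> x) # u)"
      using monomial by (simp add: gen_smult E.m_assoc)
    then show ?thesis using wedge[of "(a \<odot>\<^bsub>G\<^esub> x) # u"] monomial Cons by simp
  qed
qed (rule add)

lemma schouten_unique:
  assumes "is_schouten_bracket K A G br \<rho> B" "is_schouten_bracket K A G br \<rho> B'"
    and "P \<in> carrier E" "Q \<in> carrier E"
  shows "B P Q = B' P Q"
proof -
  note B = assms(1,2)[unfolded is_schouten_bracket_def Let_def bilinear_op_def]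
  from assms(3) show ?thesis
  proof (induction rule: E_wedge_induct)
    case (add P P')
    then show ?case using B assms(4) by simp
  next
    case (cst a)
    from assms(4) show ?case
    proof (induction rule: E_wedge_induct)
      case (add Q Q')
      then show ?case using B cst by simp
    qed (use B cst in \<open>simp_all del: in_lists_conv_set\<close>)
  next
    case (wedge xs)
    then have W: "W xs \<in> carrier E" by simp
    from assms(4) show ?case
    proof (induction rule: E_wedge_induct)
      case (add Q Q')
      then show ?case using B W by simp
    qed (use B wedge in \<open>simp_all del: in_lists_conv_set\<close>)
  qed
qed

text \<open>The formulas fix the map on the carrier by \<open>schouten_unique\<close>, and
  extensionality in each argument fixes it elsewhere. This is why the constructed bracket was cut
  down to the carrier in both arguments.\<close>

lemma schouten_bracket_eq: "schouten_bracket K A G br \<rho> = restricted_bracket"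
  unfolding schouten_bracket_def
proof (rule the_equality)
  show "is_schouten_bracket K A G br \<rho> restricted_bracket \<and> restricted_bracket \<in> extensional (carrier E) \<and>
      (\<forall>P\<in>carrier E. restricted_bracket P \<in> extensional (carrier E))"
    using restricted_bracket_schouten by (simp add: restricted_bracket_def)
next
  fix B assume B: "is_schouten_bracket K A G br \<rho> B \<and> B \<in> extensional (carrier E) \<and>
      (\<forall>P\<in>carrier E. B P \<in> extensional (carrier E))"
  show "B = restricted_bracket"
  proof (rule extensionalityI[of _ "carrier E"])
    fix P assume P: "P \<in> carrier E"
    show "B P = restricted_bracket P"
    proof (rule extensionalityI[of _ "carrier E"])
      show "B P Q = restricted_bracket P Q" if "Q \<in> carrier E" for Q
        using schouten_unique[OF _ restricted_bracket_schouten P that] B by blast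
    qed (use B P in \<open>simp_all add: restricted_bracket_def\<close>)
  qed (use B in \<open>simp_all add: restricted_bracket_def\<close>)
qed

lemma restricted_module: "module K (restrict_scalars A E)"
proof (rule moduleI)
  show "abelian_group (restrict_scalars A E)"
    by (rule ring.is_abelian_group[OF ring_cong[OF E_ring]]) simp_all
  fix k l P assume "k \<in> carrier K" "l \<in> carrier K" "P \<in> carrier (restrict_scalars A E)"
  moreover from this have "(k \<otimes>\<^bsub>K\<^esub> l) \<odot>\<^bsub>A\<^esub> \<one>\<^bsub>A\<^esub> = (k \<odot>\<^bsub>A\<^esub> \<one>\<^bsub>A\<^esub>) \<otimes>\<^bsub>A\<^esub> (l \<odot>\<^bsub>A\<^esub> \<one>\<^bsub>A\<^esub>)"
    by (simp add: KA.smult_assoc1 KA.smult_assoc2)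
  ultimately show "(k \<otimes>\<^bsub>K\<^esub> l) \<odot>\<^bsub>restrict_scalars A E\<^esub> P =
      k \<odot>\<^bsub>restrict_scalars A E\<^esub> (l \<odot>\<^bsub>restrict_scalars A E\<^esub> P)"
    by (simp add: smult_E cst_mult E.m_assoc)
qed (simp_all add: KA.R_cring smult_E KA.smult_l_distr cst_add E.l_distr E.r_distr)

lemma gerstenhaber: "gerstenhaber_algebra K (restrict_scalars A E) \<Lambda> restricted_bracket"
proof -
  interpret R: module K "restrict_scalars A E"
    by (rule restricted_module)
  show ?thesis
  proof (intro gerstenhaber_algebra.intro graded_commutative_algebra.intro
      gerstenhaber_algebra_axioms.intro)
    show "ring (restrict_scalars A E)"
      by (rule ring_cong[OF E_ring]) simp_all
    show "submodule (\<Lambda> p) K (restrict_scalars A E)" for p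
      by (rule R.submoduleI) (simp_all add: smult_E \<Lambda>_closed subset_iff)
    fix P assume "P \<in> carrier (restrict_scalars A E)"
    then have P: "P \<in> carrier E" by simp
    show "\<exists>!c. (\<forall>p. c p \<in> \<Lambda> p) \<and> finite {p. c p \<noteq> \<zero>\<^bsub>restrict_scalars A E\<^esub>} \<and>
        P = (\<Oplus>\<^bsub>restrict_scalars A E\<^esub>p\<in>{p. c p \<noteq> \<zero>\<^bsub>restrict_scalars A E\<^esub>}. c p)"
    proof (rule ex1I[of _ "\<lambda>p. component p P"])
      fix c
      assume "(\<forall>p. c p \<in> \<Lambda> p) \<and> finite {p. c p \<noteq> \<zero>\<^bsub>restrict_scalars A E\<^esub>} \<and>
        P = (\<Oplus>\<^bsub>restrict_scalars A E\<^esub>p\<in>{p. c p \<noteq> \<zero>\<^bsub>restrict_scalars A E\<^esub>}. c p)"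
      then have "c p = component p P" for p
        unfolding restrict_scalars_simps finsum_restrict_scalars
        by (elim conjE) (rule decomposition_unique)
      then show "c = (\<lambda>p. component p P)" ..
    qed (unfold restrict_scalars_simps finsum_restrict_scalars,
        use component_\<Lambda>[OF P] component_finite_sum[OF P] in blast)
  next
    fix P Q p q assume *: "P \<in> \<Lambda> p" "Q \<in> \<Lambda> q"
    then have [simp]: "P \<in> carrier E" "Q \<in> carrier E" by (simp_all add: \<Lambda>_closed)
    show "P \<otimes>\<^bsub>restrict_scalars A E\<^esub> Q \<in> \<Lambda> (p + q)"
      using * by (simp add: \<Lambda>_mult)
    show "P \<otimes>\<^bsub>restrict_scalars A E\<^esub> Q = sign_pow (restrict_scalars A E) (p * q) (Q \<otimes>\<^bsub>restrict_scalars A E\<^esub> P)"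
      using graded_commute[OF *] by simp
    show "restricted_bracket P Q \<in> \<Lambda> (p + q - 1)"
      using * by (simp add: bracket_\<Lambda>)
    show "restricted_bracket P Q = \<ominus>\<^bsub>restrict_scalars A E\<^esub> sign_pow (restrict_scalars A E) ((p - 1) * (q - 1)) (restricted_bracket Q P)"
      using bracket_antisym[OF *] by simp
    fix R r assume R: "R \<in> \<Lambda> r"
    then have [simp]: "R \<in> carrier E" by (simp add: \<Lambda>_closed)
    show "sign_pow (restrict_scalars A E) ((p - 1) * (r - 1)) (restricted_bracket P (restricted_bracket Q R)) \<oplus>\<^bsub>restrict_scalars A E\<^esub>
        sign_pow (restrict_scalars A E) ((q - 1) * (p - 1)) (restricted_bracket Q (restricted_bracket R P)) \<oplus>\<^bsub>restrict_scalars A E\<^esub>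
        sign_pow (restrict_scalars A E) ((r - 1) * (q - 1)) (restricted_bracket R (restricted_bracket P Q)) =
        \<zero>\<^bsub>restrict_scalars A E\<^esub>"
      using cyclic_jacobi[OF * R] by (simp add: cyclic_jacobi_def)
    show "restricted_bracket P (Q \<otimes>\<^bsub>restrict_scalars A E\<^esub> R) = restricted_bracket P Q \<otimes>\<^bsub>restrict_scalars A E\<^esub> R \<oplus>\<^bsub>restrict_scalars A E\<^esub>
        sign_pow (restrict_scalars A E) ((p - 1) * q) (Q \<otimes>\<^bsub>restrict_scalars A E\<^esub> restricted_bracket P R)"
      using graded_derivation_mult[OF bracket_gder[OF *(1)] *(2), of R] by simp
  qed (simp_all add: restricted_module restricted_bracket_bilinear mult_bilinear)
qed

end

theorem theorem4p4:
  fixes K :: "('k, 'm) ring_scheme"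
    and A :: "('k, 'a, 'n) module_scheme"
    and G :: "('a, 'g, 'l) module_scheme"
    and br :: "'g \<Rightarrow> 'g \<Rightarrow> 'g"
    and \<rho> :: "'g \<Rightarrow> 'a \<Rightarrow> 'a"
  assumes "field K"
    and char_zero: "\<And>n::nat. n > 0 \<Longrightarrow> add_pow K n \<one>\<^bsub>K\<^esub> \<noteq> \<zero>\<^bsub>K\<^esub>"
    and "algebra K A"
    and "lie_rinehart K A G br \<rho>"
  shows "gerstenhaber_algebra K (restrict_scalars A (ext_algebra A G)) (ext_power A G)
           (schouten_bracket K A G br \<rho>)"
proof -
  interpret lie_rinehart K A G br \<rho> by fact
  show ?thesis
    unfolding schouten_bracket_eq by (rule gerstenhaber)
qed

end
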